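(* Let $\mathbb{G}$ be a discrete quantum group and suppose that $C_r(\widehat{\mathbb{G}})$ admits a tracial state. Then $\widehat{\mathbb{G}}_{rKac}=\widehat{\mathbb{G}}_{Kac}$ as closed quantum subgroups of $\widehat{\mathbb{G}}$, and $\widehat{\mathbb{G}}/\widehat{\mathbb{G}}_{rKac}$ is coamenable.
   Context: A discrete quantum group (DQG) $\mathbb{G}$ is a locally compact quantum group (Kustermans–Vaes) whose dual $\widehat{\mathbb{G}}$ is a compact quantum group (CQG). $\mathrm{Pol}(\widehat{\mathbb{G}})$ is the Hopf $*$-algebra spanned by matrix coefficients of irreducible unitary representations of $\widehat{\mathbb{G}}$, with coproduct $\Delta_{\widehat{\mathbb{G}}}$, counit $\epsilon_{\widehat{\mathbb{G}}}$ and Haar state $h_{\widehat{\mathbb{G}}}$. $C_u(\widehat{\mathbb{G}})$ and $C_r(\widehat{\mathbb{G}})$ are its universal and reduced (GNS of $h_{\widehat{\mathbb{G}}}$) $C^*$-completions, $\Gamma_{\widehat{\mathbb{G}}}:C_u(\widehat{\mathbb{G}})\to C_r(\widehat{\mathbb{G}})$ is the canonical surjection, and $\epsilon^u_{\widehat{\mathbb{G}}}$ is the extension of the counit to $C_u(\widehat{\mathbb{G}})$. A CQG is of Kac type if its Haar state is tracial. For a DQG $\mathbb{H}$, $\widehat{\mathbb{H}}\le\widehat{\mathbb{G}}$ (closed quantum subgroup) means there is a surjective unital $*$-homomorphism $\pi_{\widehat{\mathbb{H}}}:\mathrm{Pol}(\widehat{\mathbb{G}})\to\mathrm{Pol}(\widehat{\mathbb{H}})$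 intertwining coproducts. Two closed quantum subgroups $\widehat{\mathbb{K}},\widehat{\mathbb{H}}\le\widehat{\mathbb{G}}$ are equal if $\ker\pi_{\widehat{\mathbb{K}}}=\ker\pi_{\widehat{\mathbb{H}}}$. Put $\mathrm{Pol}(\widehat{\mathbb{G}}/\widehat{\mathbb{H}})=\{a\in\mathrm{Pol}(\widehat{\mathbb{G}}):(\mathrm{id}\otimes\pi_{\widehat{\mathbb{H}}})\Delta_{\widehat{\mathbb{G}}}(a)=a\otimes1\}$, and let $C_u(\widehat{\mathbb{G}}/\widehat{\mathbb{H}})$, $C_r(\widehat{\mathbb{G}}/\widehat{\mathbb{H}})$ be its norm closures in $C_u(\widehat{\mathbb{G}})$, $C_r(\widehat{\mathbb{G}})$. $\widehat{\mathbb{G}}/\widehat{\mathbb{H}}$ is coamenable if there is a state $\epsilon^r\in C_r(\widehat{\mathbb{G}}/\widehat{\mathbb{H}})^*$ with $\epsilon^r\circ\Gamma_{\widehat{\mathbb{G}}}=\epsilon^u_{\widehat{\mathbb{G}}}$ on $C_u(\widehat{\mathbb{G}}/\widehat{\mathbb{H}})$. Canonical Kac quotient (Sołtan): let $I_{Kac}=\{a\in C_u(\widehat{\mathbb{G}}):\tau(aa^* )=0\text{ for every tracial state }\tau\in C_u(\widehat{\mathbb{G}})^*\}$, a closed two-sided ideal. The quotient $C_u(\widehat{\mathbb{G}})/I_{Kac}$ carries a unique coproduct making the quotient map intertwine coproducts, and is a (possibly exotic) $C^*$-completion of $\mathrm{Pol}$ of a Kac type CQG, denoted $\widehat{\mathbb{G}}_{Kac}$;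 $\mathrm{Pol}(\widehat{\mathbb{G}}_{Kac})$ is the image of $\mathrm{Pol}(\widehat{\mathbb{G}})$ in this quotient, so $\widehat{\mathbb{G}}_{Kac}\le\widehat{\mathbb{G}}$. Reduced version: let $I^r_{Kac}=\{a\in C_r(\widehat{\mathbb{G}}):\tau(aa^* )=0\text{ for every tracial state }\tau\in C_r(\widehat{\mathbb{G}})^*\}$. If $C_r(\widehat{\mathbb{G}})$ has a tracial state, then in the same way $C_r(\widehat{\mathbb{G}})/I^r_{Kac}$ is a (possibly exotic) $C^*$-completion of $\mathrm{Pol}$ of a Kac type CQG, denoted $\widehat{\mathbb{G}}_{rKac}$, and $\mathrm{Pol}(\widehat{\mathbb{G}}_{rKac})$ is the image of $\mathrm{Pol}(\widehat{\mathbb{G}})$ in $C_r(\widehat{\mathbb{G}})/I^r_{Kac}$, so $\widehat{\mathbb{G}}_{rKac}\le\widehat{\mathbb{G}}$. *)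

theory Defs
  imports "HOL-Analysis.Analysis"
begin

section \<open>Complex *-algebras and C*-algebras\<close>

class scaleC =
  fixes scaleC :: "complex \<Rightarrow> 'a \<Rightarrow> 'a"  (infixr "*\<^sub>C" 75)

class complex_vector = scaleC + ab_group_add +
  assumes scaleC_add_right: "c *\<^sub>C (x + y) = c *\<^sub>C x + c *\<^sub>C y"
    and scaleC_add_left: "(c + d) *\<^sub>C x = c *\<^sub>C x + d *\<^sub>C x"
    and scaleC_scaleC: "c *\<^sub>C d *\<^sub>C x = (c * d) *\<^sub>C x"
    and scaleC_one: "1 *\<^sub>C x = x"

global_interpretation complex_vector: vector_space "scaleC :: complex \<Rightarrow> 'a \<Rightarrow> 'a::complex_vector"
  by unfold_locales (simp_all add: scaleC_add_right scaleC_add_left scaleC_scaleC scaleC_one)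

global_interpretation complex_vector: vector_space_pair
    "scaleC :: complex \<Rightarrow> 'a \<Rightarrow> 'a::complex_vector" "scaleC :: complex \<Rightarrow> 'b \<Rightarrow> 'b::complex_vector"
  by unfold_locales

abbreviation cspan :: "'a::complex_vector set \<Rightarrow> 'a set"
  where "cspan \<equiv> complex_vector.span"

abbreviation clinear :: "('a::complex_vector \<Rightarrow> 'b::complex_vector) \<Rightarrow> bool"
  where "clinear \<equiv> Vector_Spaces.linear (*\<^sub>C) (*\<^sub>C)"

definition cbilinear :: "('a::complex_vector \<Rightarrow> 'b::complex_vector \<Rightarrow> 'c::complex_vector) \<Rightarrow> bool"
  where "cbilinear B \<longleftrightarrow> (\<forall>x. clinear (\<lambda>y. B x y)) \<and> (\<forall>y. clinear (\<lambda>x. B x y))"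

lemma clinear_iff:
  "clinear f \<longleftrightarrow> (\<forall>x y. f (x + y) = f x + f y) \<and> (\<forall>c x. f (c *\<^sub>C x) = c *\<^sub>C f x)"
proof -
  have "module ((*\<^sub>C) :: complex \<Rightarrow> 'a \<Rightarrow> 'a)" "module ((*\<^sub>C) :: complex \<Rightarrow> 'b \<Rightarrow> 'b)"
    by unfold_locales
  moreover have "vector_space ((*\<^sub>C) :: complex \<Rightarrow> 'a \<Rightarrow> 'a)" "vector_space ((*\<^sub>C) :: complex \<Rightarrow> 'b \<Rightarrow> 'b)"
    by unfold_locales
  ultimately show ?thesis
    by (auto simp: Vector_Spaces.linear_def module_hom_def module_hom_axioms_def)
qed

lemma clinear_compose: "clinear f \<Longrightarrow> clinear g \<Longrightarrow> clinear (\<lambda>x. f (g x))"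
  by (simp add: clinear_iff)

text \<open>Not \<^class>\<open>ring_1\<close>, which would exclude the zero algebra.\<close>

class complex_algebra_1 = complex_vector + ring + monoid_mult +
  assumes mult_scaleC_left: "(c *\<^sub>C x) * y = c *\<^sub>C (x * y)"
    and mult_scaleC_right: "x * (c *\<^sub>C y) = c *\<^sub>C (x * y)"

class complex_star_algebra = complex_algebra_1 +
  fixes star :: "'a \<Rightarrow> 'a"
  assumes star_star: "star (star x) = x"
    and star_add: "star (x + y) = star x + star y"
    and star_mult: "star (x * y) = star y * star x"
    and star_scaleC: "star (c *\<^sub>C x) = cnj c *\<^sub>C star x"

class cstar_algebra = complex_star_algebra + real_normed_algebra + banach +
  assumes scaleR_scaleC: "scaleR r x = of_real r *\<^sub>C x"
    and norm_scaleC: "norm (c *\<^sub>C x) = cmod c * norm x"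
    and cstar_identity: "norm (star x * x) = (norm x)\<^sup>2"

instantiation complex :: complex_star_algebra
begin
definition scaleC_complex :: "complex \<Rightarrow> complex \<Rightarrow> complex" where "scaleC_complex c x = c * x"
definition star_complex :: "complex \<Rightarrow> complex" where "star_complex x = cnj x"
instance
  by standard (simp_all add: scaleC_complex_def star_complex_def algebra_simps)
end

definition star_hom :: "('a::complex_star_algebra \<Rightarrow> 'b::complex_star_algebra) \<Rightarrow> bool"
  where "star_hom f \<longleftrightarrow>
    clinear f \<and> f 1 = 1 \<and> (\<forall>x y. f (x * y) = f x * f y) \<and> (\<forall>x. f (star x) = star (f x))"

section \<open>The algebraic tensor product\<close>

text \<open>
  The list \<open>[(a\<^sub>1, b\<^sub>1), \<dots>, (a\<^sub>n, b\<^sub>n)]\<close> represents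
  \<open>a\<^sub>1 \<otimes> b\<^sub>1 + \<dots> + a\<^sub>n \<otimes> b\<^sub>n\<close>; two such sums are the same tensor iff all bilinear forms agree
  on them. All operations below are the usual ones on elementary tensors, and
  \<open>tensor_lift_tensor\<close>, \<open>cbilinear_tensor\<close>, \<open>clinear_tensor_lift\<close> and
  \<open>tensor_sum_list\<close> give the universal property.
\<close>

definition eval_form :: "('a \<Rightarrow> 'b \<Rightarrow> 'c) \<Rightarrow> ('a \<times> 'b) list \<Rightarrow> 'c::comm_monoid_add"
  where "eval_form B xs = (\<Sum>(a, b)\<leftarrow>xs. B a b)"

lemma eval_form_simps [simp]:
  "eval_form B [] = 0"
  "eval_form B (p # xs) = B (fst p) (snd p) + eval_form B xs"
  "eval_form B (xs @ ys) = eval_form B xs + eval_form B ys"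
  by (simp_all add: eval_form_def split_def)

definition tensor_eq ::
    "('a::complex_vector \<times> 'b::complex_vector) list \<Rightarrow> ('a \<times> 'b) list \<Rightarrow> bool"
  where "tensor_eq xs ys \<longleftrightarrow>
    (\<forall>\<beta> :: 'a \<Rightarrow> 'b \<Rightarrow> complex. cbilinear \<beta> \<longrightarrow> eval_form \<beta> xs = eval_form \<beta> ys)"

quotient_type (overloaded) ('a, 'b) tensor  (infixr "\<otimes>" 72) =
    "('a::complex_vector \<times> 'b::complex_vector) list" / tensor_eq
  by (rule equivpI) (auto simp: reflp_def symp_def transp_def tensor_eq_def)

lift_definition tensor :: "'a::complex_vector \<Rightarrow> 'b::complex_vector \<Rightarrow> 'a \<otimes> 'b"  (infixr "\<otimes>" 72)
  is "\<lambda>a b. [(a, b)]" .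

text \<open>The map \<open>a \<otimes> b \<mapsto> B a b\<close> induced by a bilinear map \<open>B\<close>.\<close>

definition tensor_lift ::
    "('a::complex_vector \<Rightarrow> 'b::complex_vector \<Rightarrow> 'c::complex_vector) \<Rightarrow> 'a \<otimes> 'b \<Rightarrow> 'c"
  where "tensor_lift B t = eval_form B (rep_tensor t)"

definition tensor_map ::
    "('a::complex_vector \<Rightarrow> 'c::complex_vector) \<Rightarrow> ('b::complex_vector \<Rightarrow> 'd::complex_vector)
      \<Rightarrow> 'a \<otimes> 'b \<Rightarrow> 'c \<otimes> 'd"
  where "tensor_map f g t = abs_tensor (map (\<lambda>(a, b). (f a, g b)) (rep_tensor t))"

lemma cbilinear_iff:
  "cbilinear B \<longleftrightarrow>
    (\<forall>x y z. B (x + y) z = B x z + B y z) \<and> (\<forall>x y z. B x (y + z) = B x y + B x z) \<and>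
    (\<forall>c x y. B (c *\<^sub>C x) y = c *\<^sub>C B x y) \<and> (\<forall>c x y. B x (c *\<^sub>C y) = c *\<^sub>C B x y)"
  unfolding cbilinear_def clinear_iff by blast

lemma clinear_eval_form:
  assumes "clinear f"
  shows "f (eval_form B xs) = eval_form (\<lambda>a b. f (B a b)) xs"
proof -
  have "f 0 = 0" "\<And>x y. f (x + y) = f x + f y"
    using assms complex_vector.linear_0 unfolding clinear_iff by blast+
  then show ?thesis by (induction xs) auto
qed

lemma clinear_separating:
  fixes x :: "'a::complex_vector"
  assumes "\<And>f :: 'a \<Rightarrow> complex. clinear f \<Longrightarrow> f x = 0"
  shows "x = 0"
proof (rule ccontr)
  assume "x \<noteq> 0"
  then have "complex_vector.independent {x}" by simp
  from complex_vector.linear_independent_extend[OF this, of "\<lambda>_. 1"]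
  obtain f :: "'a \<Rightarrow> complex" where f: "clinear f" "f x = 1" by auto
  from assms[OF f(1)] f(2) show False by simp
qed

lemma tensor_eq_eval_form:
  fixes B :: "'a::complex_vector \<Rightarrow> 'b::complex_vector \<Rightarrow> 'c::complex_vector"
  assumes "tensor_eq xs ys" and B: "cbilinear B"
  shows "eval_form B xs = eval_form B ys"
proof -
  have "f (eval_form B xs - eval_form B ys) = 0" if f: "clinear f" for f :: "'c \<Rightarrow> complex"
  proof -
    have "cbilinear (\<lambda>a b. f (B a b))"
      using B f by (simp add: cbilinear_iff clinear_iff)
    then have "f (eval_form B xs) = f (eval_form B ys)"
      using assms(1) by (simp add: clinear_eval_form[OF f] tensor_eq_def)
    then show ?thesis using f by (simp add: complex_vector.linear_diff)
  qed
  then show ?thesis using clinear_separating by fastforce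
qed

lemma tensor_eq_rep_abs: "tensor_eq (rep_tensor (abs_tensor xs)) xs"
  using Quotient_rep_abs[OF Quotient_tensor] by (simp add: tensor_eq_def)

lemma tensor_lift_abs: "cbilinear B \<Longrightarrow> tensor_lift B (abs_tensor xs) = eval_form B xs"
  unfolding tensor_lift_def by (intro tensor_eq_eval_form tensor_eq_rep_abs)

lemma tensor_lift_tensor: "cbilinear B \<Longrightarrow> tensor_lift B (a \<otimes> b) = B a b"
  by (simp add: tensor.abs_eq tensor_lift_abs)

lemma eval_form_map:
  "eval_form B (map (\<lambda>(a, b). (f a b, g a b)) xs) = eval_form (\<lambda>a b. B (f a b) (g a b)) xs"
  by (induction xs) auto

lemma tensor_map_abs:
  assumes "clinear f" "clinear g"
  shows "tensor_map f g (abs_tensor xs) = abs_tensor (map (\<lambda>(a, b). (f a, g b)) xs)"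
proof -
  have "tensor_eq (map (\<lambda>(a, b). (f a, g b)) (rep_tensor (abs_tensor xs))) (map (\<lambda>(a, b). (f a, g b)) xs)"
    unfolding tensor_eq_def eval_form_map
  proof (intro allI impI tensor_eq_eval_form tensor_eq_rep_abs)
    fix \<beta> :: "'b \<Rightarrow> 'd \<Rightarrow> complex" assume "cbilinear \<beta>"
    with assms show "cbilinear (\<lambda>a b. \<beta> (f a) (g b))"
      by (simp add: cbilinear_iff clinear_iff)
  qed
  then show ?thesis by (simp add: tensor_map_def tensor.abs_eq_iff)
qed

lemma tensor_map_tensor: "clinear f \<Longrightarrow> clinear g \<Longrightarrow> tensor_map f g (a \<otimes> b) = f a \<otimes> g b"
  by (simp add: tensor.abs_eq tensor_map_abs)

instantiation tensor :: (complex_vector, complex_vector) complex_vector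
begin

lift_definition zero_tensor :: "'a \<otimes> 'b" is "[]" .

lift_definition plus_tensor :: "'a \<otimes> 'b \<Rightarrow> 'a \<otimes> 'b \<Rightarrow> 'a \<otimes> 'b" is append
  by (simp add: tensor_eq_def)

lift_definition scaleC_tensor :: "complex \<Rightarrow> 'a \<otimes> 'b \<Rightarrow> 'a \<otimes> 'b"
  is "\<lambda>c. map (\<lambda>(a, b). (c *\<^sub>C a, b))"
  unfolding tensor_eq_def eval_form_map
proof (intro allI impI)
  fix c and xs ys :: "('a \<times> 'b) list" and \<beta> :: "'a \<Rightarrow> 'b \<Rightarrow> complex"
  assume *: "\<forall>\<beta> :: 'a \<Rightarrow> 'b \<Rightarrow> complex. cbilinear \<beta> \<longrightarrow> eval_form \<beta> xs = eval_form \<beta> ys"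
    and "cbilinear \<beta>"
  then have "cbilinear (\<lambda>a b. \<beta> (c *\<^sub>C a) b)"
    by (simp add: cbilinear_iff scaleC_complex_def distrib_left mult.left_commute scaleC_add_right)
  with * show "eval_form (\<lambda>a b. \<beta> (c *\<^sub>C a) b) xs = eval_form (\<lambda>a b. \<beta> (c *\<^sub>C a) b) ys"
    by blast
qed

definition uminus_tensor :: "'a \<otimes> 'b \<Rightarrow> 'a \<otimes> 'b" where "uminus_tensor t = (-1) *\<^sub>C t"
definition minus_tensor :: "'a \<otimes> 'b \<Rightarrow> 'a \<otimes> 'b \<Rightarrow> 'a \<otimes> 'b" where "minus_tensor s t = s + - t"

lemma eval_form_scaleC:
  "cbilinear (\<beta> :: 'a \<Rightarrow> 'b \<Rightarrow> complex) \<Longrightarrow> eval_form (\<lambda>a b. \<beta> (c *\<^sub>C a) b) xs = c * eval_form \<beta> xs"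
  by (induction xs) (auto simp: cbilinear_iff scaleC_complex_def algebra_simps)

instance
proof
  fix s t u :: "'a \<otimes> 'b" and c d :: complex
  show "s + t + u = s + (t + u)" by transfer (simp add: tensor_eq_def)
  show "s + t = t + s" by transfer (simp add: tensor_eq_def)
  show "0 + s = s" by transfer (simp add: tensor_eq_def)
  show "c *\<^sub>C (s + t) = c *\<^sub>C s + c *\<^sub>C t" by transfer (simp add: tensor_eq_def)
  show "(c + d) *\<^sub>C s = c *\<^sub>C s + d *\<^sub>C s"
    by transfer (unfold tensor_eq_def, intro allI impI,
      simp only: eval_form_map eval_form_simps eval_form_scaleC distrib_right)
  show "c *\<^sub>C d *\<^sub>C s = (c * d) *\<^sub>C s"
  proof transfer
    fix c d :: complex and xs :: "('a \<times> 'b) list"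
    have *: "map (\<lambda>(a, b). (c *\<^sub>C a, b)) (map (\<lambda>(a, b). (d *\<^sub>C a, b)) xs) = map (\<lambda>(a, b). ((c * d) *\<^sub>C a, b)) xs"
      by (simp add: split_def scaleC_scaleC)
    show "tensor_eq (map (\<lambda>(a, b). (c *\<^sub>C a, b)) (map (\<lambda>(a, b). (d *\<^sub>C a, b)) xs))
      (map (\<lambda>(a, b). ((c * d) *\<^sub>C a, b)) xs)"
      unfolding * by (simp add: tensor_eq_def)
  qed
  show "1 *\<^sub>C s = s" by transfer (simp add: tensor_eq_def scaleC_one)
  show "- s + s = 0" unfolding uminus_tensor_def
    by transfer (unfold tensor_eq_def, intro allI impI,
      simp only: eval_form_map eval_form_simps eval_form_scaleC, simp)
  show "s - t = s + - t" by (simp add: minus_tensor_def)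
qed

end

lemma cbilinear_tensor: "cbilinear (\<otimes>)"
  unfolding cbilinear_iff
  by (intro conjI allI; transfer) (auto simp: tensor_eq_def cbilinear_iff scaleC_complex_def)

lemma clinear_tensor_lift:
  assumes "cbilinear B"
  shows "clinear (tensor_lift B)"
proof -
  have "tensor_lift B (s + t) = tensor_lift B s + tensor_lift B t" for s t
    by (induct s rule: tensor.abs_induct, induct t rule: tensor.abs_induct)
      (simp add: plus_tensor.abs_eq tensor_lift_abs assms)
  moreover have "tensor_lift B (c *\<^sub>C t) = c *\<^sub>C tensor_lift B t" for c t
  proof (induct t rule: tensor.abs_induct)
    fix xs :: "('a \<times> 'b) list"
    have "eval_form (\<lambda>a b. B (c *\<^sub>C a) b) xs = c *\<^sub>C eval_form B xs"
      using assms by (induction xs) (auto simp: cbilinear_iff scaleC_add_right)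
    then show "tensor_lift B (c *\<^sub>C abs_tensor xs) = c *\<^sub>C tensor_lift B (abs_tensor xs)"
      by (simp add: scaleC_tensor.abs_eq tensor_lift_abs assms eval_form_map)
  qed
  ultimately show ?thesis by (simp add: clinear_iff)
qed

lemma tensor_sum_list: "abs_tensor xs = (\<Sum>(a, b)\<leftarrow>xs. a \<otimes> b)"
proof (induction xs)
  case Nil
  show ?case by (simp add: zero_tensor.abs_eq)
next
  case (Cons p xs)
  have "abs_tensor (p # xs) = (fst p \<otimes> snd p) + abs_tensor xs"
    by (simp add: tensor.abs_eq plus_tensor.abs_eq)
  with Cons show ?case by (simp add: split_def)
qed

lemma eval_form_bilinear_left:
  fixes \<beta> :: "'a::complex_algebra_1 \<Rightarrow> 'b::complex_algebra_1 \<Rightarrow> complex"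
  assumes "cbilinear \<beta>"
  shows "cbilinear (\<lambda>a b. eval_form (\<lambda>c d. \<beta> (a * c) (b * d)) ys)"
  using assms by (induction ys)
    (auto simp: cbilinear_iff algebra_simps mult_scaleC_left scaleC_complex_def)

lemma eval_form_bilinear_right:
  fixes \<beta> :: "'a::complex_algebra_1 \<Rightarrow> 'b::complex_algebra_1 \<Rightarrow> complex"
  assumes "cbilinear \<beta>"
  shows "cbilinear (\<lambda>c d. \<beta> (a * c) (b * d))"
  using assms by (auto simp: cbilinear_iff algebra_simps mult_scaleC_right scaleC_complex_def)

definition tensor_list_mult ::
    "('a::times \<times> 'b::times) list \<Rightarrow> ('a \<times> 'b) list \<Rightarrow> ('a \<times> 'b) list"
  where "tensor_list_mult xs ys = concat (map (\<lambda>(a, b). map (\<lambda>(c, d). (a * c, b * d)) ys) xs)"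

lemma eval_form_mult:
  "eval_form \<beta> (tensor_list_mult xs ys) = eval_form (\<lambda>a b. eval_form (\<lambda>c d. \<beta> (a * c) (b * d)) ys) xs"
  unfolding tensor_list_mult_def by (induction xs) (auto simp: eval_form_map split: prod.splits)

lemma eval_form_cong:
  "(\<And>a b. B a b = C a b) \<Longrightarrow> eval_form B xs = eval_form C xs"
  by (simp add: eval_form_def)

lemma eval_form_add:
  "eval_form (\<lambda>a b. B a b + C a b) xs = eval_form B xs + eval_form C xs"
  by (induction xs) (auto simp: algebra_simps)

instantiation tensor :: (complex_algebra_1, complex_algebra_1) complex_algebra_1
begin

lift_definition one_tensor :: "'a \<otimes> 'b" is "[(1, 1)]" .

lift_definition times_tensor :: "'a \<otimes> 'b \<Rightarrow> 'a \<otimes> 'b \<Rightarrow> 'a \<otimes> 'b" is tensor_list_mult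
proof -
  fix xs xs' ys ys' :: "('a \<times> 'b) list"
  assume xs: "tensor_eq xs xs'" and ys: "tensor_eq ys ys'"
  show "tensor_eq (tensor_list_mult xs ys) (tensor_list_mult xs' ys')"
    unfolding tensor_eq_def eval_form_mult
  proof (intro allI impI)
    fix \<beta> :: "'a \<Rightarrow> 'b \<Rightarrow> complex" assume \<beta>: "cbilinear \<beta>"
    have "eval_form (\<lambda>a b. eval_form (\<lambda>c d. \<beta> (a * c) (b * d)) ys) xs
        = eval_form (\<lambda>a b. eval_form (\<lambda>c d. \<beta> (a * c) (b * d)) ys') xs"
      by (intro eval_form_cong tensor_eq_eval_form[OF ys] eval_form_bilinear_right \<beta>)
    also have "\<dots> = eval_form (\<lambda>a b. eval_form (\<lambda>c d. \<beta> (a * c) (b * d)) ys') xs'"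
      by (intro tensor_eq_eval_form[OF xs] eval_form_bilinear_left \<beta>)
    finally show "eval_form (\<lambda>a b. eval_form (\<lambda>c d. \<beta> (a * c) (b * d)) ys) xs
        = eval_form (\<lambda>a b. eval_form (\<lambda>c d. \<beta> (a * c) (b * d)) ys') xs'" .
  qed
qed

instance
proof
  fix s t u :: "'a \<otimes> 'b" and c :: complex
  show "s * t * u = s * (t * u)"
    by transfer (simp add: tensor_eq_def eval_form_mult mult.assoc)
  show "1 * s = s" "s * 1 = s"
    by (transfer; simp add: tensor_eq_def eval_form_mult)+
  show "(s + t) * u = s * u + t * u"
    by transfer (simp add: tensor_eq_def eval_form_mult)
  show "s * (t + u) = s * t + s * u"
    by transfer (simp add: tensor_eq_def eval_form_mult eval_form_add)
  show "(c *\<^sub>C s) * t = c *\<^sub>C (s * t)"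
    by transfer (simp add: tensor_eq_def eval_form_mult eval_form_map mult_scaleC_left)
  show "s * (c *\<^sub>C t) = c *\<^sub>C (s * t)"
    by transfer (simp add: tensor_eq_def eval_form_mult eval_form_map mult_scaleC_right)
qed

end

lemma times_tensor_tensor: "(a \<otimes> b) * (c \<otimes> d) = (a * c) \<otimes> (b * d)"
  by transfer (simp add: tensor_list_mult_def tensor_eq_def)

instantiation tensor :: (complex_star_algebra, complex_star_algebra) complex_star_algebra
begin

lift_definition star_tensor :: "'a \<otimes> 'b \<Rightarrow> 'a \<otimes> 'b" is "map (\<lambda>(a, b). (star a, star b))"
proof -
  fix xs ys :: "('a \<times> 'b) list"
  assume *: "tensor_eq xs ys"
  show "tensor_eq (map (\<lambda>(a, b). (star a, star b)) xs) (map (\<lambda>(a, b). (star a, star b)) ys)"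
    unfolding tensor_eq_def eval_form_map
  proof (intro allI impI)
    fix \<beta> :: "'a \<Rightarrow> 'b \<Rightarrow> complex" assume \<beta>: "cbilinear \<beta>"
    have cnj: "cnj (eval_form (\<lambda>a b. \<beta> (star a) (star b)) zs)
      = eval_form (\<lambda>a b. cnj (\<beta> (star a) (star b))) zs" for zs :: "('a \<times> 'b) list"
      by (induction zs) auto
    have "cbilinear (\<lambda>a b. cnj (\<beta> (star a) (star b)))"
      using \<beta> by (simp add: cbilinear_iff star_add star_scaleC scaleC_complex_def)
    then have "cnj (eval_form (\<lambda>a b. \<beta> (star a) (star b)) xs)
      = cnj (eval_form (\<lambda>a b. \<beta> (star a) (star b)) ys)"
      unfolding cnj by (rule tensor_eq_eval_form[OF *])
    then show "eval_form (\<lambda>a b. \<beta> (star a) (star b)) xs = eval_form (\<lambda>a b. \<beta> (star a) (star b)) ys"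
      by simp
  qed
qed

lemma eval_form_swap:
  fixes f :: "'a \<Rightarrow> 'b \<Rightarrow> 'c \<Rightarrow> 'd \<Rightarrow> complex"
  shows "eval_form (\<lambda>a b. eval_form (f a b) ys) xs = eval_form (\<lambda>c d. eval_form (\<lambda>a b. f a b c d) xs) ys"
proof (induction xs)
  case Nil
  show ?case by (induction ys) auto
next
  case (Cons p xs)
  then show ?case by (simp add: eval_form_add)
qed

instance
proof
  fix s t :: "'a \<otimes> 'b" and c :: complex
  show "star (star s) = s"
    by transfer (simp add: tensor_eq_def eval_form_map star_star del: map_map)
  show "star (s + t) = star s + star t"
    by transfer (simp add: tensor_eq_def)
  show "star (s * t) = star t * star s"
    by transfer (simp add: tensor_eq_def eval_form_map eval_form_mult star_mult, intro allI impI,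
      rule eval_form_swap)
  show "star (c *\<^sub>C s) = cnj c *\<^sub>C star s"
    by transfer (simp add: tensor_eq_def eval_form_map star_scaleC del: map_map)
qed

end

lemma star_tensor_tensor: "star (a \<otimes> b) = star a \<otimes> star b"
  by transfer (simp add: tensor_eq_def)

definition tensor_assoc ::
    "('a::complex_vector \<otimes> 'b::complex_vector) \<otimes> 'c::complex_vector \<Rightarrow> 'a \<otimes> ('b \<otimes> 'c)"
  where "tensor_assoc = tensor_lift (\<lambda>t c. tensor_lift (\<lambda>a b. a \<otimes> (b \<otimes> c)) t)"

section \<open>Compact quantum groups\<close>

text \<open>
  A compact quantum group is given by its Hopf *-algebra \<open>Pol\<close> (the type \<open>'p\<close>), with coproduct
  \<open>\<Delta>\<close>, counit \<open>\<epsilon>\<close> and antipode \<open>S\<close>: a Hopf *-algebra spanned by the matrix coefficients of its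
  finite-dimensional unitary representations (equivalently of the irreducible ones, every such
  representation being a direct sum of irreducible ones). The discrete quantum groups are the
  duals of these.
\<close>

definition hopf_star_algebra ::
    "('p::complex_star_algebra \<Rightarrow> 'p \<otimes> 'p) \<Rightarrow> ('p \<Rightarrow> complex) \<Rightarrow> ('p \<Rightarrow> 'p) \<Rightarrow> bool"
  where "hopf_star_algebra \<Delta> \<epsilon> S \<longleftrightarrow>
    star_hom \<Delta> \<and> star_hom \<epsilon> \<and> clinear S \<and>
    (\<forall>x. tensor_assoc (tensor_map \<Delta> id (\<Delta> x)) = tensor_map id \<Delta> (\<Delta> x)) \<and>
    (\<forall>x. tensor_lift (\<lambda>a b. \<epsilon> a *\<^sub>C b) (\<Delta> x) = x) \<and>
    (\<forall>x. tensor_lift (\<lambda>a b. \<epsilon> b *\<^sub>C a) (\<Delta> x) = x) \<and>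
    (\<forall>x. tensor_lift (\<lambda>a b. S a * b) (\<Delta> x) = \<epsilon> x *\<^sub>C 1) \<and>
    (\<forall>x. tensor_lift (\<lambda>a b. a * S b) (\<Delta> x) = \<epsilon> x *\<^sub>C 1)"

definition unitary_rep ::
    "('p::complex_star_algebra \<Rightarrow> 'p \<otimes> 'p) \<Rightarrow> nat \<Rightarrow> (nat \<Rightarrow> nat \<Rightarrow> 'p) \<Rightarrow> bool"
  where "unitary_rep \<Delta> n u \<longleftrightarrow>
    (\<forall>i<n. \<forall>j<n. \<Delta> (u i j) = (\<Sum>k<n. u i k \<otimes> u k j)) \<and>
    (\<forall>i<n. \<forall>j<n. (\<Sum>k<n. u i k * star (u j k)) = (if i = j then 1 else 0)) \<and>
    (\<forall>i<n. \<forall>j<n. (\<Sum>k<n. star (u k i) * u k j) = (if i = j then 1 else 0))"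

definition compact_quantum_group ::
    "('p::complex_star_algebra \<Rightarrow> 'p \<otimes> 'p) \<Rightarrow> ('p \<Rightarrow> complex) \<Rightarrow> ('p \<Rightarrow> 'p) \<Rightarrow> bool"
  where "compact_quantum_group \<Delta> \<epsilon> S \<longleftrightarrow>
    hopf_star_algebra \<Delta> \<epsilon> S \<and>
    cspan {u i j | n u i j. unitary_rep \<Delta> n u \<and> i < n \<and> j < n} = UNIV"

definition haar_state :: "('p::complex_star_algebra \<Rightarrow> 'p \<otimes> 'p) \<Rightarrow> ('p \<Rightarrow> complex) \<Rightarrow> bool"
  where "haar_state \<Delta> h \<longleftrightarrow>
    clinear h \<and> h 1 = 1 \<and> (\<forall>x. h (star x * x) \<in> \<real>\<^sub>\<ge>\<^sub>0) \<and>
    (\<forall>x. tensor_lift (\<lambda>a b. h b *\<^sub>C a) (\<Delta> x) = h x *\<^sub>C 1) \<and>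
    (\<forall>x. tensor_lift (\<lambda>a b. h a *\<^sub>C b) (\<Delta> x) = h x *\<^sub>C 1)"

section \<open>Universal and reduced completions\<close>

definition cstar_seminorm :: "('p::complex_star_algebra \<Rightarrow> real) \<Rightarrow> bool"
  where "cstar_seminorm p \<longleftrightarrow>
    (\<forall>x y. p (x + y) \<le> p x + p y) \<and> (\<forall>c x. p (c *\<^sub>C x) = cmod c * p x) \<and>
    (\<forall>x y. p (x * y) \<le> p x * p y) \<and> (\<forall>x. p (star x * x) = (p x)\<^sup>2)"

definition universal_norm :: "'p::complex_star_algebra \<Rightarrow> real"
  where "universal_norm a = (SUP p\<in>{p. cstar_seminorm p}. p a)"

text \<open>
  \<open>gns_norm h a\<close> is the operator norm of \<open>x \<mapsto> a x\<close> on \<open>Pol\<close> with the inner product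
  \<open>\<langle>x, y\<rangle> = h(x\<^sup>* y)\<close>, i.e. the norm of \<open>a\<close> in the GNS representation of \<open>h\<close>.
\<close>

definition gns_length :: "('p::complex_star_algebra \<Rightarrow> complex) \<Rightarrow> 'p \<Rightarrow> real"
  where "gns_length h x = sqrt (Re (h (star x * x)))"

definition gns_norm :: "('p::complex_star_algebra \<Rightarrow> complex) \<Rightarrow> 'p \<Rightarrow> real"
  where "gns_norm h a = (SUP x\<in>{x. gns_length h x \<le> 1}. gns_length h (a * x))"

definition cstar_completion ::
    "('p::complex_star_algebra \<Rightarrow> real) \<Rightarrow> ('p \<Rightarrow> 'c::cstar_algebra) \<Rightarrow> bool"
  where "cstar_completion p \<iota> \<longleftrightarrow>
    star_hom \<iota> \<and> (\<forall>a. norm (\<iota> a) = p a) \<and> closure (range \<iota>) = UNIV"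

definition universal_completion :: "('p::complex_star_algebra \<Rightarrow> 'u::cstar_algebra) \<Rightarrow> bool"
  where "universal_completion \<iota> \<longleftrightarrow> cstar_completion universal_norm \<iota>"

definition reduced_completion ::
    "('p::complex_star_algebra \<Rightarrow> complex) \<Rightarrow> ('p \<Rightarrow> 'r::cstar_algebra) \<Rightarrow> bool"
  where "reduced_completion h \<iota> \<longleftrightarrow> cstar_completion (gns_norm h) \<iota>"

text \<open>
  The extension of \<open>f\<close> by continuity along a map \<open>\<iota>\<close> with dense range. The canonical surjection
  \<open>C\<^sub>u \<rightarrow> C\<^sub>r\<close> is \<open>continuous_extension \<iota>\<^sub>u \<iota>\<^sub>r\<close>, and the counit of \<open>C\<^sub>u\<close> is
  \<open>continuous_extension \<iota>\<^sub>u \<epsilon>\<close>.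
\<close>

definition continuous_extension ::
    "('p \<Rightarrow> 'u::topological_space) \<Rightarrow> ('p \<Rightarrow> 'c::topological_space) \<Rightarrow> 'u \<Rightarrow> 'c"
  where "continuous_extension \<iota> f = (THE F. continuous_on UNIV F \<and> (\<forall>a. F (\<iota> a) = f a))"

section \<open>States and the canonical Kac quotient\<close>

text \<open>States of a unital C*-subalgebra \<open>D\<close>; values outside \<open>D\<close> are irrelevant.\<close>

definition state_on :: "'c::cstar_algebra set \<Rightarrow> ('c \<Rightarrow> complex) \<Rightarrow> bool"
  where "state_on D \<tau> \<longleftrightarrow>
    (\<forall>x\<in>D. \<forall>y\<in>D. \<tau> (x + y) = \<tau> x + \<tau> y) \<and> (\<forall>c. \<forall>x\<in>D. \<tau> (c *\<^sub>C x) = c * \<tau> x) \<and>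
    continuous_on D \<tau> \<and> (\<forall>x\<in>D. \<tau> (star x * x) \<in> \<real>\<^sub>\<ge>\<^sub>0) \<and> \<tau> 1 = 1"

definition tracial_state :: "('c::cstar_algebra \<Rightarrow> complex) \<Rightarrow> bool"
  where "tracial_state \<tau> \<longleftrightarrow> state_on UNIV \<tau> \<and> (\<forall>x y. \<tau> (x * y) = \<tau> (y * x))"

definition kac_ideal :: "'c::cstar_algebra set"
  where "kac_ideal = {a. \<forall>\<tau>. tracial_state \<tau> \<longrightarrow> \<tau> (a * star a) = 0}"

lemma tracial_state_add: "tracial_state \<tau> \<Longrightarrow> \<tau> (x + y) = \<tau> x + \<tau> y"
  and tracial_state_scaleC: "tracial_state \<tau> \<Longrightarrow> \<tau> (c *\<^sub>C x) = c * \<tau> x"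
  and tracial_state_nonneg: "tracial_state \<tau> \<Longrightarrow> \<tau> (star x * x) \<in> \<real>\<^sub>\<ge>\<^sub>0"
  and tracial_state_commute: "tracial_state \<tau> \<Longrightarrow> \<tau> (x * y) = \<tau> (y * x)"
  by (auto simp: tracial_state_def state_on_def)

lemma star_zero [simp]: "star (0 :: 'a::complex_star_algebra) = 0"
  using star_add[of "0::'a" 0] by simp

lemma star_uminus: "star (- x :: 'a::complex_star_algebra) = - star x"
  using star_add[of x "- x"] by (simp add: eq_neg_iff_add_eq_0 add.commute)

lemma star_diff: "star (x - y :: 'a::complex_star_algebra) = star x - star y"
  using star_add[of x "- y"] by (simp add: star_uminus)

lemma star_one [simp]: "star (1 :: 'a::complex_star_algebra) = 1"
  using star_mult[of "1::'a" "star 1"] by (simp add: star_star)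

lemma tracial_state_mult_null:
  assumes \<tau>: "tracial_state \<tau>" and null: "\<tau> (a * star a) = 0"
  shows "\<tau> (a * x) = 0"
proof -
  note simps = tracial_state_add[OF \<tau>] tracial_state_scaleC[OF \<tau>]
  define w w' m where "w = \<tau> (a * x)" and "w' = \<tau> (star x * star a)" and "m = Re (\<tau> (star x * x))"
  have m: "\<tau> (star x * x) = of_real m" "m \<ge> 0"
    using tracial_state_nonneg[OF \<tau>, of x]
    by (auto simp: m_def complex_nonneg_Reals_iff complex_eq_iff)
  have pos: "c * w + cnj c * w' + of_real ((cmod c)\<^sup>2 * m) \<in> \<real>\<^sub>\<ge>\<^sub>0" for c
  proof -
    have "star (star a + c *\<^sub>C x) * (star a + c *\<^sub>C x)
      = a * star a + c *\<^sub>C (a * x) + cnj c *\<^sub>C (star x * star a) + (c * cnj c) *\<^sub>C (star x * x)"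
      by (simp add: star_add star_scaleC star_star algebra_simps mult_scaleC_left mult_scaleC_right
        scaleC_scaleC)
    then have "\<tau> (star (star a + c *\<^sub>C x) * (star a + c *\<^sub>C x))
      = c * w + cnj c * w' + of_real ((cmod c)\<^sup>2 * m)"
      by (simp add: simps null w_def w'_def m complex_norm_square[symmetric])
    then show ?thesis using tracial_state_nonneg[OF \<tau>, of "star a + c *\<^sub>C x"] by simp
  qed
  have w': "w' = cnj w"
    using pos[of 1] pos[of \<i>] by (auto simp: complex_nonneg_Reals_iff complex_eq_iff)
  define t where "t = 1 / (m + 1)"
  have t: "t > 0" "t * m < 1" using m(2) by (auto simp: t_def field_simps)
  have cw: "complex_of_real (cmod w) * complex_of_real (cmod w) = w * cnj w"
    using complex_norm_square[of w] by (simp add: power2_eq_square)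
  have c: "(- of_real t * cnj w) * w + cnj (- of_real t * cnj w) * w'
      + of_real ((cmod (- of_real t * cnj w))\<^sup>2 * m) = of_real ((t * m - 2) * (t * (cmod w)\<^sup>2))"
    using t(1) by (simp add: w' norm_mult power_mult_distrib cw power2_eq_square
      algebra_simps del: of_real_power)
  have "0 \<le> (t * m - 2) * (t * (cmod w)\<^sup>2)"
    using pos[of "- of_real t * cnj w"] unfolding c by (simp only: nonneg_Reals_of_real_iff)
  then have "t * (cmod w)\<^sup>2 \<le> 0"
    using t by (auto simp: zero_le_mult_iff)
  then show ?thesis using t by (simp add: mult_le_0_iff w_def)
qed

lemma kac_ideal_iff:
  "a \<in> kac_ideal \<longleftrightarrow> (\<forall>\<tau> x. tracial_state \<tau> \<longrightarrow> \<tau> (a * x) = 0)"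
  unfolding kac_ideal_def using tracial_state_mult_null by auto

lemma tracial_state_0: "tracial_state \<tau> \<Longrightarrow> \<tau> 0 = 0"
  using tracial_state_add[of \<tau> 0 0] by simp

lemma tracial_state_diff: "tracial_state \<tau> \<Longrightarrow> \<tau> (x - y) = \<tau> x - \<tau> y"
  using tracial_state_add[of \<tau> "x - y" y] by simp

lemma kac_ideal_0: "0 \<in> kac_ideal"
  by (simp add: kac_ideal_iff tracial_state_0)

lemma kac_ideal_add: "a \<in> kac_ideal \<Longrightarrow> b \<in> kac_ideal \<Longrightarrow> a + b \<in> kac_ideal"
  by (auto simp: kac_ideal_iff distrib_right tracial_state_add)

lemma kac_ideal_diff: "a \<in> kac_ideal \<Longrightarrow> b \<in> kac_ideal \<Longrightarrow> a - b \<in> kac_ideal"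
  by (auto simp: kac_ideal_iff left_diff_distrib tracial_state_diff)

lemma kac_ideal_scaleC: "a \<in> kac_ideal \<Longrightarrow> c *\<^sub>C a \<in> kac_ideal"
  by (auto simp: kac_ideal_iff mult_scaleC_left tracial_state_scaleC)

lemma kac_ideal_mult_right: "a \<in> kac_ideal \<Longrightarrow> a * b \<in> kac_ideal"
  by (simp add: kac_ideal_iff mult.assoc)

lemma kac_ideal_mult_left: "a \<in> kac_ideal \<Longrightarrow> b * a \<in> kac_ideal"
  unfolding kac_ideal_iff by (metis mult.assoc tracial_state_commute)

lemma kac_ideal_star: "a \<in> kac_ideal \<Longrightarrow> star a \<in> kac_ideal"
  unfolding kac_ideal_def by (simp add: star_star) (metis tracial_state_commute)

text \<open>
  The *-algebra underlying \<open>C/I\<close>, where \<open>I\<close> is the ideal \<^const>\<open>kac_ideal\<close> of the C*-algebra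
  \<open>C = 'c\<close>. For \<open>C = C\<^sub>u\<close> the ideal is \<open>I\<^sub>K\<^sub>a\<^sub>c\<close>, for \<open>C = C\<^sub>r\<close> it is \<open>I\<^sup>r\<^sub>K\<^sub>a\<^sub>c\<close>.
\<close>

quotient_type (overloaded) 'c kac_quotient =
    "'c::cstar_algebra" / "\<lambda>a b. a - b \<in> kac_ideal"
proof (rule equivpI)
  show "reflp (\<lambda>a b :: 'c. a - b \<in> kac_ideal)"
    by (simp add: reflp_def kac_ideal_0)
  show "symp (\<lambda>a b :: 'c. a - b \<in> kac_ideal)"
    unfolding symp_def using kac_ideal_diff[OF kac_ideal_0] by fastforce
  show "transp (\<lambda>a b :: 'c. a - b \<in> kac_ideal)"
    unfolding transp_def using kac_ideal_add by fastforce
qed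

instantiation kac_quotient :: (cstar_algebra) complex_star_algebra
begin

lift_definition zero_kac_quotient :: "'a kac_quotient" is 0 .
lift_definition one_kac_quotient :: "'a kac_quotient" is 1 .

lift_definition plus_kac_quotient :: "'a kac_quotient \<Rightarrow> 'a kac_quotient \<Rightarrow> 'a kac_quotient" is "(+)"
  using kac_ideal_add by (fastforce simp: algebra_simps)

lift_definition minus_kac_quotient :: "'a kac_quotient \<Rightarrow> 'a kac_quotient \<Rightarrow> 'a kac_quotient" is "(-)"
  using kac_ideal_diff by (fastforce simp: algebra_simps)

lift_definition uminus_kac_quotient :: "'a kac_quotient \<Rightarrow> 'a kac_quotient" is uminus
  using kac_ideal_diff[OF kac_ideal_0] by fastforce

lift_definition scaleC_kac_quotient :: "complex \<Rightarrow> 'a kac_quotient \<Rightarrow> 'a kac_quotient" is "(*\<^sub>C)"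
  by (metis complex_vector.scale_right_diff_distrib kac_ideal_scaleC)

lift_definition times_kac_quotient :: "'a kac_quotient \<Rightarrow> 'a kac_quotient \<Rightarrow> 'a kac_quotient" is "(*)"
proof -
  fix a a' b b' :: 'a
  assume "a - a' \<in> kac_ideal" "b - b' \<in> kac_ideal"
  then have "(a - a') * b + a' * (b - b') \<in> kac_ideal"
    by (intro kac_ideal_add kac_ideal_mult_left kac_ideal_mult_right)
  then show "a * b - a' * b' \<in> kac_ideal" by (simp add: algebra_simps)
qed

lift_definition star_kac_quotient :: "'a kac_quotient \<Rightarrow> 'a kac_quotient" is star
  by (metis star_diff kac_ideal_star)

instance
proof
  fix x y z :: "'a kac_quotient" and c d :: complex
  show "x + y + z = x + (y + z)" by transfer (simp add: add.assoc kac_ideal_0)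
  show "x + y = y + x" by transfer (simp add: add.commute kac_ideal_0)
  show "0 + x = x" by transfer (simp add: kac_ideal_0)
  show "- x + x = 0" by transfer (simp add: kac_ideal_0)
  show "x - y = x + - y" by transfer (simp add: kac_ideal_0)
  show "x * y * z = x * (y * z)" by transfer (simp add: mult.assoc kac_ideal_0)
  show "1 * x = x" "x * 1 = x" by (transfer; simp add: kac_ideal_0)+
  show "(x + y) * z = x * z + y * z" by transfer (simp add: distrib_right kac_ideal_0)
  show "x * (y + z) = x * y + x * z" by transfer (simp add: distrib_left kac_ideal_0)
  show "c *\<^sub>C (x + y) = c *\<^sub>C x + c *\<^sub>C y" by transfer (simp add: scaleC_add_right kac_ideal_0)
  show "(c + d) *\<^sub>C x = c *\<^sub>C x + d *\<^sub>C x" by transfer (simp add: scaleC_add_left kac_ideal_0)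
  show "c *\<^sub>C d *\<^sub>C x = (c * d) *\<^sub>C x" by transfer (simp add: scaleC_scaleC kac_ideal_0)
  show "1 *\<^sub>C x = x" by transfer (simp add: scaleC_one kac_ideal_0)
  show "(c *\<^sub>C x) * y = c *\<^sub>C (x * y)" by transfer (simp add: mult_scaleC_left kac_ideal_0)
  show "x * (c *\<^sub>C y) = c *\<^sub>C (x * y)" by transfer (simp add: mult_scaleC_right kac_ideal_0)
  show "star (star x) = x" by transfer (simp add: star_star kac_ideal_0)
  show "star (x + y) = star x + star y" by transfer (simp add: star_add kac_ideal_0)
  show "star (x * y) = star y * star x" by transfer (simp add: star_mult kac_ideal_0)
  show "star (c *\<^sub>C x) = cnj c *\<^sub>C star x" by transfer (simp add: star_scaleC kac_ideal_0)
qed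

end

text \<open>
  For \<open>\<iota>\<close> the embedding of \<open>Pol\<close> into \<open>C\<^sub>u\<close> (resp. \<open>C\<^sub>r\<close>), \<open>kac_map \<iota>\<close> is the map \<open>\<pi>\<close> from \<open>Pol\<close>
  onto \<open>Pol\<close> of the canonical (resp. reduced) Kac quotient, the latter being
  \<^term>\<open>range (kac_map \<iota>)\<close>; its coproduct is the one that makes \<open>\<pi>\<close> intertwine coproducts.
\<close>

definition kac_map :: "('p::complex_star_algebra \<Rightarrow> 'c::cstar_algebra) \<Rightarrow> 'p \<Rightarrow> 'c kac_quotient"
  where "kac_map \<iota> a = abs_kac_quotient (\<iota> a)"

section \<open>Closed quantum subgroups\<close>

text \<open>
  A closed quantum subgroup enters only through its map \<open>\<pi>\<close>. The codomain of \<open>\<pi>\<close> may be larger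
  than \<open>Pol\<close> of the subgroup, which is \<^term>\<open>range \<pi>\<close>: the algebraic tensor product with a
  subspace embeds into the one with the whole space.
\<close>

definition equal_subgroups :: "('p \<Rightarrow> 'b::zero) \<Rightarrow> ('p \<Rightarrow> 'c::zero) \<Rightarrow> bool"
  where "equal_subgroups \<pi> \<rho> \<longleftrightarrow> {a. \<pi> a = 0} = {a. \<rho> a = 0}"

definition pol_quotient ::
    "('p::complex_star_algebra \<Rightarrow> 'p \<otimes> 'p) \<Rightarrow> ('p \<Rightarrow> 'b::complex_star_algebra) \<Rightarrow> 'p set"
  where "pol_quotient \<Delta> \<pi> = {a. tensor_map id \<pi> (\<Delta> a) = a \<otimes> 1}"

definition coamenable_quotient ::
    "('p::complex_star_algebra \<Rightarrow> 'p \<otimes> 'p) \<Rightarrow> ('p \<Rightarrow> complex) \<Rightarrow>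
      ('p \<Rightarrow> 'u::cstar_algebra) \<Rightarrow> ('p \<Rightarrow> 'r::cstar_algebra) \<Rightarrow>
      ('p \<Rightarrow> 'b::complex_star_algebra) \<Rightarrow> bool"
  where "coamenable_quotient \<Delta> \<epsilon> \<iota>\<^sub>u \<iota>\<^sub>r \<pi> \<longleftrightarrow>
    (\<exists>\<epsilon>\<^sub>r. state_on (closure (\<iota>\<^sub>r ` pol_quotient \<Delta> \<pi>)) \<epsilon>\<^sub>r \<and>
      (\<forall>x \<in> closure (\<iota>\<^sub>u ` pol_quotient \<Delta> \<pi>).
        \<epsilon>\<^sub>r (continuous_extension \<iota>\<^sub>u \<iota>\<^sub>r x) = continuous_extension \<iota>\<^sub>u \<epsilon> x))"

end

theory Submission
  imports Defs "HOL-Computational_Algebra.Polynomial"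
begin

text \<open>
  Let \<open>J\<close> be the set of all \<open>a\<close> in \<open>Pol\<close> with \<open>\<iota>\<^sub>r a\<close> in the Kac ideal of \<open>C\<^sub>r\<close>, that is, the common null
  ideal of the tracial states of \<open>C\<^sub>r\<close>, and \<open>I\<close> the corresponding set for \<open>C\<^sub>u\<close>. The first claim is
  \<open>J = I\<close>. As the reduced norm is below the universal one, tracial states of \<open>C\<^sub>r\<close> give tracial
  states of \<open>C\<^sub>u\<close>, and \<open>I \<subseteq> J\<close>.

  For \<open>J \<subseteq> I\<close> suppose first that \<open>Pol\<close> consists of functions on a compact group, and let \<open>E\<close> be the
  closed union of the supports of the tracial states of \<open>C\<^sub>r\<close>. Convolving such a state with an arbitrary
  tracial state gives again a tracial state of \<open>C\<^sub>r\<close>, so \<open>E\<close> is stable under right translation by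
  every support of a tracial state. In particular \<open>E\<close> is a semigroup, and a closed semigroup in a
  compact group is a group; so \<open>E\<close> contains the unit, and therefore all these supports. The
  proof below is this argument for a compact quantum group:

  \<^item> Convolution with a tracial functional \<open>\<sigma>\<close> of \<open>Pol\<close> does not increase the reduced norm. This is
    Fell absorption, the multiplicative isometry \<open>x \<otimes> b \<mapsto> \<Delta> x (1 \<otimes> b)\<close> intertwining \<open>a \<otimes> 1\<close> with \<open>\<Delta> a\<close>
    (\<open>gns_norm_convolve\<close>). So the convolution of a tracial state of \<open>C\<^sub>r\<close> with \<open>\<sigma>\<close> is one again
    (\<open>convolution_tracial_state\<close>), and by Cauchy-Schwarz \<open>J\<close> is invariant under the slice maps
    \<open>(id \<otimes> \<sigma>(- y)) \<Delta>\<close> (\<open>reduced_kac_ideal_invariant\<close>).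

  \<^item> The counit vanishes on \<open>J\<close> (\<open>counit_vanishes_on_invariant_subspace\<close>). The elements of \<open>J\<close> with
    coefficients in a fixed unitary representation form a finite-dimensional space, on which the
    coproduct acts by a matrix \<open>T\<close> with \<open>T\<^sup>* T = 1\<close> up to elements that a trace cannot see. The trace
    forces \<open>T T\<^sup>* = 1\<close> as well; this replaces the passage from semigroups to groups.

  \<^item> The counit turns the slice \<open>(id \<otimes> \<sigma>(- y)) \<Delta> a\<close> into \<open>\<sigma>(a y)\<close>. So \<open>\<sigma>(a y) = 0\<close> for every \<open>a\<close> in
    \<open>J\<close> and every tracial functional \<open>\<sigma>\<close> of \<open>Pol\<close>, in particular for those that come from \<open>C\<^sub>u\<close>.

  Coamenability is then short. If \<open>a\<close> lies in \<open>Pol\<close> of the quotient space, the counit applied to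
  \<open>(id \<otimes> \<pi>) (\<Delta> a) = a \<otimes> 1\<close> yields \<open>\<pi> a = \<epsilon> a 1\<close>, so every tracial state of \<open>C\<^sub>r\<close> agrees with the
  counit there: its restriction is the state asked for.

  The canonical surjection and the counit on \<open>C\<^sub>u\<close> exist because \<^const>\<open>universal_norm\<close> dominates
  every C*-seminorm, which means that C*-seminorms are uniformly bounded on each matrix coefficient
  (\<open>cstar_seminorm_le_universal_norm\<close>). This rests on the positivity of \<open>x\<^sup>* x\<close>, which is needed for
  C*-seminorms on algebras that are not complete and is proved by polynomial estimates alone
  (\<open>star_mult_self_positive\<close>).
\<close>

section \<open>C*-seminorms and positivity\<close>

text \<open>
  The spectral radius trick: an estimate for the powers of an element of a C*-algebra that is
  worse than the wanted one by a factor of linear growth is as good as the wanted one. Only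
  powers of two occur because these are the ones that a C*-seminorm respects on
  hermitian elements.
\<close>

lemma power_growth_le:
  fixes X R A B :: real
  assumes "0 \<le> R" "\<And>k. X ^ (2^k) \<le> (A + B * 2^k) * R ^ (2^k)"
  shows "X \<le> R"
proof (rule ccontr)
  assume "\<not> X \<le> R"
  then have XR: "R < X" by simp
  then have X: "X > 0" using assms(1) by simp
  show False
  proof (cases "R = 0")
    case True
    with assms(2)[of 0] X show False by simp
  next
    case False
    then have R: "R > 0" using assms(1) by simp
    define y where "y = X / R"
    have y: "y > 1" using XR R by (simp add: y_def)
    have "y ^ (2^k) \<le> A + B * 2^k" for k
      using assms(2)[of k] R by (simp add: y_def power_divide field_simps)
    then have le: "1 \<le> A * (1 / y ^ (2^k)) + B * (real (2^k) / y ^ (2^k))" for k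
      using y by (simp add: field_simps)
    have sub: "strict_mono (\<lambda>k. 2^k :: nat)"
      by (simp add: strict_mono_def)
    have l1: "(\<lambda>n. real n / y ^ n) \<longlonglongrightarrow> 0"
      using lim_n_over_pown[of y] y by simp
    have l2: "(\<lambda>n. 1 / y ^ n) \<longlonglongrightarrow> 0"
      using LIMSEQ_inverse_realpow_zero[OF y] by (simp add: inverse_eq_divide)
    have "(\<lambda>k. A * (1 / y ^ (2^k)) + B * (real (2^k) / y ^ (2^k))) \<longlonglongrightarrow> A * 0 + B * 0"
      using LIMSEQ_subseq_LIMSEQ[OF l1 sub] LIMSEQ_subseq_LIMSEQ[OF l2 sub]
      by (intro tendsto_add tendsto_mult_left) (simp_all add: o_def)
    then have "1 \<le> A * 0 + B * (0::real)"
      using le by (intro LIMSEQ_le_const) auto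
    then show False by simp
  qed
qed

definition hermitian :: "'a::complex_star_algebra \<Rightarrow> bool"
  where "hermitian a \<longleftrightarrow> star a = a"

definition scal :: "real \<Rightarrow> 'a::complex_star_algebra"
  where "scal t = complex_of_real t *\<^sub>C 1"

lemma scal_simps:
  "scal (s + t) = scal s + scal t" "scal (s * t) = scal s * scal t" "scal 0 = 0" "scal 1 = 1"
  "scal (- s) = - scal s"
  "star (scal s) = scal s"
  by (simp_all add: scal_def scaleC_add_left mult_scaleC_left mult_scaleC_right scaleC_scaleC
      scaleC_one star_scaleC)

lemma scal_commute: "scal s * a = a * scal s"
  by (simp add: scal_def mult_scaleC_left mult_scaleC_right)

lemma scal_mult: "scal s * a = complex_of_real s *\<^sub>C a"
  by (simp add: scal_def mult_scaleC_left)

text \<open>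
  Evaluation of real polynomials at an algebra element. All commuting families below consist of
  polynomials in one hermitian element, and their identities are checked in the ring of
  polynomials.
\<close>

definition peval :: "'a::complex_star_algebra \<Rightarrow> real poly \<Rightarrow> 'a"
  where "peval c q = fold_coeffs (\<lambda>a x. scal a + c * x) q 0"

lemma peval_0 [simp]: "peval c 0 = 0"
  by (simp add: peval_def)

lemma peval_pCons [simp]: "peval c (pCons a q) = scal a + c * peval c q"
  by (cases "q = 0 \<and> a = 0") (auto simp: peval_def scal_simps)

lemma peval_1 [simp]: "peval c 1 = 1"
  by (simp add: one_pCons scal_simps)

lemma peval_add [simp]: "peval c (q + r) = peval c q + peval c r"
  by (induction q r rule: poly_induct2) (simp_all add: scal_simps algebra_simps)

lemma peval_smult [simp]: "peval c (smult s q) = scal s * peval c q"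
proof (induction q)
  case (pCons a q)
  have "c * (scal s * peval c q) = scal s * (c * peval c q)"
    by (metis mult.assoc scal_commute)
  with pCons show ?case by (simp add: scal_simps distrib_left)
qed simp

lemma peval_uminus [simp]: "peval c (- q) = - peval c q"
  by (induction q) (simp_all add: scal_simps)

lemma peval_diff [simp]: "peval c (q - r) = peval c q - peval c r"
  using peval_add[of c q "- r"] by simp

lemma peval_mult [simp]: "peval c (q * r) = peval c q * peval c r"
  by (induction q) (simp_all add: algebra_simps scal_simps)

lemma peval_commute_base: "peval c q * c = c * peval c q"
proof (induction q)
  case (pCons a q)
  then show ?case by (simp add: distrib_left distrib_right mult.assoc scal_commute)
qed simp

lemma hermitian_peval: "hermitian c \<Longrightarrow> hermitian (peval c q)"
  unfolding hermitian_def
  by (induction q) (simp_all add: star_add star_mult scal_simps(6) peval_commute_base)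

locale cstar_seminormed =
  fixes p :: "'a::complex_star_algebra \<Rightarrow> real"
  assumes seminorm: "cstar_seminorm p"
begin

lemma triangle: "p (x + y) \<le> p x + p y"
  and homogeneous: "p (c *\<^sub>C x) = cmod c * p x"
  and submult: "p (x * y) \<le> p x * p y"
  and cstar: "p (star x * x) = (p x)\<^sup>2"
  using seminorm by (auto simp: cstar_seminorm_def)

lemma p_0 [simp]: "p 0 = 0"
  using homogeneous[of 0 0] by simp

lemma p_minus [simp]: "p (- x) = p x"
  using homogeneous[of "-1" x] by simp

lemma nonneg [simp]: "0 \<le> p x"
  using triangle[of x "- x"] by simp

lemma triangle_diff: "p (x - y) \<le> p x + p y"
  using triangle[of x "- y"] by simp

lemma p_one: "p 1 \<le> 1"
proof -
  have "p 1 = p 1 * p 1" using cstar[of 1] by (simp add: power2_eq_square)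
  then have "p 1 = 0 \<or> p 1 = 1" by simp
  then show ?thesis by auto
qed

lemma p_scal: "p (scal s) \<le> \<bar>s\<bar>"
  using p_one mult_left_mono[OF p_one, of "\<bar>s\<bar>"] by (simp add: scal_def homogeneous)

lemma p_scal_mult: "p (scal s * x) = \<bar>s\<bar> * p x"
  by (simp add: scal_mult homogeneous)

lemma p_star [simp]: "p (star x) = p x"
proof -
  have le: "p x \<le> p (star x)" for x
  proof (cases "p x = 0")
    case False
    have "p x * p x \<le> p (star x) * p x"
      using cstar[of x] submult[of "star x" x] by (simp add: power2_eq_square)
    with False show ?thesis by (metis mult_right_le_imp_le nonneg order_le_less)
  qed simp
  show ?thesis using le[of x] le[of "star x"] by (simp add: star_star)
qed

lemma p_square: "hermitian h \<Longrightarrow> p (h * h) = (p h)\<^sup>2"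
  using cstar[of h] by (simp add: hermitian_def)

lemma p_power_two_power: "hermitian h \<Longrightarrow> p (h ^ (2^k)) = p h ^ (2^k)"
proof (induction k)
  case (Suc k)
  have "hermitian (h ^ n)" for n
    using Suc.prems by (induction n) (simp_all add: hermitian_def star_mult power_commutes)
  then have "p (h ^ (2^k) * h ^ (2^k)) = (p (h ^ (2^k)))\<^sup>2" by (rule p_square)
  with Suc show ?case by (simp add: power_add[symmetric] power_mult[symmetric] mult_2 power2_eq_square)
qed simp

text \<open>
  As \<open>y\<close> and \<open>z\<close> commute, \<open>y\<^sup>2 + z\<^sup>2 = w\<^sup>* w\<close> for \<open>w = y + iz\<close>, and \<open>y\<close> is the real part of \<open>w\<close>.
\<close>

lemma square_le_sum_squares:
  assumes "hermitian y" "hermitian z" "y * z = z * y"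
  shows "(p y)\<^sup>2 \<le> p (y * y + z * z)"
proof -
  define w where "w = y + \<i> *\<^sub>C z"
  have sw: "star w = y - \<i> *\<^sub>C z"
    using assms by (simp add: w_def star_add star_scaleC hermitian_def)
  have "star w * w = y * y + z * z"
    by (subst sw) (simp add: w_def algebra_simps assms(3) mult_scaleC_left mult_scaleC_right scaleC_scaleC scaleC_one)
  then have w: "p (y * y + z * z) = (p w)\<^sup>2" using cstar[of w] by simp
  have "(1/2) *\<^sub>C (w + star w) = (1/2) *\<^sub>C (1 *\<^sub>C y + 1 *\<^sub>C y)"
    by (subst sw) (simp add: w_def scaleC_one)
  also have "\<dots> = y" unfolding scaleC_add_left[symmetric] scaleC_scaleC by (simp add: scaleC_one)
  finally have "p y = (1/2) * p (w + star w)" by (metis homogeneous norm_divide norm_numeral norm_one)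
  then have "p y \<le> p w" using triangle[of w "star w"] by simp
  then show ?thesis unfolding w by (simp add: power_mono)
qed

text \<open>
  For hermitian \<open>a\<close> this says that \<open>m\<close> is an upper bound of the spectrum: when \<open>t\<close> is large, the
  norm of \<open>t + a\<close> is attained at the top of the spectrum of \<open>a\<close>. In particular \<open>upper (- a) 0\<close>
  says that \<open>a\<close> is positive. Unlike the spectrum, the norms make sense without completeness.
\<close>

definition upper :: "'a \<Rightarrow> real \<Rightarrow> bool"
  where "upper a m \<longleftrightarrow> (\<forall>e>0. \<forall>\<^sub>F t in at_top. p (scal t + a) \<le> t + m + e)"

lemma upperI:
  assumes "\<forall>\<^sub>F t in at_top. p (scal t + a) \<le> t + m"
  shows "upper a m"
  unfolding upper_def
proof (intro allI impI)
  fix e :: real assume "e > 0"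
  then show "\<forall>\<^sub>F t in at_top. p (scal t + a) \<le> t + m + e"
    by (intro eventually_mono[OF assms]) simp
qed

lemma upper_norm: "upper a (p a)"
proof (rule upperI)
  show "\<forall>\<^sub>F t in at_top. p (scal t + a) \<le> t + p a"
    using eventually_ge_at_top[of 0]
  proof eventually_elim
    case (elim t)
    then show ?case using triangle[of "scal t" a] p_scal[of t] by simp
  qed
qed

lemma upper_limit: "(\<And>e. e > 0 \<Longrightarrow> upper a (m + e)) \<Longrightarrow> upper a m"
  unfolding upper_def
proof (intro allI impI)
  fix e :: real
  assume *: "\<And>e. e > 0 \<Longrightarrow> \<forall>ea>0. \<forall>\<^sub>F t in at_top. p (scal t + a) \<le> t + (m + e) + ea" and "e > 0"
  then have "\<forall>\<^sub>F t in at_top. p (scal t + a) \<le> t + (m + e/2) + e/2"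
    using half_gt_zero by blast
  then show "\<forall>\<^sub>F t in at_top. p (scal t + a) \<le> t + m + e"
    by (rule eventually_mono) simp
qed

lemma upper_mono:
  assumes "upper a m" "m \<le> n"
  shows "upper a n"
  unfolding upper_def
proof (intro allI impI)
  fix e :: real assume "e > 0"
  then have "\<forall>\<^sub>F t in at_top. p (scal t + a) \<le> t + m + e"
    using assms(1) by (simp add: upper_def)
  then show "\<forall>\<^sub>F t in at_top. p (scal t + a) \<le> t + n + e"
    by (rule eventually_mono) (use assms(2) in simp)
qed

lemma upper_add:
  assumes "upper a m" "upper b n"
  shows "upper (a + b) (m + n)"
  unfolding upper_def
proof (intro allI impI)
  fix e :: real assume "e > 0"
  then have "\<forall>\<^sub>F t in at_top. p (scal t + a) \<le> t + m + e/2"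
    and "\<forall>\<^sub>F t in at_top. p (scal t + b) \<le> t + n + e/2"
    using assms by (simp_all add: upper_def)
  then have ev: "\<forall>\<^sub>F t in at_top. p (scal t + a) \<le> t + m + e/2 \<and> p (scal t + b) \<le> t + n + e/2"
    by (rule eventually_conj)
  have "filterlim (\<lambda>t::real. t / 2) at_top at_top"
    using filterlim_tendsto_pos_mult_at_top[OF tendsto_const _ filterlim_ident, of "1/2"] by simp
  from eventually_compose_filterlim[OF ev this]
  show "\<forall>\<^sub>F t in at_top. p (scal t + (a + b)) \<le> t + (m + n) + e"
  proof eventually_elim
    case (elim t)
    have "scal t + (a + b) = (scal (t/2) + a) + (scal (t/2) + b)"
      using scal_simps(1)[of "t/2" "t/2"] by (simp add: algebra_simps)
    then have "p (scal t + (a + b)) \<le> p (scal (t/2) + a) + p (scal (t/2) + b)"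
      by (simp only: triangle)
    with elim show ?case by (simp add: field_simps)
  qed
qed

lemma upper_scal: "upper (scal s) s"
proof (rule upperI)
  show "\<forall>\<^sub>F t in at_top. p (scal t + scal s) \<le> t + s"
    using eventually_ge_at_top[of "- s"]
  proof eventually_elim
    case (elim t)
    then show ?case using p_scal[of "t + s"] by (simp add: scal_simps)
  qed
qed

lemma upper_scale:
  assumes "upper a m" "s > 0"
  shows "upper (scal s * a) (s * m)"
  unfolding upper_def
proof (intro allI impI)
  fix e :: real assume "e > 0"
  then have ev: "\<forall>\<^sub>F t in at_top. p (scal t + a) \<le> t + m + e/s"
    using assms by (simp add: upper_def)
  have "filterlim (\<lambda>t::real. (1/s) * t) at_top at_top"
    using assms(2) by (intro filterlim_tendsto_pos_mult_at_top[OF tendsto_const]) (auto simp: filterlim_ident)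
  from eventually_compose_filterlim[OF ev this]
  show "\<forall>\<^sub>F t in at_top. p (scal t + scal s * a) \<le> t + s * m + e"
  proof eventually_elim
    case (elim t)
    have "scal t + scal s * a = scal s * (scal ((1/s) * t) + a)"
      using assms(2) by (simp add: distrib_left scal_simps(2)[symmetric])
    then have "p (scal t + scal s * a) = s * p (scal ((1/s) * t) + a)"
      using assms(2) by (simp only: p_scal_mult)
    also have "\<dots> \<le> s * ((1/s) * t + m + e/s)"
      using elim assms(2) by (intro mult_left_mono) auto
    also have "\<dots> = t + s * m + e" using assms(2) by (simp add: field_simps)
    finally show ?case .
  qed
qed

text \<open>
  The square root of \<open>t - h\<^sup>2\<close> is approximated by \<open>y = s - h\<^sup>2/(2s)\<close> with \<open>s\<^sup>2 = t\<close>, up to an error of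
  order \<open>1/t\<close>. So \<open>t - h\<^sup>2\<close> is \<open>y\<^sup>2\<close> up to such an error, and \<open>y\<^sup>2\<close> is bounded in norm by
  \<open>y\<^sup>2 + h\<^sup>2\<close>, which is \<open>t\<close> up to such an error.
\<close>

lemma upper_minus_square:
  assumes h: "hermitian h"
  shows "upper (- (h * h)) 0"
  unfolding upper_def
proof (intro allI impI)
  fix e :: real assume e: "e > 0"
  show "\<forall>\<^sub>F t in at_top. p (scal t + - (h * h)) \<le> t + 0 + e"
    using eventually_ge_at_top[of "max 1 ((p h)^4 / e)"]
  proof eventually_elim
    case (elim t)
    then have t: "t > 0" "(p h)^4 / e \<le> t" by auto
    define X :: "real poly" where "X = [:0, 1:]"
    define s where "s = sqrt t"
    have s: "s > 0" "s * s = t" using t by (simp_all add: s_def)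
    define Y where "Y = [:s:] - smult (1 / (2 * s)) (X * X)"
    have id1: "[:t:] - X * X = Y * Y - smult (1/(4*t)) ((X*X)*(X*X))"
      using s by (simp add: Y_def X_def field_simps) (simp add: s(2)[symmetric] mult.assoc)
    have id2: "Y * Y + X * X = [:t:] + smult (1/(4*t)) ((X*X)*(X*X))"
      using id1 by (simp add: algebra_simps)
    define y where "y = peval h Y"
    have X: "peval h X = h" by (simp add: X_def scal_simps)
    have y1: "scal t - h * h = y * y - scal (1/(4*t)) * ((h*h)*(h*h))"
      using arg_cong[OF id1, of "peval h"] by (simp add: X y_def)
    have y2: "y * y + h * h = scal t + scal (1/(4*t)) * ((h*h)*(h*h))"
      using arg_cong[OF id2, of "peval h"] by (simp add: X y_def)
    have hy: "hermitian y" by (simp add: y_def hermitian_peval h)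
    have comm: "y * h = h * y" by (simp add: y_def peval_commute_base)
    have hh: "hermitian (h * h)" using h by (simp add: hermitian_def star_mult)
    have p4: "p ((h*h)*(h*h)) = (p h)^4"
      by (simp add: p_square hh h flip: power_mult)
    have q: "p (scal (1/(4*t)) * ((h*h)*(h*h))) = (p h)^4 / (4*t)"
      using t by (simp add: p_scal_mult p4)
    have "(p y)\<^sup>2 \<le> p (scal t + scal (1/(4*t)) * ((h*h)*(h*h)))"
      using square_le_sum_squares[OF hy h comm] y2 by simp
    also have "\<dots> \<le> t + (p h)^4 / (4*t)"
      using triangle[of "scal t"] p_scal[of t] q t by (smt (verit))
    finally have yy: "p (y * y) \<le> t + (p h)^4 / (4*t)" by (simp add: p_square hy)
    have "p (scal t - h * h) \<le> p (y * y) + (p h)^4 / (4*t)"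
      unfolding y1 using triangle_diff[of "y*y"] q by (smt (verit))
    also have "\<dots> \<le> t + (p h)^4 / (2*t)"
    proof -
      have "(p h)^4 / (2*t) = (p h)^4 / (4*t) + (p h)^4 / (4*t)" by simp
      then show ?thesis using yy by linarith
    qed
    also have "\<dots> \<le> t + e" 
    proof -
      have "(p h)^4 / t \<le> e" using t e by (simp add: field_simps)
      then show ?thesis using e by simp
    qed
    finally show ?case by simp
  qed
qed

text \<open>
  For \<open>t = r\<close>, where \<open>r\<close> is the norm of \<open>h\<^sup>2\<close>, this follows from
  \<open>(r + h\<^sup>2)\<^sup>2 = (r - h\<^sup>2)\<^sup>2 + 4r h\<^sup>2\<close>. The norm of \<open>t + h\<^sup>2\<close> is a convex function of \<open>t\<close> with value
  \<open>r\<close> at \<open>0\<close> and at least \<open>2r\<close> at \<open>r\<close>, so from there on it grows at least as fast as \<open>t + r\<close>.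
  The alternative \<open>p h = 0\<close> makes room for the seminorm \<open>0\<close>, for which the norm of \<open>t\<close> is not \<open>t\<close>.
\<close>

lemma norm_shifted_square:
  assumes h: "hermitian h" and t: "(p h)\<^sup>2 \<le> t"
  shows "t + (p h)\<^sup>2 \<le> p (scal t + h * h) \<or> p h = 0"
proof (cases "p h = 0")
  case False
  define r where "r = (p h)\<^sup>2"
  have r: "r > 0" "sqrt r = p h" using False by (simp_all add: r_def)
  define X :: "real poly" where "X = [:0, 1:]"
  have X: "peval h X = h" by (simp add: X_def scal_simps)
  have hh: "hermitian (h * h)" using h by (simp add: hermitian_def star_mult)
  have id: "([:r:] + X * X) * ([:r:] + X * X)
      = ([:r:] - X * X) * ([:r:] - X * X) + smult (2 * sqrt r) X * smult (2 * sqrt r) X"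
    using r(1) by (simp add: X_def algebra_simps)
  define y z w where "y = peval h ([:r:] - X * X)" and "z = peval h (smult (2 * sqrt r) X)"
    and "w = peval h ([:r:] + X * X)"
  have w: "w = scal r + h * h" by (simp add: w_def X)
  have herm: "hermitian y" "hermitian z" "hermitian w"
    by (simp_all only: y_def z_def w_def hermitian_peval h)
  have yz: "y * z = z * y" unfolding y_def z_def peval_mult[symmetric] by (simp add: mult.commute)
  have pz: "p z = 2 * (p h)\<^sup>2"
    using r by (simp add: z_def X p_scal_mult power2_eq_square)
  have "w * w = z * z + y * y"
    unfolding w_def y_def z_def peval_mult[symmetric] peval_add[symmetric] id by (simp add: add.commute)
  then have "(p z)\<^sup>2 \<le> (p w)\<^sup>2"
    using square_le_sum_squares[OF herm(2,1)] yz p_square[OF herm(3)] by simp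
  then have w2: "2 * r \<le> p (scal r + h * h)"
    using pz w power2_le_imp_le[of "p z" "p w"] by (simp add: r_def)
  have t: "t > 0" "r \<le> t" using t r(1) by (simp_all only: r_def)
  have "scal r + h * h = scal (r/t) * (scal t + h * h) + scal (1 - r/t) * (h * h)"
  proof -
    have "scal (r/t) * (scal t + h * h) + scal (1 - r/t) * (h * h)
      = scal (r/t * t) + scal (r/t + (1 - r/t)) * (h * h)"
      by (simp only: scal_simps(1,2) distrib_left distrib_right add.assoc)
    then show ?thesis using t by (simp add: scal_simps)
  qed
  moreover have "\<bar>1 - r/t\<bar> = 1 - r/t" "\<bar>r/t\<bar> = r/t" using t r(1) by auto
  ultimately have "p (scal r + h * h) \<le> (r/t) * p (scal t + h * h) + (1 - r/t) * r"
    using triangle[of "scal (r/t) * (scal t + h * h)" "scal (1 - r/t) * (h * h)"]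
    by (simp only: p_scal_mult p_square h r_def)
  with w2 have "2 * r \<le> r * (p (scal t + h * h) / t + (1 - r/t))" by (simp add: field_simps)
  then have "2 \<le> p (scal t + h * h) / t + (1 - r/t)" using r(1) by (metis mult.commute mult_le_cancel_left_pos)
  then show ?thesis using t by (simp add: field_simps r_def)
qed simp

lemma upper_square_norm:
  assumes "upper (h * h) m" "hermitian h" "m \<ge> 0"
  shows "(p h)\<^sup>2 \<le> m"
proof (cases "p h = 0")
  case False
  have "(p h)\<^sup>2 \<le> m + e" if "e > 0" for e
  proof -
    have "\<forall>\<^sub>F t in at_top. p (scal t + h * h) \<le> t + m + e \<and> (p h)\<^sup>2 \<le> t"
      using assms(1) that unfolding upper_def
      by (intro eventually_conj eventually_ge_at_top) auto
    then obtain t where "p (scal t + h * h) \<le> t + m + e" "(p h)\<^sup>2 \<le> t"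
      by (auto simp: eventually_at_top_linorder)
    with norm_shifted_square[OF assms(2), of t] False show ?thesis by simp
  qed
  then show ?thesis by (rule field_le_epsilon)
qed (use assms in simp)

text \<open>
  The elements \<open>z\<^sup>* z\<close> and \<open>z z\<^sup>*\<close> have the same spectrum apart from \<open>0\<close>. In terms of norms:
  \<open>(t + z z\<^sup>*)\<^sup>n = t\<^sup>n + z g z\<^sup>*\<close>, where \<open>g\<close> is the sum of the \<open>n\<close> terms
  \<open>t\<^sup>n\<^sup>-\<^sup>1\<^sup>-\<^sup>j (t + z\<^sup>* z)\<^sup>j\<close>, so the norms of the powers are controlled up to a factor of linear growth.
\<close>

lemma upper_swap:
  assumes "upper (star z * z) m" "m \<ge> 0"
  shows "upper (z * star z) m"
  unfolding upper_def
proof (intro allI impI)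
  fix e :: real assume "e > 0"
  then have "\<forall>\<^sub>F t in at_top. p (scal t + star z * z) \<le> t + m + e"
    using assms by (simp add: upper_def)
  then show "\<forall>\<^sub>F t in at_top. p (scal t + z * star z) \<le> t + m + e"
    using eventually_gt_at_top[of 0]
  proof eventually_elim
    case (elim t)
    define R where "R = t + m + e"
    define a where "a = scal t + star z * z"
    define b where "b = scal t + z * star z"
    have R: "R > 0" "t \<le> R" "p a \<le> R" using elim \<open>e > 0\<close> assms(2) by (simp_all add: R_def a_def)
    have ind: "\<exists>g. b ^ n = scal (t ^ n) + z * g * star z \<and> p g * R \<le> real n * R ^ n" for n
    proof (induction n)
      case 0
      show ?case by (intro exI[of _ 0]) (simp add: scal_simps)
    next
      case (Suc n)
      then obtain g where g: "b ^ n = scal (t ^ n) + z * g * star z" "p g * R \<le> real n * R ^ n"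
        by blast
      have "b ^ Suc n = (scal (t^n) + z * g * star z) * b" by (simp only: power_Suc2 g)
      also have "\<dots> = scal (t^n) * scal t + scal (t^n) * (z * star z)
          + (z * g * star z * scal t + z * g * star z * (z * star z))"
        by (simp add: b_def algebra_simps)
      also have "z * g * star z * scal t = z * (g * scal t) * star z"
        by (metis mult.assoc scal_commute)
      also have "scal (t^n) * (z * star z) = z * scal (t^n) * star z"
        by (metis mult.assoc scal_commute)
      finally have "b ^ Suc n = scal (t^Suc n) + z * (g * a + scal (t^n)) * star z"
        by (simp add: a_def algebra_simps scal_simps(2))
           (metis scal_commute)
      moreover have "p (g * a + scal (t^n)) * R \<le> real (Suc n) * R ^ Suc n"
      proof -
        have tn: "t ^ n \<le> R ^ n" using R elim by (intro power_mono) auto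
        have "p (g * a + scal (t^n)) \<le> p g * R + R ^ n"
          using triangle[of "g*a" "scal (t^n)"] submult[of g a] p_scal[of "t^n"] elim tn
            mult_left_mono[OF R(3) nonneg[of g]] by simp
        then have "p (g * a + scal (t^n)) * R \<le> (p g * R + R ^ n) * R"
          using R by (intro mult_right_mono) auto
        also have "\<dots> \<le> (real n * R ^ n + R ^ n) * R"
          using R g by (intro mult_right_mono add_right_mono) auto
        finally show ?thesis by (simp add: algebra_simps)
      qed
      ultimately show ?case by blast
    qed
    have hb: "hermitian b" by (simp add: hermitian_def b_def star_add star_mult star_star scal_simps(6))
    have "p b ^ (2^k) \<le> (1 + ((p z)\<^sup>2 / R) * 2^k) * R ^ (2^k)" for k
    proof -
      obtain g where g: "b ^ (2^k) = scal (t ^ (2^k)) + z * g * star z" "p g * R \<le> real (2^k) * R ^ (2^k)"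
        using ind by blast
      have tn: "t ^ (2^k) \<le> R ^ (2^k)" using R elim by (intro power_mono) auto
      have "p (z * g * star z) \<le> p z * p g * p z"
        by (metis submult p_star mult_right_mono nonneg order_trans)
      also have "\<dots> = (p z)\<^sup>2 / R * (p g * R)" using R by (simp add: power2_eq_square field_simps)
      also have "\<dots> \<le> (p z)\<^sup>2 / R * (real (2^k) * R ^ (2^k))"
        using g R by (intro mult_left_mono) auto
      finally have 1: "p (z * g * star z) \<le> (p z)\<^sup>2 / R * 2^k * R ^ (2^k)" by (simp add: mult.assoc)
      have "p b ^ (2^k) = p (b ^ (2^k))" by (simp add: p_power_two_power hb)
      also have "\<dots> \<le> t ^ (2^k) + p (z * g * star z)"
        unfolding g(1) using triangle[of "scal (t ^ (2^k))" "z * g * star z"] p_scal[of "t ^ (2^k)"] elim by simp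
      finally show ?thesis using 1 tn by (simp add: distrib_right)
    qed
    then have "p b \<le> R" by (rule power_growth_le[OF less_imp_le[OF R(1)]])
    then show ?case by (simp add: b_def R_def)
  qed
qed

text \<open>
  With \<open>z = h + ik\<close> for hermitian \<open>h\<close> and \<open>k\<close>, the sum \<open>z\<^sup>* z + z z\<^sup>* = 2h\<^sup>2 + 2k\<^sup>2\<close> has the upper bound
  \<open>2m\<close>, and so \<open>h\<^sup>2\<close> and \<open>k\<^sup>2\<close> have the upper bound \<open>m\<close>. The factor \<open>4\<close> comes from adding the
  norms of the two parts.
\<close>

lemma upper_norm_square:
  assumes up: "upper (star z * z) m" and m: "m \<ge> 0"
  shows "(p z)\<^sup>2 \<le> 4 * m"
proof -
  define h k where "h = (1/2) *\<^sub>C (z + star z)" and "k = (- \<i>/2) *\<^sub>C (z - star z)"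
  have half: "(1/2) *\<^sub>C x + (1/2) *\<^sub>C x = x" for x :: 'a
    unfolding scaleC_add_left[symmetric] by (simp add: scaleC_one)
  have hk: "hermitian h" "hermitian k"
    by (simp_all add: hermitian_def h_def k_def star_scaleC star_add star_diff star_star add.commute
       complex_vector.scale_right_diff_distrib)
  have z: "z = h + \<i> *\<^sub>C k"
  proof -
    have "h + \<i> *\<^sub>C k = ((1/2) *\<^sub>C z + (1/2) *\<^sub>C z)"
      by (simp add: h_def k_def scaleC_scaleC scaleC_add_right complex_vector.scale_right_diff_distrib)
    then show ?thesis by (simp only: half)
  qed
  have sz: "star z = h - \<i> *\<^sub>C k"
    using hk unfolding z by (simp add: star_add star_scaleC hermitian_def)
  have sum: "star z * z + z * star z = (h * h + h * h) + (k * k + k * k)"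
    by (subst (1 2) sz, subst (1 2) z) (simp add: algebra_simps mult_scaleC_left mult_scaleC_right scaleC_scaleC scaleC_one)
  have U: "upper (star z * z + z * star z) (m + m)"
    by (intro upper_add upper_swap up m)
  have sh: "scal (1/2) * (x + x) = x" for x :: 'a
    by (simp add: scal_mult scaleC_add_right half)
  have main: "(p h')\<^sup>2 \<le> m" if "hermitian h'" "hermitian k'"
      "star z * z + z * star z = (h' * h' + h' * h') + (k' * k' + k' * k')" for h' k'
  proof -
    have "upper (- (k' * k')) 0" by (rule upper_minus_square[OF that(2)])
    then have "upper ((star z * z + z * star z) + (- (k' * k') + - (k' * k'))) ((m + m) + (0 + 0))"
      by (intro upper_add U)
    then have "upper (h' * h' + h' * h') (m + m)" 
      using that(3) by (simp add: add.commute)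
    from upper_scale[OF this, of "1/2"] have "upper (h' * h') m" by (simp only: sh) simp
    then show ?thesis using that m by (intro upper_square_norm) auto
  qed
  have "(p h)\<^sup>2 \<le> m" "(p k)\<^sup>2 \<le> m" using main[OF hk sum] main[OF hk(2,1)] sum by (simp_all add: add.commute)
  then have "p h \<le> sqrt m" "p k \<le> sqrt m" using real_le_rsqrt by blast+
  moreover have "p z \<le> p h + p k" using triangle[of h "\<i> *\<^sub>C k"] by (simp add: z homogeneous)
  ultimately have "p z \<le> 2 * sqrt m" by simp
  then have "(p z)\<^sup>2 \<le> (2 * sqrt m)\<^sup>2" by (intro power_mono) auto
  then show ?thesis using m by (simp add: power_mult_distrib)
qed

text \<open>
  Visser's iteration for \<open>1 - \<surd>(1 - X)\<close>: the maps \<open>w \<mapsto> (X + w\<^sup>2)/2\<close> preserve the ball of radius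
  \<open>1/2\<close> as long as \<open>X\<close> has norm at most \<open>3/4\<close>, and the error of \<open>(1 - w)\<^sup>2\<close> is twice the last step.
\<close>

lemma sqrt_approximation:
  assumes x: "p (peval c X) \<le> 3/4" and d: "d > 0"
  shows "\<exists>s. p (peval c (s * s - (1 - X))) \<le> d"
proof -
  define w where "w = rec_nat (0 :: real poly) (\<lambda>_ v. smult (1/2) (X + v * v))"
  have w0: "w 0 = 0" and wS: "w (Suc n) = smult (1/2) (X + w n * w n)" for n
    by (simp_all add: w_def)
  have b: "p (peval c (w n)) \<le> 1/2" for n
  proof (induction n)
    case (Suc n)
    have "p (peval c (w n) * peval c (w n)) \<le> (1/2) * (1/2)"
      by (intro order.trans[OF submult] mult_mono Suc) auto
    then show ?case using triangle[of "peval c X" "peval c (w n) * peval c (w n)"] x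
      by (simp add: wS p_scal_mult)
  qed (simp add: w0)
  have dif: "p (peval c (w (Suc n) - w n)) \<le> (1/2)^n" for n
  proof (induction n)
    case 0
    show ?case using b[of 1] b[of 0] w0 by simp
  next
    case (Suc n)
    have "w (Suc (Suc n)) - w (Suc n) = smult (1/2) ((w (Suc n) - w n) * (w (Suc n) + w n))"
      by (simp only: wS[of "Suc n"] wS[of n, unfolded wS]) (simp add: wS algebra_simps smult_add_right smult_diff_right)
    then have "p (peval c (w (Suc (Suc n)) - w (Suc n)))
      = (1/2) * p (peval c (w (Suc n) - w n) * peval c (w (Suc n) + w n))"
      by (simp only: peval_smult p_scal_mult peval_mult)
    also have "\<dots> \<le> (1/2) * ((1/2)^n * 1)"
      using triangle[of "peval c (w (Suc n))" "peval c (w n)"] b[of n] b[of "Suc n"] Suc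
      by (intro mult_left_mono order.trans[OF submult] mult_mono) auto
    finally show ?case by simp
  qed
  obtain n where n: "(1/2::real)^n < d / 2" using real_arch_pow_inv[of "d/2" "1/2"] d by auto
  have "(1 - w n) * (1 - w n) - (1 - X) = smult 2 (w (Suc n) - w n)"
    by (simp add: wS algebra_simps smult_diff_right smult_add_right) (simp add: numeral_poly)
  then have "p (peval c ((1 - w n) * (1 - w n) - (1 - X))) \<le> d"
    using dif[of n] n by (simp only: peval_smult p_scal_mult)
  then show ?thesis by blast
qed

text \<open>
  Up to an error that is small in norm, \<open>1 - X\<close> is a square.
\<close>

lemma upper_minus_weighted_square:
  assumes c: "hermitian c" and x: "p (peval c X) \<le> 3/4"
  shows "upper (- peval c (Y * Y * (1 - X))) 0"
proof (rule upper_limit)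
  fix e :: real assume e: "e > 0"
  define M where "M = p (peval c (Y * Y)) + 1"
  have M: "M > 0" by (simp add: M_def add_nonneg_pos)
  obtain s where s: "p (peval c (s * s - (1 - X))) \<le> e / M"
    using sqrt_approximation[OF x, of "e / M"] e M by auto
  have "upper (- (peval c (Y * s) * peval c (Y * s))) 0"
    by (intro upper_minus_square hermitian_peval c)
  moreover have "p (peval c (Y * Y * (s * s - (1 - X)))) \<le> M * (e / M)"
    unfolding peval_mult[of c "Y * Y"]
    using s M by (intro order.trans[OF submult] mult_mono) (auto simp: M_def)
  then have "upper (peval c (Y * Y * (s * s - (1 - X)))) e"
    using M by (intro upper_mono[OF upper_norm]) simp
  ultimately have "upper (- (peval c (Y * s) * peval c (Y * s)) + peval c (Y * Y * (s * s - (1 - X)))) (0 + e)"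
    by (rule upper_add)
  moreover have "- (peval c (Y * s) * peval c (Y * s)) + peval c (Y * Y * (s * s - (1 - X)))
      = peval c (- ((Y * s) * (Y * s)) + Y * Y * (s * s - (1 - X)))"
    by (simp only: peval_mult peval_uminus peval_add)
  moreover have "- ((Y * s) * (Y * s)) + Y * Y * (s * s - (1 - X)) = - (Y * Y * (1 - X))"
    by (simp add: algebra_simps)
  ultimately show "upper (- peval c (Y * Y * (1 - X))) (0 + e)"
    by (simp only: peval_uminus)
qed

lemma upper_rescale:
  assumes "r > 0" "upper (- (star (scal (1/r) * x) * (scal (1/r) * x))) m"
  shows "upper (- (star x * x)) (r\<^sup>2 * m)"
proof -
  have "star (scal (1/r) * x) * (scal (1/r) * x) = scal (1/r * (1/r)) * (star x * x)"
    by (simp only: star_mult scal_simps(2,6)) (metis mult.assoc scal_commute)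
  then have "scal (r\<^sup>2) * - (star (scal (1/r) * x) * (scal (1/r) * x))
      = - (scal (r\<^sup>2 * (1/r * (1/r))) * (star x * x))"
    by (simp only: scal_simps(2) mult.assoc mult_minus_right)
  moreover have "r\<^sup>2 * (1/r * (1/r)) = 1" using assms(1) by (simp add: power2_eq_square)
  ultimately show ?thesis
    using upper_scale[OF assms(2), of "r\<^sup>2"] assms(1) by (simp add: scal_simps(4))
qed

text \<open>
  If \<open>c = x\<^sup>* x\<close> has norm at most one and \<open>z = x (1 - c)\<close>, then \<open>z\<^sup>* z = c (1 - c)\<^sup>2\<close>. The cubic
  \<open>s (1 - s)\<^sup>2\<close> is at most \<open>4/27\<close> for \<open>s \<le> 1\<close>, the certificate being
  \<open>4/27 - s (1 - s)\<^sup>2 = (s - 1/3)\<^sup>2 (4/3 - s)\<close>, so \<open>z\<close> is small, while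
  \<open>s - s (1 - s)\<^sup>2 = s\<^sup>2 (2 - s)\<close> shows that \<open>z\<^sup>* z\<close> is at least as negative as \<open>x\<^sup>* x\<close>.
  A bound for the negative part therefore improves by the factor \<open>4 \<cdot> 4/27\<close>.
\<close>

lemma positivity_step:
  assumes H: "\<And>x. p x \<le> 1 \<Longrightarrow> upper (- (star x * x)) \<theta>" and "\<theta> \<ge> 0" and x: "p x \<le> 1"
  shows "upper (- (star x * x)) (16/27 * \<theta>)"
proof -
  define c where "c = star x * x"
  have c: "hermitian c" by (simp add: c_def hermitian_def star_mult star_star)
  have pc: "p c \<le> 1" using x by (simp add: c_def cstar power_le_one)
  define X :: "real poly" where "X = [:0, 1:]"
  have X: "peval c X = c" by (simp add: X_def scal_simps)
  define z where "z = x * peval c (1 - X)"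
  have hz: "star (peval c (1 - X)) = peval c (1 - X)"
    using hermitian_peval[OF c] unfolding hermitian_def by blast
  have zz: "star z * z = peval c ((1 - X) * X * (1 - X))"
    by (simp only: z_def star_mult hz peval_mult X) (simp add: c_def mult.assoc)
  have 1: "(1 - X) * X * (1 - X) = [:4/27:] - smult (4/3) ((X - [:1/3:]) * (X - [:1/3:]) * (1 - smult (3/4) X))"
    by (simp add: X_def one_pCons field_simps)
  have p1: "p (peval c (smult (3/4) X)) \<le> 3/4" using pc by (simp add: X p_scal_mult)
  have p2: "p (peval c (smult (1/2) X)) \<le> 3/4" using pc by (simp add: X p_scal_mult)
  have "upper (scal (4/27) + scal (4/3) * - peval c ((X - [:1/3:]) * (X - [:1/3:]) * (1 - smult (3/4) X)))
      (4/27 + 4/3 * 0)"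
    by (intro upper_add upper_scal upper_scale upper_minus_weighted_square c p1) simp
  then have "upper (star z * z) (4/27)"
    by (simp only: zz 1 peval_diff peval_smult) simp
  then have z: "(p z)\<^sup>2 \<le> 16/27" using upper_norm_square[of z "4/27"] by simp
  have "upper (- (star z * z)) (16/27 * \<theta>)"
  proof (cases "p z = 0")
    case True
    have "upper (- (star z * z)) (p (- (star z * z)))" by (rule upper_norm)
    then show ?thesis using True \<open>\<theta> \<ge> 0\<close> by (rule_tac upper_mono[of _ 0]) (auto simp: cstar)
  next
    case False
    define r where "r = p z"
    have r: "r > 0" using False nonneg[of z] by (simp add: r_def order_less_le)
    have "p (scal (1/r) * z) \<le> 1" using r by (simp add: p_scal_mult r_def)
    from upper_rescale[OF r H[OF this]] show ?thesis
      using mult_right_mono[OF z \<open>\<theta> \<ge> 0\<close>] by (rule_tac upper_mono) (auto simp: r_def)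
  qed
  moreover have "upper (scal 2 * - peval c (X * X * (1 - smult (1/2) X))) (2 * 0)"
    by (intro upper_scale upper_minus_weighted_square c p2) simp
  ultimately have "upper (- (star z * z) + scal 2 * - peval c (X * X * (1 - smult (1/2) X))) (16/27 * \<theta> + 2 * 0)"
    by (rule upper_add)
  moreover have "- (star z * z) + scal 2 * - peval c (X * X * (1 - smult (1/2) X)) = - c"
  proof -
    have "- ((1 - X) * X * (1 - X)) + smult 2 (- (X * X * (1 - smult (1/2) X))) = - X"
      by (simp add: X_def one_pCons)
    from arg_cong[OF this, of "peval c"] show ?thesis
      by (simp only: peval_add peval_uminus peval_smult zz X)
  qed
  ultimately show ?thesis by (simp add: c_def)
qed

text \<open>
  The theorem of Fukamiya and Kaplansky that \<open>x\<^sup>* x\<close> is positive, for C*-seminorms.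
\<close>

lemma star_mult_self_positive: "upper (- (star x * x)) 0"
proof -
  have it: "p x \<le> 1 \<Longrightarrow> upper (- (star x * x)) ((16/27)^n)" for x n
  proof (induction n arbitrary: x)
    case 0
    then show ?case using upper_mono[OF upper_norm, of "- (star x * x)" 1]
      by (simp add: cstar power_le_one)
  next
    case (Suc n)
    from positivity_step[OF Suc.IH _ Suc.prems] show ?case by simp
  qed
  have unit: "upper (- (star x * x)) 0" if "p x \<le> 1" for x
  proof (rule upper_limit)
    fix e :: real assume "e > 0"
    then obtain n where "(16/27::real)^n < e" using real_arch_pow_inv[of e "16/27"] by auto
    then show "upper (- (star x * x)) (0 + e)" using it[OF that, of n] by (auto intro: upper_mono)
  qed
  show ?thesis
  proof (cases "p x \<le> 1")
    case False
    define r where "r = p x"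
    have r: "r > 0" using False by (simp add: r_def)
    have "p (scal (1/r) * x) \<le> 1" using r by (simp add: p_scal_mult r_def)
    from upper_rescale[OF r unit[OF this]] show ?thesis by simp
  qed (rule unit)
qed

text \<open>
  By positivity each \<open>x\<^sub>i\<^sup>* x\<^sub>i\<close> has the upper bound \<open>1\<close>. The sharp constant is \<open>1\<close>; what matters is
  that the bound depends neither on the seminorm nor on the number of summands.
\<close>

lemma norm_le_2_of_sum_eq_1:
  assumes fin: "finite A" and sum: "(\<Sum>k\<in>A. star (x k) * x k) = 1" and i: "i \<in> A"
  shows "p (x i) \<le> 2"
proof -
  have rest: "upper (- (\<Sum>k\<in>B. star (x k) * x k)) 0" if "finite B" for B
    using that
  proof (induction B)
    case empty
    show ?case using upper_scal[of 0] by (simp add: scal_simps)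
  next
    case (insert j B)
    then show ?case using upper_add[OF insert.IH star_mult_self_positive[of "x j"]]
      by (simp add: add.commute)
  qed
  have "upper (scal 1 + - (\<Sum>k\<in>A-{i}. star (x k) * x k)) (1 + 0)"
    using fin by (intro upper_add upper_scal rest) auto
  moreover have "scal 1 + - (\<Sum>k\<in>A-{i}. star (x k) * x k) = star (x i) * x i"
    using sum by (simp add: scal_simps sum.remove[OF fin i] algebra_simps)
  ultimately have "upper (star (x i) * x i) 1" by simp
  then have "(p (x i))\<^sup>2 \<le> 2\<^sup>2" using upper_norm_square[of "x i" 1] by simp
  then show ?thesis by (rule power2_le_imp_le) simp
qed

end

section \<open>Positive functionals\<close>

definition positive_functional :: "('a::complex_star_algebra \<Rightarrow> complex) \<Rightarrow> bool"
  where "positive_functional f \<longleftrightarrow> clinear f \<and> (\<forall>x. f (star x * x) \<in> \<real>\<^sub>\<ge>\<^sub>0)"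

lemma clinear_functional_add: "clinear (f :: 'a::complex_vector \<Rightarrow> complex) \<Longrightarrow> f (x + y) = f x + f y"
  and clinear_functional_scaleC: "clinear f \<Longrightarrow> f (c *\<^sub>C x) = c * f x"
  by (simp_all add: clinear_iff scaleC_complex_def)

lemma clinear_functional_0: "clinear (f :: 'a::complex_vector \<Rightarrow> complex) \<Longrightarrow> f 0 = 0"
  using clinear_functional_scaleC[of f 0 0] by simp

lemma clinear_functional_uminus: "clinear (f :: 'a::complex_vector \<Rightarrow> complex) \<Longrightarrow> f (- x) = - f x"
  using clinear_functional_scaleC[of f "-1" x] by simp

lemma clinear_functional_diff: "clinear (f :: 'a::complex_vector \<Rightarrow> complex) \<Longrightarrow> f (x - y) = f x - f y"
  using clinear_functional_add[of f x "- y"] by (simp add: clinear_functional_uminus)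

lemma clinear_functional_sum:
  "clinear (f :: 'a::complex_vector \<Rightarrow> complex) \<Longrightarrow> f (\<Sum>i\<in>I. g i) = (\<Sum>i\<in>I. f (g i))"
  by (induction I rule: infinite_finite_induct)
    (simp_all add: clinear_functional_0 clinear_functional_add)

lemmas clinear_functional_simps = clinear_functional_add clinear_functional_scaleC
  clinear_functional_0 clinear_functional_uminus clinear_functional_diff clinear_functional_sum

context
  fixes f :: "'a::complex_star_algebra \<Rightarrow> complex"
  assumes f: "positive_functional f"
begin

lemma positive_linear: "clinear f"
  using f by (simp add: positive_functional_def)

lemmas positive_simps = clinear_functional_simps[OF positive_linear]

lemma gns_length_nonneg: "0 \<le> gns_length f x"
  and positive_square: "f (star x * x) = complex_of_real ((gns_length f x)\<^sup>2)"
proof -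
  have "Re (f (star x * x)) \<ge> 0" "Im (f (star x * x)) = 0"
    using f by (auto simp: positive_functional_def complex_nonneg_Reals_iff)
  then show "0 \<le> gns_length f x" "f (star x * x) = complex_of_real ((gns_length f x)\<^sup>2)"
    by (simp_all add: gns_length_def complex_eq_iff)
qed

text \<open>
  Both statements come from the positivity of \<open>f ((x + c y)\<^sup>* (x + c y))\<close>: the first one for
  \<open>c = 1\<close> and \<open>c = i\<close>, the second one for suitable multiples of the conjugate of \<open>f (x\<^sup>* y)\<close>.
\<close>

lemma positive_conj_and_cauchy_schwarz:
  "f (star y * x) = cnj (f (star x * y)) \<and> cmod (f (star x * y)) \<le> gns_length f x * gns_length f y"
proof -
  define w w' X Y where "w = f (star x * y)" and "w' = f (star y * x)"
    and "X = (gns_length f x)\<^sup>2" and "Y = (gns_length f y)\<^sup>2"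
  have pos: "complex_of_real X + c * w + cnj c * w' + of_real ((cmod c)\<^sup>2 * Y) \<in> \<real>\<^sub>\<ge>\<^sub>0" for c
  proof -
    have "star (x + c *\<^sub>C y) * (x + c *\<^sub>C y)
      = star x * x + c *\<^sub>C (star x * y) + cnj c *\<^sub>C (star y * x) + (c * cnj c) *\<^sub>C (star y * y)"
      by (simp add: star_add star_scaleC algebra_simps mult_scaleC_left mult_scaleC_right
        scaleC_scaleC)
    then have "f (star (x + c *\<^sub>C y) * (x + c *\<^sub>C y))
      = complex_of_real X + c * w + cnj c * w' + of_real ((cmod c)\<^sup>2 * Y)"
      by (simp add: positive_simps w_def w'_def X_def Y_def positive_square
          complex_norm_square[symmetric])
    then show ?thesis using f by (metis positive_functional_def)
  qed
  have w': "w' = cnj w"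
    using pos[of 1] pos[of \<i>] by (auto simp: complex_nonneg_Reals_iff complex_eq_iff)
  have quad: "0 \<le> X - 2 * s * (cmod w)\<^sup>2 + s\<^sup>2 * (cmod w)\<^sup>2 * Y" for s
  proof -
    have cw: "cnj w * w = complex_of_real ((cmod w)\<^sup>2)" "w * cnj w = complex_of_real ((cmod w)\<^sup>2)"
      using complex_norm_square[of w] by (simp_all add: mult.commute)
    have "complex_of_real X + (- of_real s * cnj w) * w + cnj (- of_real s * cnj w) * w'
       + of_real ((cmod (- of_real s * cnj w))\<^sup>2 * Y)
       = of_real (X - 2 * s * (cmod w)\<^sup>2 + s\<^sup>2 * (cmod w)\<^sup>2 * Y)"
      by (simp add: w' mult.assoc cw norm_mult power_mult_distrib del: of_real_power)
    then show ?thesis using pos[of "- of_real s * cnj w"] by (metis nonneg_Reals_of_real_iff)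
  qed
  have "(cmod w)\<^sup>2 \<le> X * Y"
  proof (cases "Y = 0")
    case True
    have "cmod w = 0"
    proof (rule ccontr)
      assume "cmod w \<noteq> 0"
      then show False using quad[of "(X + 1) / (2 * (cmod w)\<^sup>2)"] True by simp
    qed
    then show ?thesis by (simp add: X_def Y_def)
  next
    case False
    then have "Y > 0" by (simp add: Y_def)
    then show ?thesis using quad[of "1 / Y"] by (simp add: power2_eq_square field_simps)
  qed
  then have "(cmod w)\<^sup>2 \<le> (gns_length f x * gns_length f y)\<^sup>2"
    by (simp add: X_def Y_def power_mult_distrib)
  then have "cmod w \<le> gns_length f x * gns_length f y"
    by (rule power2_le_imp_le) (simp add: gns_length_nonneg)
  then show ?thesis using w' by (simp add: w_def w'_def)
qed

lemma positive_cauchy_schwarz: "cmod (f (star x * y)) \<le> gns_length f x * gns_length f y"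
  using positive_conj_and_cauchy_schwarz by blast

lemma positive_star_mult: "f (star y * x) = cnj (f (star x * y))"
  using positive_conj_and_cauchy_schwarz by blast

lemma positive_null:
  assumes "f (x * star x) = 0"
  shows "f (x * y) = 0"
proof -
  have "gns_length f (star x) = 0" using assms by (simp add: gns_length_def star_star)
  then show ?thesis using positive_cauchy_schwarz[of "star x" y] by (simp add: star_star)
qed

lemma gns_length_0: "gns_length f 0 = 0"
  by (simp add: gns_length_def positive_simps)

lemma gns_length_scaleC: "gns_length f (c *\<^sub>C x) = cmod c * gns_length f x"
proof -
  have "f (star (c *\<^sub>C x) * (c *\<^sub>C x)) = complex_of_real ((cmod c * gns_length f x)\<^sup>2)"
    by (simp add: star_scaleC mult_scaleC_left mult_scaleC_right scaleC_scaleC positive_simps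
        positive_square power_mult_distrib complex_norm_square[symmetric] mult.commute[of "cnj c"])
  then show ?thesis by (simp add: gns_length_def[of f "c *\<^sub>C x"] gns_length_nonneg)
qed

lemma gns_length_triangle: "gns_length f (x + y) \<le> gns_length f x + gns_length f y"
proof (rule power2_le_imp_le)
  have "Re (f (star (x + y) * (x + y)))
    = (gns_length f x)\<^sup>2 + 2 * Re (f (star x * y)) + (gns_length f y)\<^sup>2"
    using positive_star_mult[of y x]
    by (simp add: star_add distrib_left distrib_right positive_simps positive_square)
  then have "(gns_length f (x + y))\<^sup>2 = (gns_length f x)\<^sup>2 + 2 * Re (f (star x * y)) + (gns_length f y)\<^sup>2"
    by (simp add: positive_square)
  moreover have "Re (f (star x * y)) \<le> gns_length f x * gns_length f y"
    using complex_Re_le_cmod positive_cauchy_schwarz order.trans by blast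
  ultimately show "(gns_length f (x + y))\<^sup>2 \<le> (gns_length f x + gns_length f y)\<^sup>2"
    by (simp add: power2_sum)
qed (simp add: gns_length_nonneg)

lemma gns_length_sum: "gns_length f (\<Sum>i\<in>I. g i) \<le> (\<Sum>i\<in>I. gns_length f (g i))"
proof (induction I rule: infinite_finite_induct)
  case (insert i I)
  then show ?case using gns_length_triangle[of "g i" "sum g I"] by simp
qed (simp_all add: gns_length_0)

text \<open>
  A positive functional that is bounded in any way by a C*-seminorm is bounded with the best
  possible constant, its value at the unit: iterating Cauchy-Schwarz along the powers
  \<open>(a\<^sup>* a)\<^bsup>2^k\<^esup>\<close> makes the given constant disappear in the limit.
\<close>

lemma positive_bounded_sharp:
  assumes p: "cstar_seminorm p" and C: "\<And>b. (gns_length f b)\<^sup>2 \<le> C * (p b)\<^sup>2"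
  shows "(gns_length f a)\<^sup>2 \<le> (gns_length f 1)\<^sup>2 * (p a)\<^sup>2"
proof -
  interpret cstar_seminormed p by standard (rule p)
  define c where "c = star a * a"
  have c: "hermitian (c ^ n)" for n
    by (induction n) (simp_all add: hermitian_def c_def star_mult star_star power_commutes)
  define m where "m = (gns_length f 1)\<^sup>2"
  define r where "r k = cmod (f (c ^ (2^k)))" for k :: nat
  have r0: "r 0 = (gns_length f a)\<^sup>2" by (simp add: r_def c_def positive_square norm_power)
  have dbl: "star (c ^ (2^k)) * c ^ (2^k) = c ^ (2 ^ Suc k)" for k
    using c[of "2^k"] by (simp add: hermitian_def power_add[symmetric] mult_2)
  have step: "(r k)\<^sup>2 \<le> m * r (Suc k)" for k
  proof -
    have "r k \<le> gns_length f 1 * gns_length f (c ^ (2^k))"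
      using positive_cauchy_schwarz[of 1 "c ^ (2^k)"] by (simp add: r_def)
    then have "(r k)\<^sup>2 \<le> (gns_length f 1 * gns_length f (c ^ (2^k)))\<^sup>2"
      by (intro power_mono) (simp_all add: r_def)
    also have "\<dots> = m * r (Suc k)"
      using positive_square[of "c ^ (2^k)"] dbl[of k]
      by (simp add: r_def m_def power_mult_distrib del: power_Suc of_real_power)
    finally show ?thesis .
  qed
  have pow: "r 0 ^ (2^k) * m \<le> m ^ (2^k) * r k" for k
  proof (induction k)
    case (Suc k)
    show ?case
    proof (cases "m = 0")
      case False
      then have m: "m > 0" by (simp add: m_def)
      have "(r 0 ^ (2^k) * m)\<^sup>2 \<le> (m ^ (2^k) * r k)\<^sup>2"
        using Suc m by (intro power_mono) (simp_all add: r_def)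
      also have "\<dots> \<le> (m ^ (2^k))\<^sup>2 * (m * r (Suc k))"
        using step m by (simp add: power_mult_distrib)
      finally have "m * (r 0 ^ (2^Suc k) * m) \<le> m * (m ^ (2 ^ Suc k) * r (Suc k))"
        by (simp add: power2_eq_square power_add[symmetric] mult_2 power_mult_distrib mult_ac)
      then show ?thesis using m by (metis mult_le_cancel_left_pos)
    qed (simp add: r_def)
  qed simp
  have bound: "r k \<le> max 0 C * p c ^ (2^k)" for k
  proof (cases k)
    case 0
    have "C * (p a)\<^sup>2 \<le> max 0 C * (p a)\<^sup>2" by (intro mult_right_mono) auto
    with C[of a] show ?thesis using 0 r0 by (simp add: c_def cstar)
  next
    case (Suc j)
    have "r k = (gns_length f (c ^ (2^j)))\<^sup>2"
      using dbl[of j] positive_square[of "c ^ (2^j)"] by (simp add: r_def Suc norm_power del: power_Suc)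
    also have "\<dots> \<le> max 0 C * (p (c ^ (2^j)))\<^sup>2"
      using C by (rule order.trans) (intro mult_right_mono, auto)
    also have "(p (c ^ (2^j)))\<^sup>2 = p c ^ (2^k)"
      using c[of 1] by (simp add: p_power_two_power Suc power_mult[symmetric] mult.commute)
    finally show ?thesis .
  qed
  have "r 0 \<le> m * p c"
  proof (cases "m = 0")
    case True
    then show ?thesis using positive_cauchy_schwarz[of 1 c] by (simp add: r_def m_def)
  next
    case False
    then have m: "m > 0" by (simp add: m_def)
    show ?thesis
    proof (rule power_growth_le)
      fix k
      have "r 0 ^ (2^k) * m \<le> m ^ (2^k) * (max 0 C * p c ^ (2^k))"
        using pow[of k] mult_left_mono[OF bound[of k], of "m ^ (2^k)"] m
        by (meson order.trans zero_le_power less_imp_le)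
      then show "r 0 ^ (2^k) \<le> (max 0 C / m + 0 * 2^k) * (m * p c) ^ (2^k)"
        using m by (simp add: field_simps power_mult_distrib)
    qed (use m in simp)
  qed
  then show ?thesis by (simp add: r0 m_def c_def cstar)
qed

end

section \<open>Slices and products of functionals on a tensor product\<close>

lemma tensor_induct [case_names zero plus tensor]:
  assumes "P 0" "\<And>s t. P s \<Longrightarrow> P t \<Longrightarrow> P (s + t)" "\<And>a b. P (a \<otimes> b)"
  shows "P t"
proof (induct t rule: tensor.abs_induct)
  case (1 xs)
  have "P (\<Sum>(a, b)\<leftarrow>xs. a \<otimes> b)"
    by (induction xs) (auto intro: assms)
  then show ?case by (simp add: tensor_sum_list)
qed

lemma
  fixes a a' :: "'a::complex_vector" and b b' :: "'b::complex_vector"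
  shows tensor_add_left: "(a + a') \<otimes> b = a \<otimes> b + a' \<otimes> b"
    and tensor_add_right: "a \<otimes> (b + b') = a \<otimes> b + a \<otimes> b'"
    and tensor_scaleC_left: "(k *\<^sub>C a) \<otimes> b = k *\<^sub>C (a \<otimes> b)"
    and tensor_scaleC_right: "a \<otimes> (k *\<^sub>C b) = k *\<^sub>C (a \<otimes> b)"
  using cbilinear_tensor unfolding cbilinear_iff by blast+

lemma tensor_zero_left [simp]: "0 \<otimes> b = 0"
  using tensor_scaleC_left[of 0 0 b] by simp

lemma tensor_zero_right [simp]: "a \<otimes> 0 = 0"
  using tensor_scaleC_right[of a 0 0] by simp

lemma tensor_sum_right: "a \<otimes> (\<Sum>i\<in>I. b i) = (\<Sum>i\<in>I. a \<otimes> b i)"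
  by (induction I rule: infinite_finite_induct) (simp_all add: tensor_add_right)

lemma one_tensor_eq: "(1 :: 'a::complex_algebra_1 \<otimes> 'b::complex_algebra_1) = 1 \<otimes> 1"
  by (simp add: one_tensor_def tensor.abs_eq)

lemma tensor_lift_add: "cbilinear B \<Longrightarrow> tensor_lift B (s + t) = tensor_lift B s + tensor_lift B t"
  and tensor_lift_scaleC: "cbilinear B \<Longrightarrow> tensor_lift B (c *\<^sub>C t) = c *\<^sub>C tensor_lift B t"
  using clinear_tensor_lift unfolding clinear_iff by blast+

lemma tensor_lift_zero: "cbilinear B \<Longrightarrow> tensor_lift B 0 = 0"
  using tensor_lift_scaleC[of B 0 0] by simp

lemmas tensor_lift_simps = tensor_lift_add tensor_lift_scaleC tensor_lift_zero tensor_lift_tensor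

definition tensor_functional ::
    "('a::complex_star_algebra \<Rightarrow> complex) \<Rightarrow> ('b::complex_star_algebra \<Rightarrow> complex) \<Rightarrow> 'a \<otimes> 'b \<Rightarrow> complex"
  where "tensor_functional f g = tensor_lift (\<lambda>a b. f a * g b)"

definition right_slice ::
    "('b::complex_star_algebra \<Rightarrow> complex) \<Rightarrow> 'a::complex_star_algebra \<otimes> 'b \<Rightarrow> 'a"
  where "right_slice g = tensor_lift (\<lambda>a b. g b *\<^sub>C a)"

definition left_slice ::
    "('a::complex_star_algebra \<Rightarrow> complex) \<Rightarrow> 'a \<otimes> 'b::complex_star_algebra \<Rightarrow> 'b"
  where "left_slice f = tensor_lift (\<lambda>a b. f a *\<^sub>C b)"

context
  fixes f :: "'a::complex_star_algebra \<Rightarrow> complex" and g :: "'b::complex_star_algebra \<Rightarrow> complex"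
  assumes lin: "clinear f" "clinear g"
begin

lemma cbilinear_mult: "cbilinear (\<lambda>a b. f a * g b)"
  using lin by (simp add: cbilinear_iff clinear_functional_simps scaleC_complex_def algebra_simps)

lemma tensor_functional_linear: "clinear (tensor_functional f g)"
  unfolding tensor_functional_def by (intro clinear_tensor_lift cbilinear_mult)

lemma tensor_functional_tensor [simp]: "tensor_functional f g (a \<otimes> b) = f a * g b"
  unfolding tensor_functional_def by (intro tensor_lift_tensor cbilinear_mult)

lemmas tensor_functional_simps = clinear_functional_simps[OF tensor_functional_linear]

lemma right_slice_linear: "clinear (right_slice g :: 'a \<otimes> 'b \<Rightarrow> 'a)"
  and right_slice_tensor [simp]: "right_slice g (a \<otimes> b) = g b *\<^sub>C (a :: 'a)"
proof -
  have "cbilinear (\<lambda>(a::'a) b. g b *\<^sub>C a)"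
    using lin by (simp add: cbilinear_iff clinear_functional_simps algebra_simps scaleC_add_left
        scaleC_add_right scaleC_scaleC mult.commute)
  then show "clinear (right_slice g :: 'a \<otimes> 'b \<Rightarrow> 'a)" "right_slice g (a \<otimes> b) = g b *\<^sub>C (a :: 'a)"
    by (simp_all add: right_slice_def clinear_tensor_lift tensor_lift_tensor)
qed

lemma left_slice_linear: "clinear (left_slice f :: 'a \<otimes> 'b \<Rightarrow> 'b)"
  and left_slice_tensor [simp]: "left_slice f (a \<otimes> b) = f a *\<^sub>C (b :: 'b)"
proof -
  have "cbilinear (\<lambda>a (b::'b). f a *\<^sub>C b)"
    using lin by (simp add: cbilinear_iff clinear_functional_simps algebra_simps scaleC_add_left
        scaleC_add_right scaleC_scaleC mult.commute)
  then show "clinear (left_slice f :: 'a \<otimes> 'b \<Rightarrow> 'b)" "left_slice f (a \<otimes> b) = f a *\<^sub>C (b :: 'b)"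
    by (simp_all add: left_slice_def clinear_tensor_lift tensor_lift_tensor)
qed

lemma right_slice_simps:
  "right_slice g (s + t) = right_slice g s + (right_slice g t :: 'a)"
  "right_slice g (0 :: 'a \<otimes> 'b) = 0"
  "right_slice g (\<Sum>i\<in>I. u i) = (\<Sum>i\<in>I. right_slice g (u i) :: 'a)"
proof -
  show 1: "right_slice g (s + t) = right_slice g s + (right_slice g t :: 'a)" for s t
    using right_slice_linear unfolding clinear_iff by blast
  show 2: "right_slice g (0 :: 'a \<otimes> 'b) = 0" using 1[of 0 0] by simp
  show "right_slice g (\<Sum>i\<in>I. u i) = (\<Sum>i\<in>I. right_slice g (u i) :: 'a)"
    by (induction I rule: infinite_finite_induct) (simp_all add: 1 2)
qed

lemma left_slice_simps:
  "left_slice f (s + t) = left_slice f s + (left_slice f t :: 'b)"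
  "left_slice f (0 :: 'a \<otimes> 'b) = 0"
proof -
  show 1: "left_slice f (s + t) = left_slice f s + (left_slice f t :: 'b)" for s t
    using left_slice_linear unfolding clinear_iff by blast
  show 2: "left_slice f (0 :: 'a \<otimes> 'b) = 0" using 1[of 0 0] by simp
qed

lemma tensor_functional_right_slice:
  "tensor_functional f g ((v \<otimes> 1) * t * (x \<otimes> 1)) = f (v * right_slice g t * x)"
  by (induction t rule: tensor_induct)
    (simp_all add: tensor_functional_simps right_slice_simps times_tensor_tensor distrib_left distrib_right
      clinear_functional_simps[OF lin(1)] mult_scaleC_left mult_scaleC_right)

lemma tensor_functional_left_slice:
  "tensor_functional f g ((1 \<otimes> v) * t * (1 \<otimes> y)) = g (v * left_slice f t * y)"
  by (induction t rule: tensor_induct)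
    (simp_all add: tensor_functional_simps left_slice_simps times_tensor_tensor distrib_left distrib_right
      clinear_functional_simps[OF lin(2)] mult_scaleC_left mult_scaleC_right)

lemma tensor_functional_tracial:
  assumes "\<And>x y. f (x * y) = f (y * x)" "\<And>x y. g (x * y) = g (y * x)"
  shows "tensor_functional f g (s * t) = tensor_functional f g (t * s)"
proof (induction s rule: tensor_induct)
  case (tensor a b)
  show ?case
    by (induction t rule: tensor_induct)
      (simp_all add: tensor_functional_simps times_tensor_tensor distrib_left distrib_right assms(1)[of a] assms(2)[of b])
qed (simp_all add: tensor_functional_simps distrib_left distrib_right)

end

text \<open>
  For a tensor \<open>\<Sum> x\<^sub>i \<otimes> y\<^sub>i\<close> all \<open>y\<^sub>i\<close> except the first one, \<open>y\<^sub>1\<close>, can be made orthogonal to \<open>y\<^sub>1\<close> with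
  respect to \<open>g\<close> by moving their components along \<open>y\<^sub>1\<close> into the first summand. The mixed terms
  then vanish, and the remaining sum is shorter.
\<close>

lemma tensor_functional_positive:
  fixes f :: "'a::complex_star_algebra \<Rightarrow> complex" and g :: "'b::complex_star_algebra \<Rightarrow> complex"
  assumes f: "positive_functional f" and g: "positive_functional g"
  shows "positive_functional (tensor_functional f g)"
  unfolding positive_functional_def
proof (intro conjI allI)
  note lin = positive_linear[OF f] positive_linear[OF g]
  show "clinear (tensor_functional f g)" by (rule tensor_functional_linear[OF lin])
  note simps = tensor_functional_simps[OF lin] tensor_functional_tensor[OF lin]
  define \<phi> where "\<phi> = tensor_functional f g"
  have "\<phi> (star (\<Sum>(a, b)\<leftarrow>xs. a \<otimes> b) * (\<Sum>(a, b)\<leftarrow>xs. a \<otimes> b)) \<in> \<real>\<^sub>\<ge>\<^sub>0" for xs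
  proof (induction "length xs" arbitrary: xs)
    case 0
    then show ?case by (simp add: \<phi>_def simps)
  next
    case (Suc n)
    then obtain x1 y1 ys where xs: "xs = (x1, y1) # ys" and n: "n = length ys"
      by (metis Suc_length_conv surj_pair)
    \<comment> \<open>the coefficient of the projection to \<open>y\<^sub>1\<close>; it is \<open>0\<close>, as it should be, if \<open>y\<^sub>1\<close> is a null vector\<close>
    define \<alpha> where "\<alpha> y = g (star y1 * y) / g (star y1 * y1)" for y
    have orth: "g (star y1 * (y - \<alpha> y *\<^sub>C y1)) = 0" for y
    proof (cases "g (star y1 * y1) = 0")
      case True
      then have "g (star y1 * y) = 0"
        using positive_null[OF g, of "star y1"] by (simp add: star_star)
      with True show ?thesis
        by (simp add: \<alpha>_def positive_simps[OF g] right_diff_distrib mult_scaleC_right)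
    qed (simp add: \<alpha>_def positive_simps[OF g] right_diff_distrib mult_scaleC_right)
    then have orth': "g (star (y - \<alpha> y *\<^sub>C y1) * y1) = 0" for y
      using positive_star_mult[OF g, of "y - \<alpha> y *\<^sub>C y1" y1] by simp
    define zs where "zs = map (\<lambda>(x, y). (x, y - \<alpha> y *\<^sub>C y1)) ys"
    define X where "X = x1 + (\<Sum>(x, y)\<leftarrow>ys. \<alpha> y *\<^sub>C x)"
    define Z where "Z = (\<Sum>(a, b)\<leftarrow>zs. a \<otimes> b)"
    have eq: "(\<Sum>(a, b)\<leftarrow>xs. a \<otimes> b) = (X \<otimes> y1) + Z"
    proof -
      have "(\<Sum>(a, b)\<leftarrow>ys. a \<otimes> b) = ((\<Sum>(x, y)\<leftarrow>ys. \<alpha> y *\<^sub>C x) \<otimes> y1)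
        + (\<Sum>(a, b)\<leftarrow>map (\<lambda>(x, y). (x, y - \<alpha> y *\<^sub>C y1)) ys. a \<otimes> b)"
      proof (induction ys)
        case (Cons q ys)
        obtain x y where q: "q = (x, y)" by (cases q)
        have "x \<otimes> y = ((\<alpha> y *\<^sub>C x) \<otimes> y1) + x \<otimes> (y - \<alpha> y *\<^sub>C y1)"
          using tensor_add_right[of x "\<alpha> y *\<^sub>C y1" "y - \<alpha> y *\<^sub>C y1"]
          by (simp add: tensor_scaleC_left tensor_scaleC_right)
        then show ?case using Cons by (simp add: q tensor_add_left algebra_simps)
      qed simp
      then show ?thesis by (simp add: xs X_def Z_def zs_def tensor_add_left algebra_simps)
    qed
    have c1: "\<phi> (star (X \<otimes> y1) * Z) = 0"
    proof -
      have "\<phi> (star (X \<otimes> y1) * (\<Sum>(a, b)\<leftarrow>map (\<lambda>(x, y). (x, y - \<alpha> y *\<^sub>C y1)) ys. a \<otimes> b)) = 0"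
        by (induction ys) (auto simp: \<phi>_def simps distrib_left star_tensor_tensor times_tensor_tensor orth)
      then show ?thesis by (simp add: Z_def zs_def)
    qed
    have c2: "\<phi> (star Z * (X \<otimes> y1)) = 0"
    proof -
      have "\<phi> (star (\<Sum>(a, b)\<leftarrow>map (\<lambda>(x, y). (x, y - \<alpha> y *\<^sub>C y1)) ys. a \<otimes> b) * (X \<otimes> y1)) = 0"
        by (induction ys) (auto simp: \<phi>_def simps distrib_right star_add star_tensor_tensor times_tensor_tensor orth')
      then show ?thesis by (simp add: Z_def zs_def)
    qed
    have "\<phi> (star (X \<otimes> y1) * (X \<otimes> y1)) = f (star X * X) * g (star y1 * y1)"
      by (simp add: \<phi>_def simps star_tensor_tensor times_tensor_tensor)
    moreover have "f (star X * X) \<in> \<real>\<^sub>\<ge>\<^sub>0" "g (star y1 * y1) \<in> \<real>\<^sub>\<ge>\<^sub>0"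
      using f g by (simp_all add: positive_functional_def)
    ultimately have c3: "\<phi> (star (X \<otimes> y1) * (X \<otimes> y1)) \<in> \<real>\<^sub>\<ge>\<^sub>0" by (simp add: nonneg_Reals_mult_I)
    have c4: "\<phi> (star Z * Z) \<in> \<real>\<^sub>\<ge>\<^sub>0"
      unfolding Z_def by (rule Suc(1)) (simp add: zs_def n)
    have "\<phi> (star ((X \<otimes> y1) + Z) * ((X \<otimes> y1) + Z)) = \<phi> (star (X \<otimes> y1) * (X \<otimes> y1)) + \<phi> (star Z * Z)"
      using c1 c2 by (simp add: star_add distrib_left distrib_right \<phi>_def simps)
    then show ?case using c3 c4 by (simp add: eq nonneg_Reals_add_I)
  qed
  then show "tensor_functional f g (star t * t) \<in> \<real>\<^sub>\<ge>\<^sub>0" for t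
    by (induct t rule: tensor.abs_induct) (simp only: tensor_sum_list \<phi>_def)
qed

section \<open>Matrix coefficients, norms and convolution\<close>

lemma unitary_rep_unitary:
  assumes "unitary_rep \<Delta> n u" "i < n" "j < n"
  shows "\<Delta> (u i j) = (\<Sum>k<n. u i k \<otimes> u k j)"
    and "(\<Sum>k<n. u i k * star (u j k)) = (if i = j then 1 else 0)"
    and "(\<Sum>k<n. star (u k i) * u k j) = (if i = j then 1 else 0)"
  using assms by (simp_all add: unitary_rep_def)

locale cqg =
  fixes \<Delta> :: "'p::complex_star_algebra \<Rightarrow> 'p \<otimes> 'p" and \<epsilon> :: "'p \<Rightarrow> complex" and S :: "'p \<Rightarrow> 'p"
  assumes cqg: "compact_quantum_group \<Delta> \<epsilon> S"
begin

lemma hopf: "hopf_star_algebra \<Delta> \<epsilon> S"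
  using cqg by (simp add: compact_quantum_group_def)

lemma coproduct_simps:
  "\<Delta> (x + y) = \<Delta> x + \<Delta> y" "\<Delta> (c *\<^sub>C x) = c *\<^sub>C \<Delta> x" "\<Delta> (x * y) = \<Delta> x * \<Delta> y"
  "\<Delta> (star x) = star (\<Delta> x)" "\<Delta> 1 = 1"
  using hopf by (auto simp: hopf_star_algebra_def star_hom_def clinear_iff)

lemma coproduct_zero: "\<Delta> 0 = 0"
  using coproduct_simps(1)[of 0 0] by simp

lemma coproduct_sum: "\<Delta> (\<Sum>i\<in>I. g i) = (\<Sum>i\<in>I. \<Delta> (g i))"
  by (induction I rule: infinite_finite_induct) (simp_all add: coproduct_zero coproduct_simps)

lemma counit_hom: "star_hom \<epsilon>"
  using hopf by (simp add: hopf_star_algebra_def)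

lemma counit_linear: "clinear \<epsilon>"
  using counit_hom by (simp add: star_hom_def)

lemma counit_mult: "\<epsilon> (x * y) = \<epsilon> x * \<epsilon> y" and counit_one: "\<epsilon> 1 = 1"
    and counit_star: "\<epsilon> (star x) = cnj (\<epsilon> x)"
  using counit_hom by (simp_all add: star_hom_def star_complex_def)

lemma counit_right: "right_slice \<epsilon> (\<Delta> x) = x"
  and counit_left: "left_slice \<epsilon> (\<Delta> x) = x"
  using hopf by (simp_all add: hopf_star_algebra_def right_slice_def left_slice_def)

lemma matrix_coefficient_induct [case_names zero plus scale coefficient]:
  assumes "P 0" "\<And>x y. P x \<Longrightarrow> P y \<Longrightarrow> P (x + y)" "\<And>c x. P x \<Longrightarrow> P (c *\<^sub>C x)"
    "\<And>n u i j. unitary_rep \<Delta> n u \<Longrightarrow> i < n \<Longrightarrow> j < n \<Longrightarrow> P (u i j)"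
  shows "P x"
proof (rule complex_vector.span_induct)
  show "x \<in> cspan {u i j | n u i j. unitary_rep \<Delta> n u \<and> i < n \<and> j < n}"
    using cqg by (simp add: compact_quantum_group_def)
qed (auto simp: complex_vector.subspace_def intro: assms)

lemma cstar_seminorms_bounded: "\<exists>C. \<forall>p. cstar_seminorm p \<longrightarrow> p (a :: 'p) \<le> C"
proof (induction a rule: matrix_coefficient_induct)
  case zero
  have "p 0 \<le> 0" if "cstar_seminorm p" for p :: "'p \<Rightarrow> real"
    using cstar_seminormed.p_0[OF cstar_seminormed.intro[OF that]] by simp
  then show ?case by blast
next
  case (plus x y)
  then obtain C D where "\<forall>p. cstar_seminorm p \<longrightarrow> p x \<le> C" "\<forall>p. cstar_seminorm p \<longrightarrow> p y \<le> D"
    by blast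
  then have "p (x + y) \<le> C + D" if "cstar_seminorm p" for p :: "'p \<Rightarrow> real"
    using cstar_seminormed.triangle[OF cstar_seminormed.intro[OF that], of x y] that
    by (meson add_mono order.trans)
  then show ?case by blast
next
  case (scale c x)
  then obtain C where C: "\<forall>p. cstar_seminorm p \<longrightarrow> p x \<le> C" by blast
  have "p (c *\<^sub>C x) \<le> cmod c * C" if "cstar_seminorm p" for p :: "'p \<Rightarrow> real"
    using cstar_seminormed.homogeneous[OF cstar_seminormed.intro[OF that], of c x] that C
    by (simp add: mult_left_mono)
  then show ?case by blast
next
  case (coefficient n u i j)
  have "p (u i j) \<le> 2" if "cstar_seminorm p" for p
    using cstar_seminormed.norm_le_2_of_sum_eq_1[OF cstar_seminormed.intro[OF that], of "{..<n}" "\<lambda>k. u k j" i]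
      unitary_rep_unitary(3)[OF coefficient(1,3,3)] coefficient by simp
  then show ?case by blast
qed

lemma cstar_seminorm_le_universal_norm:
  assumes "cstar_seminorm p"
  shows "p (a :: 'p) \<le> universal_norm a"
  unfolding universal_norm_def
proof (rule cSUP_upper)
  show "p \<in> {p. cstar_seminorm p}" using assms by simp
  show "bdd_above ((\<lambda>p. p a) ` {p. cstar_seminorm p})"
    using cstar_seminorms_bounded[of a] by (auto simp: bdd_above_def)
qed

text \<open>
  A unitary coefficient \<open>u\<^sub>i\<^sub>j\<close> acts as a contraction, since the \<open>u\<^sub>k\<^sub>j\<^sup>* u\<^sub>k\<^sub>j\<close> sum to the unit.
\<close>

lemma gns_left_mult_bounded:
  assumes f: "positive_functional f"
  shows "\<exists>C\<ge>0. \<forall>x. gns_length f ((b :: 'p) * x) \<le> C * gns_length f x"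
proof (induction b rule: matrix_coefficient_induct)
  case zero
  show ?case by (intro exI[of _ 0]) (simp add: gns_length_0[OF f])
next
  case (plus a b)
  then obtain C D where C: "C \<ge> 0" "\<forall>x. gns_length f (a * x) \<le> C * gns_length f x"
    and D: "D \<ge> 0" "\<forall>x. gns_length f (b * x) \<le> D * gns_length f x" by blast
  have "gns_length f ((a + b) * x) \<le> (C + D) * gns_length f x" for x
    using gns_length_triangle[OF f, of "a * x" "b * x"] C(2)[rule_format, of x] D(2)[rule_format, of x]
    by (simp add: distrib_right)
  then show ?case using C D by (intro exI[of _ "C + D"]) auto
next
  case (scale c b)
  then obtain C where C: "C \<ge> 0" "\<forall>x. gns_length f (b * x) \<le> C * gns_length f x" by blast
  then show ?case
    by (intro exI[of _ "cmod c * C"])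
      (auto simp: mult_scaleC_left gns_length_scaleC[OF f] mult.assoc intro!: mult_left_mono)
next
  case (coefficient n u i j)
  have "gns_length f (u i j * x) \<le> 1 * gns_length f x" for x
  proof (rule power2_le_imp_le)
    have "of_real (\<Sum>k<n. (gns_length f (u k j * x))\<^sup>2) = f (\<Sum>k<n. star (u k j * x) * (u k j * x))"
      by (simp add: positive_simps[OF f] positive_square[OF f])
    also have "(\<Sum>k<n. star (u k j * x) * (u k j * x)) = star x * (\<Sum>k<n. star (u k j) * u k j) * x"
      by (simp add: star_mult sum_distrib_left sum_distrib_right mult.assoc)
    also have "\<dots> = star x * x" using unitary_rep_unitary(3)[OF coefficient(1,3,3)] by simp
    also have "f \<dots> = of_real ((gns_length f x)\<^sup>2)" by (rule positive_square[OF f])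
    finally have sum: "(\<Sum>k<n. (gns_length f (u k j * x))\<^sup>2) = (gns_length f x)\<^sup>2"
      by (simp only: of_real_eq_iff)
    have "(gns_length f (u i j * x))\<^sup>2 \<le> (\<Sum>k<n. (gns_length f (u k j * x))\<^sup>2)"
      using coefficient by (intro member_le_sum) auto
    then show "(gns_length f (u i j * x))\<^sup>2 \<le> (1 * gns_length f x)\<^sup>2" by (simp add: sum)
  qed (simp add: gns_length_nonneg[OF f])
  then show ?case by (intro exI[of _ 1]) auto
qed

lemma gns_length_mult_le:
  assumes f: "positive_functional f"
  shows "gns_length f ((a :: 'p) * x) \<le> gns_norm f a * gns_length f x"
proof -
  obtain C where C: "C \<ge> 0" "\<forall>x. gns_length f (a * x) \<le> C * gns_length f x"
    using gns_left_mult_bounded[OF f] by blast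
  have "bdd_above ((\<lambda>x. gns_length f (a * x)) ` {x. gns_length f x \<le> 1})"
  proof (rule bdd_aboveI2)
    fix x assume "x \<in> {x. gns_length f x \<le> 1}"
    then show "gns_length f (a * x) \<le> C" using C by (smt (verit) mem_Collect_eq mult_left_le)
  qed
  then have upper: "gns_length f (a * y) \<le> gns_norm f a" if "gns_length f y \<le> 1" for y
    unfolding gns_norm_def using that by (intro cSUP_upper) auto
  show ?thesis
  proof (cases "gns_length f x = 0")
    case True
    then show ?thesis using C(2)[rule_format, of x] by simp
  next
    case False
    then have x: "gns_length f x > 0" using gns_length_nonneg[OF f, of x] by simp
    show ?thesis
      using upper[of "complex_of_real (1 / gns_length f x) *\<^sub>C x"] x
      by (simp add: gns_length_scaleC[OF f] mult_scaleC_right norm_divide field_simps)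
  qed
qed

definition convolve :: "('p \<Rightarrow> complex) \<Rightarrow> 'p \<Rightarrow> 'p"
  where "convolve \<tau> a = right_slice \<tau> (\<Delta> a)"

text \<open>
  The multiplicative isometry \<open>x \<otimes> b \<mapsto> \<Delta> x (1 \<otimes> b)\<close> is surjective. On coefficients the
  unitarity of the representation provides the preimages.
\<close>

lemma coefficient_tensor_one:
  assumes "unitary_rep \<Delta> n u" "i < n" "j < n"
  shows "u i j \<otimes> 1 = (\<Sum>k<n. \<Delta> (u i k) * (1 \<otimes> star (u j k)))"
proof -
  have "(\<Sum>k<n. \<Delta> (u i k) * (1 \<otimes> star (u j k)))
      = (\<Sum>k<n. \<Sum>l<n. u i l \<otimes> (u l k * star (u j k)))"
    using assms by (simp add: unitary_rep_unitary(1) sum_distrib_right times_tensor_tensor)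
  also have "\<dots> = (\<Sum>l<n. u i l \<otimes> (\<Sum>k<n. u l k * star (u j k)))"
    by (subst sum.swap) (simp add: tensor_sum_right)
  also have "\<dots> = (\<Sum>l<n. if l = j then u i l \<otimes> 1 else 0)"
    using assms by (intro sum.cong) (auto simp: unitary_rep_unitary(2))
  also have "\<dots> = u i j \<otimes> 1" using assms by simp
  finally show ?thesis by simp
qed

context
  fixes h \<tau> :: "'p \<Rightarrow> complex"
  assumes haar: "haar_state \<Delta> h" and \<tau>: "positive_functional \<tau>" and \<tau>1: "\<tau> 1 = 1"
    and gns: "cstar_seminorm (gns_norm h)"
begin

lemma haar_positive: "positive_functional h"
  using haar by (simp add: haar_state_def positive_functional_def)

lemma haar_left_invariant: "left_slice h (\<Delta> x) = h x *\<^sub>C 1"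
  using haar by (simp add: haar_state_def left_slice_def)

lemmas factors_linear = positive_linear[OF haar_positive] positive_linear[OF \<tau>]

lemma product_positive: "positive_functional (tensor_functional h \<tau>)"
  by (rule tensor_functional_positive[OF haar_positive \<tau>])

lemma multiplicative_isometry:
  "gns_length (tensor_functional h \<tau>) (\<Delta> b * (1 \<otimes> y)) = gns_length h b * gns_length \<tau> y"
proof -
  have "star (\<Delta> b * (1 \<otimes> y)) * (\<Delta> b * (1 \<otimes> y)) = (1 \<otimes> star y) * \<Delta> (star b * b) * (1 \<otimes> y)"
    by (simp add: star_mult star_tensor_tensor coproduct_simps mult.assoc)
  then have "tensor_functional h \<tau> (star (\<Delta> b * (1 \<otimes> y)) * (\<Delta> b * (1 \<otimes> y)))
      = h (star b * b) * \<tau> (star y * y)"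
    by (simp add: tensor_functional_left_slice[OF factors_linear] haar_left_invariant mult_scaleC_left mult_scaleC_right
        positive_simps[OF \<tau>])
  then show ?thesis
    using positive_square[OF haar_positive, of b] positive_square[OF \<tau>, of y]
    by (simp add: gns_length_def[of "tensor_functional h \<tau>"] real_sqrt_mult
        gns_length_nonneg[OF haar_positive] gns_length_nonneg[OF \<tau>] flip: of_real_mult of_real_power)
qed

text \<open>
  The isometry takes \<open>a \<otimes> 1\<close> to left multiplication by \<open>\<Delta> a\<close>. Writing \<open>x \<otimes> 1\<close> as a finite sum in its
  range gives a bound whose constant depends on \<open>x\<close> in an uncontrolled way. This suffices, as
  \<open>positive_bounded_sharp\<close> improves the constant afterwards.
\<close>

lemma absorption_crude:
  "\<exists>C\<ge>0. \<forall>b. gns_length (tensor_functional h \<tau>) (\<Delta> b * (x \<otimes> 1)) \<le> C * gns_norm h b"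
proof (induction x rule: matrix_coefficient_induct)
  case zero
  show ?case by (intro exI[of _ 0]) (simp add: gns_length_0[OF product_positive])
next
  case (plus x y)
  then obtain C D where C: "C \<ge> 0" "\<forall>b. gns_length (tensor_functional h \<tau>) (\<Delta> b * (x \<otimes> 1)) \<le> C * gns_norm h b"
    and D: "D \<ge> 0" "\<forall>b. gns_length (tensor_functional h \<tau>) (\<Delta> b * (y \<otimes> 1)) \<le> D * gns_norm h b" by blast
  have "gns_length (tensor_functional h \<tau>) (\<Delta> b * ((x + y) \<otimes> 1)) \<le> (C + D) * gns_norm h b" for b
    using gns_length_triangle[OF product_positive, of "\<Delta> b * (x \<otimes> 1)" "\<Delta> b * (y \<otimes> 1)"]
      C(2)[rule_format, of b] D(2)[rule_format, of b]
    by (simp add: tensor_add_left distrib_left distrib_right)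
  then show ?case using C D by (intro exI[of _ "C + D"]) auto
next
  case (scale c x)
  then obtain C where C: "C \<ge> 0" "\<forall>b. gns_length (tensor_functional h \<tau>) (\<Delta> b * (x \<otimes> 1)) \<le> C * gns_norm h b" by blast
  then show ?case
    by (intro exI[of _ "cmod c * C"])
      (auto simp: tensor_scaleC_left mult_scaleC_right gns_length_scaleC[OF product_positive] mult.assoc
        intro!: mult_left_mono)
next
  case (coefficient n u i j)
  define C where "C = (\<Sum>k<n. gns_length h (u i k) * gns_length \<tau> (star (u j k)))"
  have "gns_length (tensor_functional h \<tau>) (\<Delta> b * (u i j \<otimes> 1)) \<le> C * gns_norm h b" for b
  proof -
    have "\<Delta> b * (u i j \<otimes> 1) = (\<Sum>k<n. \<Delta> (b * u i k) * (1 \<otimes> star (u j k)))"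
      by (simp add: coefficient_tensor_one[OF coefficient] sum_distrib_left coproduct_simps mult.assoc)
    then have "gns_length (tensor_functional h \<tau>) (\<Delta> b * (u i j \<otimes> 1))
      \<le> (\<Sum>k<n. gns_length h (b * u i k) * gns_length \<tau> (star (u j k)))"
      using gns_length_sum[OF product_positive, of "\<lambda>k. \<Delta> (b * u i k) * (1 \<otimes> star (u j k))" "{..<n}"]
      by (simp add: multiplicative_isometry)
    also have "\<dots> \<le> (\<Sum>k<n. gns_norm h b * gns_length h (u i k) * gns_length \<tau> (star (u j k)))"
      by (intro sum_mono mult_right_mono gns_length_mult_le haar_positive gns_length_nonneg[OF \<tau>])
    finally show ?thesis by (simp add: C_def sum_distrib_left sum_distrib_right mult_ac)
  qed
  moreover have "C \<ge> 0"
    by (simp add: C_def sum_nonneg gns_length_nonneg[OF haar_positive] gns_length_nonneg[OF \<tau>])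
  ultimately show ?case by blast
qed

lemma absorption:
  "gns_length (tensor_functional h \<tau>) (\<Delta> a * (x \<otimes> 1)) \<le> gns_norm h a * gns_length h x"
proof -
  define \<omega> where "\<omega> c = tensor_functional h \<tau> (star (x \<otimes> 1) * \<Delta> c * (x \<otimes> 1))" for c
  note tl = clinear_functional_simps[OF tensor_functional_linear[OF factors_linear]]
  have sq: "\<omega> (star c * c) = tensor_functional h \<tau> (star (\<Delta> c * (x \<otimes> 1)) * (\<Delta> c * (x \<otimes> 1)))" for c
    by (simp add: \<omega>_def coproduct_simps star_mult mult.assoc)
  have \<omega>: "positive_functional \<omega>"
    using product_positive unfolding positive_functional_def sq
    by (auto simp: clinear_iff \<omega>_def coproduct_simps distrib_left distrib_right tl
        mult_scaleC_left mult_scaleC_right scaleC_complex_def)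
  have len: "gns_length \<omega> c = gns_length (tensor_functional h \<tau>) (\<Delta> c * (x \<otimes> 1))" for c
    by (simp add: gns_length_def sq)
  have len1: "gns_length \<omega> 1 = gns_length h x"
    by (simp add: len coproduct_simps)
      (simp add: gns_length_def star_tensor_tensor times_tensor_tensor tensor_functional_tensor[OF factors_linear] \<tau>1)
  interpret cstar_seminormed "gns_norm h" by standard (rule gns)
  obtain C where C: "C \<ge> 0" "\<forall>b. gns_length \<omega> b \<le> C * gns_norm h b"
    unfolding len using absorption_crude by blast
  have "(gns_length \<omega> b)\<^sup>2 \<le> C\<^sup>2 * (gns_norm h b)\<^sup>2" for b
    using power_mono[OF C(2)[rule_format, of b] gns_length_nonneg[OF \<omega>], of 2] by (simp add: power_mult_distrib)
  from positive_bounded_sharp[OF \<omega> gns this, of a]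
  have "(gns_length \<omega> a)\<^sup>2 \<le> (gns_norm h a * gns_length h x)\<^sup>2"
    by (simp add: len1 power_mult_distrib mult.commute)
  then show ?thesis unfolding len
    by (rule power2_le_imp_le) (simp add: gns_length_nonneg[OF haar_positive])
qed

text \<open>
  Fell absorption: the GNS representation of the Haar state, multiplied by another representation,
  is a multiple of itself. For slice maps this means that they are contractive.
\<close>

lemma gns_norm_convolve: "gns_norm h (convolve \<tau> a) \<le> gns_norm h a"
  unfolding gns_norm_def[of h "convolve \<tau> a"]
proof (rule cSUP_least)
  show "{x. gns_length h x \<le> 1} \<noteq> {}"
    using gns_length_0[OF haar_positive] by (metis empty_iff mem_Collect_eq zero_le_one)
  fix x assume x: "x \<in> {x. gns_length h x \<le> 1}"
  interpret cstar_seminormed "gns_norm h" by standard (rule gns)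
  define y where "y = convolve \<tau> a * x"
  define Y where "Y = gns_length h y"
  have "of_real (Y\<^sup>2) = h (star y * convolve \<tau> a * x)"
    using positive_square[OF haar_positive, of y] by (simp add: Y_def y_def mult.assoc)
  also have "\<dots> = tensor_functional h \<tau> ((star y \<otimes> 1) * \<Delta> a * (x \<otimes> 1))"
    by (simp add: tensor_functional_right_slice[OF factors_linear] convolve_def)
  also have "\<dots> = tensor_functional h \<tau> (star (y \<otimes> 1) * (\<Delta> a * (x \<otimes> 1)))"
    by (simp add: star_tensor_tensor mult.assoc)
  finally have "Y\<^sup>2 = cmod (tensor_functional h \<tau> (star (y \<otimes> 1) * (\<Delta> a * (x \<otimes> 1))))"
    by (metis norm_of_real abs_power2)
  also have "\<dots> \<le> gns_length (tensor_functional h \<tau>) (y \<otimes> 1) * gns_length (tensor_functional h \<tau>) (\<Delta> a * (x \<otimes> 1))"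
    by (rule positive_cauchy_schwarz[OF product_positive])
  also have "gns_length (tensor_functional h \<tau>) (y \<otimes> 1) = Y"
    by (simp add: Y_def gns_length_def star_tensor_tensor times_tensor_tensor tensor_functional_tensor[OF factors_linear] \<tau>1)
  also have "Y * gns_length (tensor_functional h \<tau>) (\<Delta> a * (x \<otimes> 1)) \<le> Y * (gns_norm h a * gns_length h x)"
    by (intro mult_left_mono absorption) (simp add: Y_def gns_length_nonneg[OF haar_positive])
  also have "\<dots> \<le> Y * gns_norm h a"
    using x by (intro mult_left_mono mult_left_le) (simp_all add: Y_def gns_length_nonneg[OF haar_positive])
  finally have "Y * Y \<le> Y * gns_norm h a" by (simp add: power2_eq_square)
  moreover have "Y \<ge> 0" by (simp add: Y_def gns_length_nonneg[OF haar_positive])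
  ultimately have "Y \<le> gns_norm h a"
    by (cases "Y = 0") (auto simp: mult_le_cancel_left)
  then show "gns_length h (convolve \<tau> a * x) \<le> gns_norm h a" by (simp add: Y_def y_def)
qed

end
end

section \<open>The counit on invariant subspaces\<close>

lemma sum_lessThan_add: "(\<Sum>k<m + n. g k) = (\<Sum>k<m. g k) + (\<Sum>k<n. g (m + k))"
  for g :: "nat \<Rightarrow> 'a::comm_monoid_add"
  by (induction n) (simp_all add: add.assoc)

lemma cnj_mult_self: "cnj z * z = complex_of_real ((cmod z)\<^sup>2)"
  unfolding complex_norm_square by (rule mult.commute)

text \<open>
  Functions on \<open>X\<close> are compared on \<open>X\<close> only. A longest orthonormal family spans, and Bessel's
  inequality at the points of \<open>X\<close> bounds the length of such families.
\<close>

lemma orthonormal_basis: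
  fixes K :: "('x \<Rightarrow> complex) set"
  assumes X: "finite X" and zero: "(\<lambda>_. 0) \<in> K"
    and add: "\<And>a b. a \<in> K \<Longrightarrow> b \<in> K \<Longrightarrow> (\<lambda>x. a x + b x) \<in> K"
    and scale: "\<And>c a. a \<in> K \<Longrightarrow> (\<lambda>x. c * a x) \<in> K"
  shows "\<exists>(d::nat) e. (\<forall>p<d. e p \<in> K) \<and>
    (\<forall>p<d. \<forall>q<d. (\<Sum>x\<in>X. cnj (e p x) * e q x) = (if p = q then 1 else 0)) \<and>
    (\<forall>b\<in>K. \<forall>x\<in>X. b x = (\<Sum>p<d. (\<Sum>z\<in>X. cnj (e p z) * b z) * e p x))"
proof -
  define P where "P d e \<longleftrightarrow> (\<forall>p<d. e p \<in> K) \<and>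
    (\<forall>p<d. \<forall>q<d. (\<Sum>x\<in>X. cnj (e p x) * e q x) = (if p = q then 1 else 0))" for d :: nat and e
  have bessel: "(\<Sum>p<d. (cmod (e p x))\<^sup>2) \<le> 1" if P: "P d e" and x: "x \<in> X" for d e x
  proof -
    \<comment> \<open>the component of the point mass at \<open>x\<close> orthogonal to the family\<close>
    define v where "v z = (if z = x then 1 else 0) - (\<Sum>p<d. cnj (e p x) * e p z)" for z
    define B where "B = (\<Sum>p<d. cnj (e p x) * e p x)"
    have B: "B = of_real (\<Sum>p<d. (cmod (e p x))\<^sup>2)"
      by (simp add: B_def cnj_mult_self del: of_real_power)
    have ev: "(\<Sum>z\<in>X. cnj (e p z) * v z) = 0" if p: "p < d" for p
    proof -
      have "(\<Sum>z\<in>X. cnj (e p z) * v z) = (\<Sum>z\<in>X. cnj (e p z) * (if z = x then 1 else 0))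
          - (\<Sum>z\<in>X. \<Sum>q<d. cnj (e q x) * (cnj (e p z) * e q z))"
        by (simp add: v_def right_diff_distrib sum_subtractf sum_distrib_left mult_ac)
      also have "(\<Sum>z\<in>X. \<Sum>q<d. cnj (e q x) * (cnj (e p z) * e q z))
          = (\<Sum>q<d. cnj (e q x) * (\<Sum>z\<in>X. cnj (e p z) * e q z))"
        by (subst sum.swap) (simp add: sum_distrib_left)
      also have "\<dots> = (\<Sum>q<d. if q = p then cnj (e q x) else 0)"
        using P p by (intro sum.cong) (auto simp: P_def)
      also have "(\<Sum>z\<in>X. cnj (e p z) * (if z = x then 1 else 0)) = (\<Sum>z\<in>X. if z = x then cnj (e p z) else 0)"
        by (intro sum.cong) auto
      finally show ?thesis using X x p by simp
    qed
    have "(\<Sum>z\<in>X. cnj (v z) * v z) = (\<Sum>z\<in>X. (if z = x then 1 else 0) * v z)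
        - (\<Sum>z\<in>X. \<Sum>p<d. e p x * (cnj (e p z) * v z))"
    proof -
      have "cnj (v z) = (if z = x then 1 else 0) - (\<Sum>p<d. e p x * cnj (e p z))" for z
        by (simp add: v_def cnj_sum)
      then show ?thesis
        by (simp only: left_diff_distrib sum_subtractf sum_distrib_right mult.assoc)
    qed
    also have "(\<Sum>z\<in>X. \<Sum>p<d. e p x * (cnj (e p z) * v z)) = (\<Sum>p<d. e p x * (\<Sum>z\<in>X. cnj (e p z) * v z))"
      by (subst sum.swap) (simp add: sum_distrib_left)
    also have "\<dots> = 0" by (simp add: ev)
    also have "(\<Sum>z\<in>X. (if z = x then 1 else 0) * v z) = v x"
      using X x by (simp add: if_distrib[of "\<lambda>c. c * _"] cong: if_cong)
    finally have "(\<Sum>z\<in>X. cnj (v z) * v z) = 1 - B" by (simp add: v_def B_def)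
    moreover have "(\<Sum>z\<in>X. cnj (v z) * v z) = of_real (\<Sum>z\<in>X. (cmod (v z))\<^sup>2)"
      by (simp add: cnj_mult_self del: of_real_power)
    ultimately have "of_real (\<Sum>z\<in>X. (cmod (v z))\<^sup>2) = complex_of_real (1 - (\<Sum>p<d. (cmod (e p x))\<^sup>2))"
      by (simp add: B)
    then have "(\<Sum>z\<in>X. (cmod (v z))\<^sup>2) = 1 - (\<Sum>p<d. (cmod (e p x))\<^sup>2)"
      by (simp only: of_real_eq_iff)
    then show ?thesis using sum_nonneg[of X "\<lambda>z. (cmod (v z))\<^sup>2"] by simp
  qed
  have bound: "d \<le> card X" if P: "P d e" for d e
  proof -
    have "of_real (\<Sum>p<d. \<Sum>x\<in>X. (cmod (e p x))\<^sup>2) = (\<Sum>p<d. \<Sum>x\<in>X. cnj (e p x) * e p x)"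
      by (simp add: cnj_mult_self del: of_real_power)
    also have "\<dots> = of_real (real d)" using P by (simp add: P_def)
    finally have "real d = (\<Sum>p<d. \<Sum>x\<in>X. (cmod (e p x))\<^sup>2)" by (simp only: of_real_eq_iff)
    also have "\<dots> = (\<Sum>x\<in>X. \<Sum>p<d. (cmod (e p x))\<^sup>2)" by (rule sum.swap)
    also have "\<dots> \<le> (\<Sum>x\<in>X. 1)" by (intro sum_mono bessel[OF P])
    finally show ?thesis by simp
  qed
  have "\<exists>d. (\<exists>e. P d e) \<and> (\<forall>d'. (\<exists>e. P d' e) \<longrightarrow> d' \<le> d)"
  proof (rule ex_has_greatest_nat[of "\<lambda>d. \<exists>e. P d e" 0 "\<lambda>d. d" "Suc (card X)"])
    show "\<exists>e. P 0 e" by (simp add: P_def)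
  qed (use bound in \<open>auto simp: less_Suc_eq_le\<close>)
  then obtain d e where P: "P d e" and max: "\<And>d' e'. P d' e' \<Longrightarrow> d' \<le> d" by blast
  show ?thesis
  proof (intro exI[of _ d] exI[of _ e] conjI ballI)
    show "\<forall>p<d. e p \<in> K" using P by (simp add: P_def)
    show "\<forall>p<d. \<forall>q<d. (\<Sum>x\<in>X. cnj (e p x) * e q x) = (if p = q then 1 else 0)"
      using P by (simp add: P_def)
    have orth: "(\<Sum>x\<in>X. cnj (e p x) * e q x) = (if p = q then 1 else 0)" if "p < d" "q < d" for p q
      using P that by (simp add: P_def)
    fix b x assume b: "b \<in> K" and x: "x \<in> X"
    define w where "w p = (\<Sum>z\<in>X. cnj (e p z) * b z)" for p
    define v where "v z = b z - (\<Sum>p<d. w p * e p z)" for z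
    have sumK: "(\<lambda>x. \<Sum>p<m. w p * e p x) \<in> K" if "m \<le> d" for m
      using that
    proof (induction m)
      case (Suc m)
      then show ?case using add[OF Suc.IH scale[of "e m" "w m"]] P by (simp add: P_def)
    qed (simp add: zero)
    have v: "v \<in> K"
      using add[OF b scale[OF sumK[OF order_refl], of "-1"]] by (simp add: v_def[abs_def])
    have ev: "(\<Sum>z\<in>X. cnj (e p z) * v z) = 0" if p: "p < d" for p
    proof -
      have "(\<Sum>z\<in>X. cnj (e p z) * v z) = w p - (\<Sum>z\<in>X. \<Sum>q<d. w q * (cnj (e p z) * e q z))"
        by (simp add: v_def w_def right_diff_distrib sum_subtractf sum_distrib_left mult_ac)
      also have "(\<Sum>z\<in>X. \<Sum>q<d. w q * (cnj (e p z) * e q z))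
          = (\<Sum>q<d. w q * (\<Sum>z\<in>X. cnj (e p z) * e q z))"
        by (subst sum.swap) (simp add: sum_distrib_left)
      also have "\<dots> = (\<Sum>q<d. if q = p then w q else 0)"
        using p by (intro sum.cong) (auto simp: orth)
      finally show ?thesis using p by simp
    qed
    define N where "N = (\<Sum>z\<in>X. (cmod (v z))\<^sup>2)"
    have vv: "(\<Sum>z\<in>X. cnj (v z) * v z) = of_real N"
      by (simp add: N_def cnj_mult_self del: of_real_power)
    have "N = 0"
    proof (rule ccontr)
      assume "N \<noteq> 0"
      then have N: "N > 0" using sum_nonneg[of X "\<lambda>z. (cmod (v z))\<^sup>2"] by (simp add: N_def)
      define c where "c = complex_of_real (1 / sqrt N)"
      define f where "f z = c * v z" for z
      have c: "cnj c * c * of_real N = 1" using N by (simp add: c_def flip: of_real_mult)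
      have "(\<Sum>z\<in>X. cnj (f z) * f z) = cnj c * c * (\<Sum>z\<in>X. cnj (v z) * v z)"
        by (simp add: f_def sum_distrib_left mult_ac)
      then have ff: "(\<Sum>z\<in>X. cnj (f z) * f z) = 1" using c by (simp add: vv)
      have ef: "(\<Sum>z\<in>X. cnj (e p z) * f z) = 0" if "p < d" for p
      proof -
        have "(\<Sum>z\<in>X. cnj (e p z) * f z) = c * (\<Sum>z\<in>X. cnj (e p z) * v z)"
          by (simp add: f_def sum_distrib_left mult_ac)
        then show ?thesis using ev that by simp
      qed
      have fe: "(\<Sum>z\<in>X. cnj (f z) * e p z) = 0" if "p < d" for p
        using arg_cong[OF ef[OF that], of cnj] by (simp add: cnj_sum mult.commute)
      have "f \<in> K" using scale[OF v] by (simp add: f_def[abs_def])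
      then have "P (Suc d) (e(d := f))"
        using P ef fe ff by (auto simp: P_def less_Suc_eq)
      then show False using max by fastforce
    qed
    then have "v x = 0" using x X by (simp add: N_def sum_nonneg_eq_0_iff)
    then show "b x = (\<Sum>p<d. (\<Sum>z\<in>X. cnj (e p z) * b z) * e p x)" by (simp add: v_def w_def)
  qed
qed

context cqg
begin

definition direct_sum :: "nat \<Rightarrow> (nat \<Rightarrow> nat \<Rightarrow> 'p) \<Rightarrow> (nat \<Rightarrow> nat \<Rightarrow> 'p) \<Rightarrow> nat \<Rightarrow> nat \<Rightarrow> 'p"
  where "direct_sum m u v i j =
    (if i < m \<and> j < m then u i j else if m \<le> i \<and> m \<le> j then v (i - m) (j - m) else 0)"

lemma direct_sum_simps [simp]:
  "i < m \<Longrightarrow> j < m \<Longrightarrow> direct_sum m u v i j = u i j"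
  "direct_sum m u v (m + i) (m + j) = v i j"
  "i < m \<Longrightarrow> direct_sum m u v i (m + j) = 0"
  "j < m \<Longrightarrow> direct_sum m u v (m + i) j = 0"
  by (simp_all add: direct_sum_def)

lemma unitary_rep_direct_sum:
  assumes u: "unitary_rep \<Delta> m u" and v: "unitary_rep \<Delta> n v"
  shows "unitary_rep \<Delta> (m + n) (direct_sum m u v)"
proof -
  have cases: "(\<And>i. i < m \<Longrightarrow> Q i) \<Longrightarrow> (\<And>i. i < n \<Longrightarrow> Q (m + i)) \<Longrightarrow> \<forall>i<m + n. Q i" for Q
    by (metis add_less_cancel_left le_add_diff_inverse not_less)
  show ?thesis
    unfolding unitary_rep_def
    by (intro conjI cases)
      (simp_all add: sum_lessThan_add unitary_rep_unitary[OF u] unitary_rep_unitary[OF v] coproduct_zero)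
qed

text \<open>
  Thanks to direct sums a single representation suffices for a linear combination of coefficients
  of several ones.
\<close>

lemma single_rep:
  "\<exists>n u c. unitary_rep \<Delta> n u \<and> a = (\<Sum>i<n. \<Sum>j<n. c i j *\<^sub>C u i j)"
proof (induction a rule: matrix_coefficient_induct)
  case zero
  have "unitary_rep \<Delta> 0 (\<lambda>_ _. 0)" by (simp add: unitary_rep_def)
  then show ?case by fastforce
next
  case (plus x y)
  then obtain m u c n v d where u: "unitary_rep \<Delta> m u" "x = (\<Sum>i<m. \<Sum>j<m. c i j *\<^sub>C u i j)"
    and v: "unitary_rep \<Delta> n v" "y = (\<Sum>i<n. \<Sum>j<n. d i j *\<^sub>C v i j)" by blast
  define e where "e i j = (if i < m \<and> j < m then c i j else d (i - m) (j - m))" for i j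
  have "x + y = (\<Sum>i<m+n. \<Sum>j<m+n. e i j *\<^sub>C direct_sum m u v i j)"
    by (simp add: sum_lessThan_add u v e_def)
  then show ?case using unitary_rep_direct_sum[OF u(1) v(1)] by blast
next
  case (scale k x)
  then obtain m u c where u: "unitary_rep \<Delta> m u" "x = (\<Sum>i<m. \<Sum>j<m. c i j *\<^sub>C u i j)" by blast
  have "k *\<^sub>C x = (\<Sum>i<m. \<Sum>j<m. (k * c i j) *\<^sub>C u i j)"
    by (simp add: u complex_vector.scale_sum_right scaleC_scaleC)
  with u show ?case by (intro exI[of _ m] exI[of _ u]) auto
next
  case (coefficient n u k l)
  have "u k l = (\<Sum>i<n. \<Sum>j<n. (if i = k \<and> j = l then 1 else 0) *\<^sub>C u i j)"
  proof -
    have "(\<Sum>i<n. \<Sum>j<n. (if i = k \<and> j = l then 1 else 0) *\<^sub>C u i j)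
      = (\<Sum>i<n. if i = k then (\<Sum>j<n. if j = l then u i j else 0) else 0)"
    proof (intro sum.cong refl)
      fix i
      have "(\<Sum>j<n. (if i = k \<and> j = l then 1 else 0) *\<^sub>C u i j)
          = (\<Sum>j<n. if i = k then (if j = l then u i j else 0) else 0)"
        by (intro sum.cong refl) (auto simp: scaleC_one)
      then show "(\<Sum>j<n. (if i = k \<and> j = l then 1 else 0) *\<^sub>C u i j)
          = (if i = k then (\<Sum>j<n. if j = l then u i j else 0) else 0)" by simp
    qed
    then show ?thesis using coefficient by simp
  qed
  with coefficient show ?case by (intro exI[of _ n] exI[of _ u]) auto
qed

text \<open>
  The counit axiom says that \<open>u\<close> times the matrix of the values \<open>\<epsilon> (u\<^sub>i\<^sub>j)\<close> is \<open>u\<close>, and \<open>u\<close> is invertible.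
\<close>

lemma counit_coefficient:
  assumes u: "unitary_rep \<Delta> n u" "i < n" "j < n"
  shows "\<epsilon> (u i j) = (if i = j then 1 else 0)"
proof -
  define E where "E k = \<epsilon> (u k j) - (if k = j then 1 else 0)" for k
  have "(\<Sum>k<n. E k *\<^sub>C u l k) = 0" if l: "l < n" for l
  proof -
    have "(\<Sum>k<n. \<epsilon> (u k j) *\<^sub>C u l k) = u l j"
      using counit_right[of "u l j"] u l
      by (simp add: unitary_rep_unitary(1) right_slice_simps[OF counit_linear counit_linear]
          right_slice_tensor[OF counit_linear counit_linear])
    moreover have "(\<Sum>k<n. (if k = j then 1 else 0) *\<^sub>C u l k) = u l j"
    proof -
      have "(\<Sum>k<n. (if k = j then 1 else 0) *\<^sub>C u l k) = (\<Sum>k<n. if k = j then u l k else 0)"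
        by (intro sum.cong) (auto simp: scaleC_one)
      then show ?thesis using u by simp
    qed
    ultimately show ?thesis
      by (simp add: E_def complex_vector.scale_left_diff_distrib sum_subtractf)
  qed
  then have "0 = (\<Sum>l<n. star (u l i) * (\<Sum>k<n. E k *\<^sub>C u l k))" by simp
  also have "\<dots> = (\<Sum>l<n. \<Sum>k<n. E k *\<^sub>C (star (u l i) * u l k))"
    by (simp add: sum_distrib_left mult_scaleC_right)
  also have "\<dots> = (\<Sum>k<n. E k *\<^sub>C (\<Sum>l<n. star (u l i) * u l k))"
    by (subst sum.swap) (simp add: complex_vector.scale_sum_right)
  also have "\<dots> = (\<Sum>k<n. if k = i then E k *\<^sub>C 1 else 0)"
    using u by (intro sum.cong) (auto simp: unitary_rep_unitary(3))
  also have "\<dots> = E i *\<^sub>C 1" using u by simp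
  finally have "\<epsilon> (E i *\<^sub>C 1) = \<epsilon> 0" by (simp only:)
  then show ?thesis
    by (simp add: clinear_functional_simps[OF counit_linear] counit_one E_def)
qed

text \<open>
  Write \<open>a\<close> as a linear combination of the coefficients \<open>u\<^sub>i\<^sub>j\<close> of a unitary representation. The
  coefficient matrices of elements of \<open>J\<close> form a space \<open>K\<close> of matrices, on which the coproduct
  induces a coaction, right multiplication by the transpose of \<open>u\<close>. It preserves the standard inner
  product, so in an orthonormal basis \<open>e\<close> of \<open>K\<close> it is given by a matrix \<open>T\<close> over \<open>Pol\<close> that is
  isometric as far as the trace \<open>\<sigma>\<close> can see. In the presence of a trace a square matrix that is
  isometric is unitary, because \<open>1 - T T\<^sup>*\<close> has square norm \<open>d - 2d + d = 0\<close>. So the coaction on \<open>K\<close>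
  can be inverted within \<open>K\<close>, which recovers the counit on \<open>K\<close> from the values of \<open>\<sigma>\<close> at
  multiples of elements of \<open>J\<close>. These are all zero.
\<close>

lemma counit_vanishes_on_invariant_subspace:
  assumes \<sigma>: "positive_functional \<sigma>" and trace: "\<And>x y. \<sigma> (x * y) = \<sigma> (y * x)" and \<sigma>1: "\<sigma> 1 = 1"
    and J_0: "0 \<in> J" and J_add: "\<And>x y. x \<in> J \<Longrightarrow> y \<in> J \<Longrightarrow> x + y \<in> J"
    and J_scale: "\<And>c x. x \<in> J \<Longrightarrow> c *\<^sub>C x \<in> J"
    and null: "\<And>x y. x \<in> J \<Longrightarrow> \<sigma> (x * y) = 0"
    and invariant: "\<And>x y. x \<in> J \<Longrightarrow> right_slice (\<lambda>b. \<sigma> (b * y)) (\<Delta> x) \<in> J"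
    and a: "a \<in> J"
  shows "\<epsilon> a = 0"
proof -
  obtain n u c0 where u: "unitary_rep \<Delta> n u" and a_eq: "a = (\<Sum>i<n. \<Sum>j<n. c0 i j *\<^sub>C u i j)"
    using single_rep by blast
  note lin = positive_simps[OF \<sigma>]
  define X where "X = {..<n} \<times> {..<n}"
  define F where "F e = (\<Sum>i<n. \<Sum>j<n. e (i, j) *\<^sub>C u i j)" for e :: "nat \<times> nat \<Rightarrow> complex"
  define K where "K = {e. F e \<in> J}"
  have "finite X" by (simp add: X_def)
  moreover have "(\<lambda>_. 0) \<in> K" by (simp add: K_def F_def J_0)
  moreover have "(\<lambda>x. e x + f x) \<in> K" if "e \<in> K" "f \<in> K" for e f
    using J_add[of "F e" "F f"] that by (simp add: K_def F_def scaleC_add_left sum.distrib)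
  moreover have "(\<lambda>x. k * e x) \<in> K" if "e \<in> K" for k e
    using J_scale[of "F e" k] that
    by (simp add: K_def F_def complex_vector.scale_sum_right scaleC_scaleC)
  ultimately obtain d :: nat and e where basis: "\<forall>p<d. e p \<in> K"
    "\<forall>p<d. \<forall>q<d. (\<Sum>x\<in>X. cnj (e p x) * e q x) = (if p = q then 1 else 0)"
    "\<forall>b\<in>K. \<forall>x\<in>X. b x = (\<Sum>p<d. (\<Sum>z\<in>X. cnj (e p z) * b z) * e p x)"
    using orthonormal_basis[of X K] by blast
  then have eK: "\<And>p. p < d \<Longrightarrow> e p \<in> K"
    and orth: "\<And>p q. p < d \<Longrightarrow> q < d \<Longrightarrow> (\<Sum>x\<in>X. cnj (e p x) * e q x) = (if p = q then 1 else 0)"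
    and expand: "\<And>b x. b \<in> K \<Longrightarrow> x \<in> X \<Longrightarrow> b x = (\<Sum>p<d. (\<Sum>z\<in>X. cnj (e p z) * b z) * e p x)"
    by blast+
  have sumX: "(\<Sum>x\<in>X. g x) = (\<Sum>i<n. \<Sum>k<n. g (i, k))" for g :: "nat \<times> nat \<Rightarrow> complex"
    by (simp add: X_def sum.cartesian_product)
  define T where "T p q = (\<Sum>i<n. \<Sum>k<n. \<Sum>j<n. (cnj (e p (i, k)) * e q (i, j)) *\<^sub>C u k j)" for p q
  have lin_y: "clinear (\<lambda>b. \<sigma> (b * y))" for y
    by (simp add: clinear_iff distrib_right lin mult_scaleC_left scaleC_complex_def)
  have coaction: "(\<Sum>j<n. e r (i, j) * \<sigma> (u k j * y)) = (\<Sum>p<d. \<sigma> (T p r * y) * e p (i, k))"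
    if r: "r < d" and ik: "i < n" "k < n" for r i k y
  proof -
    define b where "b = (\<lambda>(i, k). \<Sum>j<n. e r (i, j) * \<sigma> (u k j * y))"
    have "right_slice (\<lambda>b. \<sigma> (b * y)) (\<Delta> (F (e r))) = F b"
    proof -
      have "right_slice (\<lambda>b. \<sigma> (b * y)) (\<Delta> (F (e r)))
        = (\<Sum>i<n. \<Sum>j<n. e r (i, j) *\<^sub>C right_slice (\<lambda>b. \<sigma> (b * y)) (\<Delta> (u i j)))"
        using right_slice_linear[OF lin_y[of y] lin_y[of y]]
        by (simp add: F_def coproduct_sum coproduct_simps right_slice_simps[OF lin_y lin_y] clinear_iff)
      also have "\<dots> = (\<Sum>i<n. \<Sum>j<n. \<Sum>k<n. (e r (i, j) * \<sigma> (u k j * y)) *\<^sub>C u i k)"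
        using u by (intro sum.cong refl) (simp add: unitary_rep_unitary(1) right_slice_simps[OF lin_y lin_y]
            right_slice_tensor[OF lin_y lin_y] complex_vector.scale_sum_right scaleC_scaleC)
      also have "\<dots> = (\<Sum>i<n. \<Sum>k<n. \<Sum>j<n. (e r (i, j) * \<sigma> (u k j * y)) *\<^sub>C u i k)"
        by (intro sum.cong refl sum.swap)
      finally show ?thesis by (simp add: F_def b_def complex_vector.scale_sum_left)
    qed
    then have "b \<in> K" using invariant[of "F (e r)" y] eK[OF r] by (simp add: K_def)
    from expand[OF this, of "(i, k)"] ik
    have "b (i, k) = (\<Sum>p<d. (\<Sum>z\<in>X. cnj (e p z) * b z) * e p (i, k))" by (simp add: X_def)
    moreover have "(\<Sum>z\<in>X. cnj (e p z) * b z) = \<sigma> (T p r * y)" for p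
      by (simp add: sumX b_def T_def sum_distrib_left sum_distrib_right lin mult_scaleC_left mult.assoc)
    ultimately show ?thesis by (simp add: b_def)
  qed
  have isometry: "(\<Sum>p<d. \<sigma> (star (T p q) * T p r * y)) = (if q = r then \<sigma> y else 0)"
    if qr: "q < d" "r < d" for q r y
  proof -
    have star_sum: "star (\<Sum>i\<in>I. g i) = (\<Sum>i\<in>I. star (g i))" for I :: "nat set" and g :: "nat \<Rightarrow> 'p"
      by (induction I rule: infinite_finite_induct) (simp_all add: star_add)
    have starT: "star (T p q) = (\<Sum>i<n. \<Sum>k<n. \<Sum>j<n. (e p (i, k) * cnj (e q (i, j))) *\<^sub>C star (u k j))" for p
      by (simp add: T_def star_sum star_scaleC)
    have "(\<Sum>p<d. \<sigma> (star (T p q) * T p r * y)) = (\<Sum>p<d. \<sigma> (T p r * (y * star (T p q))))"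
      by (intro sum.cong refl) (metis mult.assoc trace)
    also have "\<dots> = (\<Sum>p<d. \<Sum>i<n. \<Sum>k<n. \<Sum>j<n.
        cnj (e q (i, j)) * (\<sigma> (T p r * (y * star (u k j))) * e p (i, k)))"
      by (simp add: starT sum_distrib_left lin mult_scaleC_right mult_ac)
    also have "\<dots> = (\<Sum>i<n. \<Sum>p<d. \<Sum>k<n. \<Sum>j<n.
        cnj (e q (i, j)) * (\<sigma> (T p r * (y * star (u k j))) * e p (i, k)))"
      by (rule sum.swap)
    also have "\<dots> = (\<Sum>i<n. \<Sum>k<n. \<Sum>p<d. \<Sum>j<n.
        cnj (e q (i, j)) * (\<sigma> (T p r * (y * star (u k j))) * e p (i, k)))"
      by (intro sum.cong refl sum.swap)
    also have "\<dots> = (\<Sum>i<n. \<Sum>k<n. \<Sum>j<n. \<Sum>p<d.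
        cnj (e q (i, j)) * (\<sigma> (T p r * (y * star (u k j))) * e p (i, k)))"
      by (intro sum.cong refl sum.swap)
    also have "\<dots> = (\<Sum>i<n. \<Sum>k<n. \<Sum>j<n.
        cnj (e q (i, j)) * (\<Sum>l<n. e r (i, l) * \<sigma> (u k l * (y * star (u k j)))))"
      using qr by (intro sum.cong refl) (simp add: coaction sum_distrib_left)
    also have "\<dots> = (\<Sum>i<n. \<Sum>k<n. \<Sum>j<n. \<Sum>l<n.
        cnj (e q (i, j)) * e r (i, l) * \<sigma> (y * (star (u k j) * u k l)))"
    proof -
      have "\<sigma> (u k l * (y * star (u k j))) = \<sigma> (y * (star (u k j) * u k l))" for k l j
        using trace[of "u k l" "y * star (u k j)"] by (simp add: mult.assoc)
      then show ?thesis by (simp only: sum_distrib_left mult.assoc)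
    qed
    also have "\<dots> = (\<Sum>i<n. \<Sum>j<n. \<Sum>k<n. \<Sum>l<n.
        cnj (e q (i, j)) * e r (i, l) * \<sigma> (y * (star (u k j) * u k l)))"
      by (intro sum.cong refl sum.swap)
    also have "\<dots> = (\<Sum>i<n. \<Sum>j<n. \<Sum>l<n. \<Sum>k<n.
        cnj (e q (i, j)) * e r (i, l) * \<sigma> (y * (star (u k j) * u k l)))"
      by (intro sum.cong refl sum.swap)
    also have "\<dots> = (\<Sum>i<n. \<Sum>j<n. \<Sum>l<n.
        cnj (e q (i, j)) * e r (i, l) * \<sigma> (y * (\<Sum>k<n. star (u k j) * u k l)))"
      by (simp add: sum_distrib_left lin)
    also have "\<dots> = (\<Sum>i<n. \<Sum>j<n. \<Sum>l<n.
        if l = j then cnj (e q (i, j)) * e r (i, l) * \<sigma> y else 0)"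
      using u by (intro sum.cong refl) (simp add: unitary_rep_unitary(3) lin)
    also have "\<dots> = (\<Sum>x\<in>X. cnj (e q x) * e r x) * \<sigma> y"
      by (simp add: sumX sum_distrib_right)
    finally show ?thesis using orth[OF qr] by simp
  qed
  \<comment> \<open>the entries of \<open>T T\<^sup>*\<close>\<close>
  define M where "M p r = (\<Sum>q<d. T p q * star (T r q))" for p r
  have star_M: "star (M p r) = M r p" for p r
  proof -
    have "star (\<Sum>i\<in>I. g i) = (\<Sum>i\<in>I. star (g i))" for I :: "nat set" and g :: "nat \<Rightarrow> 'p"
      by (induction I rule: infinite_finite_induct) (simp_all add: star_add)
    then show ?thesis by (simp add: M_def star_mult star_star)
  qed
  have TT: "(\<Sum>q<d. \<Sum>p<d. \<sigma> (star (T p q) * T p q)) = of_nat d"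
    using isometry[of _ _ 1] \<sigma>1 by simp
  have "(\<Sum>p<d. \<sigma> (M p p)) = (\<Sum>p<d. \<Sum>q<d. \<sigma> (star (T p q) * T p q))"
    by (simp add: M_def lin trace)
  also have "\<dots> = of_nat d" by (subst sum.swap) (rule TT)
  finally have tr_M: "(\<Sum>p<d. \<sigma> (M p p)) = of_nat d" .
  have tr_MM: "(\<Sum>p<d. \<Sum>r<d. \<sigma> (M p r * M r p)) = of_nat d"
  proof -
    have "(\<Sum>p<d. \<Sum>r<d. \<sigma> (M p r * M r p))
      = (\<Sum>p<d. \<Sum>r<d. \<Sum>q<d. \<Sum>s<d. \<sigma> (star (T r q) * T r s * (star (T p s) * T p q)))"
    proof (intro sum.cong refl)
      fix p r
      have "\<sigma> (M p r * M r p) = (\<Sum>q<d. \<Sum>s<d. \<sigma> (T p q * (star (T r q) * T r s * star (T p s))))"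
        unfolding M_def sum_distrib_left sum_distrib_right lin
        by (subst sum.swap) (simp add: mult.assoc)
      also have "\<dots> = (\<Sum>q<d. \<Sum>s<d. \<sigma> (star (T r q) * T r s * (star (T p s) * T p q)))"
        by (intro sum.cong refl) (metis mult.assoc trace)
      finally show "\<sigma> (M p r * M r p) = \<dots>" .
    qed
    also have "\<dots> = (\<Sum>p<d. \<Sum>q<d. \<Sum>r<d. \<Sum>s<d. \<sigma> (star (T r q) * T r s * (star (T p s) * T p q)))"
      by (intro sum.cong refl sum.swap)
    also have "\<dots> = (\<Sum>p<d. \<Sum>q<d. \<Sum>s<d. \<Sum>r<d. \<sigma> (star (T r q) * T r s * (star (T p s) * T p q)))"
      by (intro sum.cong refl sum.swap)
    also have "\<dots> = (\<Sum>p<d. \<Sum>q<d. \<Sum>s<d. if q = s then \<sigma> (star (T p s) * T p q) else 0)"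
      by (intro sum.cong refl isometry) auto
    also have "\<dots> = (\<Sum>p<d. \<Sum>q<d. \<sigma> (star (T p q) * T p q))" by simp
    also have "\<dots> = of_nat d" by (subst sum.swap) (rule TT)
    finally show ?thesis .
  qed
  define Y where "Y p r = (if p = r then 1 else 0) - M p r" for p r
  have sY: "star (Y p r) = Y r p" for p r by (simp add: Y_def star_diff star_M)
  have "(\<Sum>p<d. \<Sum>r<d. \<sigma> (Y p r * star (Y p r)))
      = (\<Sum>p<d. \<Sum>r<d. (if p = r then 1 - 2 * \<sigma> (M p r) else 0) + \<sigma> (M p r * M r p))"
    by (intro sum.cong refl) (simp add: sY, simp add: Y_def left_diff_distrib right_diff_distrib lin \<sigma>1)
  also have "\<dots> = (\<Sum>p<d. 1 - 2 * \<sigma> (M p p)) + of_nat d"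
    by (simp add: sum.distrib tr_MM)
  also have "\<dots> = 0" by (simp add: sum_subtractf tr_M flip: sum_distrib_left)
  finally have zero: "(\<Sum>p<d. \<Sum>r<d. \<sigma> (Y p r * star (Y p r))) = 0" .
  have "\<sigma> (Y p r * star (Y p r)) = 0" if pr: "p < d" "r < d" for p r
  proof -
    have eq: "\<sigma> (Y p r * star (Y p r)) = of_real ((gns_length \<sigma> (star (Y p r)))\<^sup>2)" for p r
      using positive_square[OF \<sigma>, of "star (Y p r)"] by (simp add: star_star)
    have "complex_of_real (\<Sum>p<d. \<Sum>r<d. (gns_length \<sigma> (star (Y p r)))\<^sup>2) = 0"
      using zero by (simp add: eq)
    then have "(\<Sum>p<d. \<Sum>r<d. (gns_length \<sigma> (star (Y p r)))\<^sup>2) = 0"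
      by (simp only: of_real_eq_0_iff)
    then show ?thesis using pr by (simp add: eq sum_nonneg sum_nonneg_eq_0_iff)
  qed
  then have Y_0: "\<sigma> (Y p r) = 0" if "p < d" "r < d" for p r
    using positive_null[OF \<sigma>, of "Y p r" 1] that by simp
  have coisometry: "\<sigma> (M p r) = (if p = r then 1 else 0)" if "p < d" "r < d" for p r
    using Y_0[OF that] by (cases "p = r") (simp_all add: Y_def lin \<sigma>1)
  define tr where "tr b = (\<Sum>i<n. b (i, i))" for b :: "nat \<times> nat \<Rightarrow> complex"
  have counit_F: "\<epsilon> (F b) = tr b" for b
  proof -
    have "\<epsilon> (F b) = (\<Sum>i<n. \<Sum>j<n. if j = i then b (i, j) else 0)"
    proof -
      have "\<epsilon> (F b) = (\<Sum>i<n. \<Sum>j<n. b (i, j) * \<epsilon> (u i j))"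
        by (simp add: F_def clinear_functional_simps[OF counit_linear])
      also have "\<dots> = (\<Sum>i<n. \<Sum>j<n. if j = i then b (i, j) else 0)"
        using u by (intro sum.cong refl) (simp add: counit_coefficient)
      finally show ?thesis .
    qed
    then show ?thesis by (simp add: tr_def)
  qed
  have "tr (e s) = 0" if s: "s < d" for s
  proof -
    have 0: "(\<Sum>p<d. \<sigma> (T p r * star (T s r)) * tr (e p)) = 0" if r: "r < d" for r
    proof -
      have "(\<Sum>p<d. \<sigma> (T p r * star (T s r)) * tr (e p))
          = (\<Sum>i<n. \<Sum>p<d. \<sigma> (T p r * star (T s r)) * e p (i, i))"
        unfolding tr_def sum_distrib_left by (rule sum.swap)
      also have "\<dots> = (\<Sum>i<n. \<Sum>j<n. e r (i, j) * \<sigma> (u i j * star (T s r)))"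
        using r by (intro sum.cong[OF refl]) (simp add: coaction)
      also have "\<dots> = \<sigma> (F (e r) * star (T s r))"
        by (simp add: F_def sum_distrib_right lin mult_scaleC_left)
      also have "\<dots> = 0" using null eK[OF r] by (simp add: K_def)
      finally show ?thesis .
    qed
    have "tr (e s) = (\<Sum>p<d. if p = s then tr (e p) else 0)" using s by simp
    also have "\<dots> = (\<Sum>p<d. \<sigma> (M p s) * tr (e p))"
      using s by (intro sum.cong refl) (simp add: coisometry)
    also have "\<dots> = (\<Sum>p<d. \<Sum>r<d. \<sigma> (T p r * star (T s r)) * tr (e p))"
      by (simp add: M_def lin sum_distrib_right)
    also have "\<dots> = (\<Sum>r<d. \<Sum>p<d. \<sigma> (T p r * star (T s r)) * tr (e p))" by (rule sum.swap)
    also have "\<dots> = 0" using 0 by simp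
    finally show ?thesis .
  qed
  moreover have "tr b = (\<Sum>p<d. (\<Sum>z\<in>X. cnj (e p z) * b z) * tr (e p))" if b: "b \<in> K" for b
  proof -
    have "tr b = (\<Sum>i<n. \<Sum>p<d. (\<Sum>z\<in>X. cnj (e p z) * b z) * e p (i, i))"
      unfolding tr_def by (intro sum.cong refl expand b) (simp add: X_def)
    also have "\<dots> = (\<Sum>p<d. \<Sum>i<n. (\<Sum>z\<in>X. cnj (e p z) * b z) * e p (i, i))" by (rule sum.swap)
    finally show ?thesis by (simp add: tr_def sum_distrib_left)
  qed
  moreover have "a = F (\<lambda>(i, j). c0 i j)" by (simp add: a_eq F_def)
  ultimately show ?thesis using a counit_F[of "\<lambda>(i, j). c0 i j"] by (simp add: K_def)
qed

end

section \<open>Extension by continuity\<close>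

lemma continuous_agree_on_dense:
  fixes F G :: "'c::topological_space \<Rightarrow> 'd::t2_space"
  assumes "continuous_on UNIV F" "continuous_on UNIV G" "closure D = UNIV" "\<And>x. x \<in> D \<Longrightarrow> F x = G x"
  shows "F x = G x"
proof -
  have "closed {x. F x = G x}" using assms by (intro closed_Collect_eq) auto
  then have "closure D \<subseteq> {x. F x = G x}" using assms by (intro closure_minimal) auto
  then show ?thesis using assms(3) by auto
qed

lemma continuous_extension_eqI:
  fixes F :: "'c::topological_space \<Rightarrow> 'd::t2_space"
  assumes dense: "closure (range \<iota>) = UNIV" and F: "continuous_on UNIV F" "\<And>a. F (\<iota> a) = f a"
  shows "continuous_extension \<iota> f = F"
  unfolding continuous_extension_def
proof (rule the_equality)
  fix G assume G: "continuous_on UNIV G \<and> (\<forall>a. G (\<iota> a) = f a)"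
  show "G = F"
  proof
    show "G x = F x" for x
      by (rule continuous_agree_on_dense[OF _ F(1) dense]) (use G F(2) in auto)
  qed
qed (use F in auto)

lemma extension_from_dense:
  fixes \<iota> :: "'p \<Rightarrow> 'c::metric_space" and f :: "'p \<Rightarrow> 'd::complete_space"
  assumes dense: "closure (range \<iota>) = UNIV" and lip: "\<And>a b. dist (f a) (f b) \<le> C * dist (\<iota> a) (\<iota> b)"
  obtains F where "continuous_on UNIV F" "\<And>a. F (\<iota> a) = f a"
proof -
  define g where "g x = f (inv \<iota> x)" for x
  have g: "g (\<iota> a) = f a" for a
  proof -
    have "\<iota> (inv \<iota> (\<iota> a)) = \<iota> a" by (simp add: f_inv_into_f)
    then show ?thesis using lip[of "inv \<iota> (\<iota> a)" a] by (simp add: g_def)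
  qed
  have "uniformly_continuous_on (range \<iota>) g"
    unfolding uniformly_continuous_on_def
  proof (intro allI impI)
    fix e :: real assume e: "e > 0"
    show "\<exists>d>0. \<forall>x\<in>range \<iota>. \<forall>x'\<in>range \<iota>. dist x' x < d \<longrightarrow> dist (g x') (g x) < e"
    proof (intro exI[of _ "e / (\<bar>C\<bar> + 1)"] conjI ballI impI)
      show "e / (\<bar>C\<bar> + 1) > 0" using e by (simp add: add_nonneg_pos)
      fix x x' assume "x \<in> range \<iota>" "x' \<in> range \<iota>" and d: "dist x' x < e / (\<bar>C\<bar> + 1)"
      then obtain a a' where x: "x = \<iota> a" "x' = \<iota> a'" by auto
      have "dist (g x') (g x) \<le> C * dist x' x" using lip by (simp add: x g)
      also have "\<dots> \<le> (\<bar>C\<bar> + 1) * dist x' x" by (intro mult_right_mono) auto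
      also have "\<dots> < e" using d by (simp add: field_simps add_nonneg_pos)
      finally show "dist (g x') (g x) < e" .
    qed
  qed
  then obtain G where "uniformly_continuous_on (closure (range \<iota>)) G" "\<And>x. x \<in> range \<iota> \<Longrightarrow> g x = G x"
    by (rule uniformly_continuous_on_extension_on_closure) blast
  then have "continuous_on UNIV G" "\<And>a. G (\<iota> a) = f a"
    using g by (auto simp: dense uniformly_continuous_imp_continuous)
  then show thesis by (rule that)
qed

section \<open>Tracial states\<close>

lemma norm_star [simp]: "norm (star x) = norm (x :: 'c::cstar_algebra)"
proof -
  have "cstar_seminorm (norm :: 'c \<Rightarrow> real)"
    by (simp add: cstar_seminorm_def norm_triangle_ineq norm_scaleC norm_mult_ineq cstar_identity)
  then show ?thesis by (rule cstar_seminormed.p_star[OF cstar_seminormed.intro])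
qed

lemma star_hom_simps:
  assumes "star_hom \<iota>"
  shows "\<iota> (x + y) = \<iota> x + \<iota> y" "\<iota> (x - y) = \<iota> x - \<iota> y" "\<iota> (c *\<^sub>C x) = c *\<^sub>C \<iota> x" "\<iota> (x * y) = \<iota> x * \<iota> y"
    "\<iota> (star x) = star (\<iota> x)" "\<iota> 1 = 1" "\<iota> 0 = 0"
proof -
  have lin: "clinear \<iota>" using assms by (simp add: star_hom_def)
  show "\<iota> (x + y) = \<iota> x + \<iota> y" "\<iota> (c *\<^sub>C x) = c *\<^sub>C \<iota> x" "\<iota> (x * y) = \<iota> x * \<iota> y"
    "\<iota> (star x) = star (\<iota> x)" "\<iota> 1 = 1"
    using assms by (simp_all add: star_hom_def clinear_iff)
  show "\<iota> (x - y) = \<iota> x - \<iota> y" "\<iota> 0 = 0"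
    using complex_vector.linear_diff[OF lin] complex_vector.linear_0[OF lin] by auto
qed

lemma star_hom_cstar_seminorm:
  assumes "star_hom \<iota>"
  shows "cstar_seminorm (\<lambda>a. norm (\<iota> a :: 'c::cstar_algebra))"
  using star_hom_simps[OF assms]
  by (simp add: cstar_seminorm_def norm_triangle_ineq norm_scaleC norm_mult_ineq cstar_identity)

lemma continuous_star: "continuous_on UNIV (star :: 'c::cstar_algebra \<Rightarrow> 'c)"
proof (rule continuous_on_iff[THEN iffD2], intro ballI allI impI)
  fix x :: 'c and e :: real assume "e > 0"
  then show "\<exists>d>0. \<forall>x'\<in>UNIV. dist x' x < d \<longrightarrow> dist (star x') (star x) < e"
    by (intro exI[of _ e]) (simp add: dist_norm star_diff[symmetric])
qed

lemma continuous_scaleC: "continuous_on UNIV (\<lambda>x :: 'c::cstar_algebra. c *\<^sub>C x)"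
proof -
  have "bounded_linear (\<lambda>x :: 'c. c *\<^sub>C x)"
    by (rule bounded_linear_intro[of _ "cmod c"])
      (simp_all add: scaleC_add_right scaleR_scaleC scaleC_scaleC norm_scaleC mult.commute)
  then show ?thesis by (rule linear_continuous_on)
qed

text \<open>
  Tracial states of a *-algebra without norm. On \<open>Pol\<close> they include the restrictions of the tracial
  states of both completions.
\<close>

definition tracial_functional :: "('a::complex_star_algebra \<Rightarrow> complex) \<Rightarrow> bool"
  where "tracial_functional \<sigma> \<longleftrightarrow>
    positive_functional \<sigma> \<and> (\<forall>x y. \<sigma> (x * y) = \<sigma> (y * x)) \<and> \<sigma> 1 = 1"

lemma tracial_state_functional:
  assumes "tracial_state \<tau>" "star_hom \<iota>"
  shows "tracial_functional (\<lambda>a. \<tau> (\<iota> a))"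
proof -
  note \<tau> = assms(1) and hom = star_hom_simps[OF assms(2)]
  have "\<tau> 1 = 1" using \<tau> by (simp add: tracial_state_def state_on_def)
  moreover have "\<tau> (\<iota> x * \<iota> y) = \<tau> (\<iota> y * \<iota> x)" for x y by (rule tracial_state_commute[OF \<tau>])
  ultimately show ?thesis
    by (simp add: tracial_functional_def positive_functional_def clinear_iff scaleC_complex_def hom
        tracial_state_add[OF \<tau>] tracial_state_scaleC[OF \<tau>] tracial_state_nonneg[OF \<tau>])
qed

lemma tracial_state_bounded:
  assumes \<tau>: "tracial_state (\<tau> :: 'c::cstar_algebra \<Rightarrow> complex)"
  shows "\<exists>C\<ge>0. \<forall>x. cmod (\<tau> x) \<le> C * norm x"
proof -
  have "continuous_on UNIV \<tau>" using \<tau> by (simp add: tracial_state_def state_on_def)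
  then obtain d where d: "d > 0" "\<And>x. norm x < d \<Longrightarrow> cmod (\<tau> x) < 1"
    using tracial_state_0[OF \<tau>] unfolding continuous_on_iff
    by (metis UNIV_I dist_0_norm dist_commute zero_less_one)
  have "cmod (\<tau> x) \<le> (2 / d) * norm x" for x
  proof (cases "x = 0")
    case False
    define c where "c = d / (2 * norm x)"
    have c: "c > 0" using d False by (simp add: c_def)
    have "norm (complex_of_real c *\<^sub>C x) < d"
    proof -
      have "norm (complex_of_real c *\<^sub>C x) = c * norm x" using c by (simp add: norm_scaleC)
      also have "\<dots> < d" using d False by (simp add: c_def)
      finally show ?thesis .
    qed
    from d(2)[OF this] have "c * cmod (\<tau> x) < 1"
      using c by (simp add: tracial_state_scaleC[OF \<tau>] norm_mult)
    then show ?thesis using d False by (simp add: c_def field_simps)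
  qed (simp add: tracial_state_0[OF \<tau>])
  then show ?thesis using d by (intro exI[of _ "2 / d"]) auto
qed

lemma tracial_state_extension:
  fixes \<iota> :: "'p::complex_star_algebra \<Rightarrow> 'c::cstar_algebra"
  assumes \<iota>: "star_hom \<iota>" and dense: "closure (range \<iota>) = UNIV"
    and \<sigma>: "tracial_functional \<sigma>" and bound: "\<And>a. cmod (\<sigma> a) \<le> C * norm (\<iota> a)"
  shows "\<exists>\<tau>. tracial_state \<tau> \<and> (\<forall>a. \<tau> (\<iota> a) = \<sigma> a)"
proof -
  note hom = star_hom_simps[OF \<iota>]
  have pos: "positive_functional \<sigma>" and tr: "\<sigma> (x * y) = \<sigma> (y * x)" and one: "\<sigma> 1 = 1" for x y
    using \<sigma> by (auto simp: tracial_functional_def)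
  note lin = positive_simps[OF pos]
  have "dist (\<sigma> a) (\<sigma> b) \<le> C * dist (\<iota> a) (\<iota> b)" for a b
    using bound[of "a - b"] by (simp add: dist_norm lin hom)
  then obtain F where F: "continuous_on UNIV F" "\<And>a. F (\<iota> a) = \<sigma> a"
    using extension_from_dense[OF dense, of \<sigma> C] by blast
  have cont: "continuous_on UNIV (\<lambda>x. F (g x))" if "continuous_on UNIV g" for g :: "'c \<Rightarrow> 'c"
    using continuous_on_compose2[OF F(1) that] by simp
  note agree = continuous_agree_on_dense[OF _ _ dense]
  have add: "F (x + y) = F x + F y" for x y
  proof -
    have "F (\<iota> a + y) = F (\<iota> a) + F y" for a y
    proof (rule agree[of "\<lambda>y. F (\<iota> a + y)" "\<lambda>y. F (\<iota> a) + F y"])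
      show "F (\<iota> a + y) = F (\<iota> a) + F y" if "y \<in> range \<iota>" for y
        using that by (auto simp: F(2) lin simp flip: hom(1))
    qed (intro cont continuous_intros F(1))+
    note left = this
    show ?thesis
    proof (rule agree[of "\<lambda>x. F (x + y)" "\<lambda>x. F x + F y"])
      show "F (x + y) = F x + F y" if "x \<in> range \<iota>" for x
        using that left by auto
    qed (intro cont continuous_intros F(1))+
  qed
  have scale: "F (c *\<^sub>C x) = c * F x" for c x
  proof (rule agree[of "\<lambda>x. F (c *\<^sub>C x)" "\<lambda>x. c * F x"])
    show "F (c *\<^sub>C x) = c * F x" if "x \<in> range \<iota>" for x
      using that by (auto simp: F(2) lin simp flip: hom(3))
  qed (intro cont continuous_scaleC continuous_intros F(1))+
  have trace: "F (x * y) = F (y * x)" for x y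
  proof -
    have "F (\<iota> a * y) = F (y * \<iota> a)" for a y
    proof (rule agree[of "\<lambda>y. F (\<iota> a * y)" "\<lambda>y. F (y * \<iota> a)"])
      show "F (\<iota> a * y) = F (y * \<iota> a)" if y: "y \<in> range \<iota>" for y
      proof -
        obtain b where "y = \<iota> b" using y by auto
        then show ?thesis using tr[of a b] by (simp add: F(2) flip: hom(4))
      qed
    qed (intro cont continuous_intros)+
    note left = this
    show ?thesis
    proof (rule agree[of "\<lambda>x. F (x * y)" "\<lambda>x. F (y * x)"])
      show "F (x * y) = F (y * x)" if "x \<in> range \<iota>" for x
        using that left by auto
    qed (intro cont continuous_intros)+
  qed
  have positive: "F (star x * x) \<in> \<real>\<^sub>\<ge>\<^sub>0" for x
  proof -
    have "continuous_on UNIV (\<lambda>x. F (star x * x))"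
      by (intro cont continuous_intros continuous_star)
    then have "closed ((\<lambda>x. F (star x * x)) -` \<real>\<^sub>\<ge>\<^sub>0)"
      by (intro closed_vimage closed_nonneg_Reals_complex)
    moreover have "range \<iota> \<subseteq> (\<lambda>x. F (star x * x)) -` \<real>\<^sub>\<ge>\<^sub>0"
      using pos by (auto simp: hom(4,5)[symmetric] F(2) positive_functional_def)
    ultimately have "closure (range \<iota>) \<subseteq> (\<lambda>x. F (star x * x)) -` \<real>\<^sub>\<ge>\<^sub>0" by (intro closure_minimal)
    then show ?thesis using dense by auto
  qed
  have "F 1 = 1" using F(2)[of 1] by (simp add: hom one)
  then have "tracial_state F"
    using add scale F(1) positive trace by (simp add: tracial_state_def state_on_def)
  then show ?thesis using F(2) by blast
qed

lemma kac_map_eq_0_iff: "kac_map \<iota> a = 0 \<longleftrightarrow> \<iota> a \<in> kac_ideal"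
proof -
  have "kac_map \<iota> a = 0 \<longleftrightarrow> \<iota> a - 0 \<in> kac_ideal"
    unfolding kac_map_def zero_kac_quotient_def by (simp only: kac_quotient.abs_eq_iff)
  then show ?thesis by simp
qed

lemma kac_map_linear: "star_hom \<iota> \<Longrightarrow> clinear (kac_map \<iota>)"
  by (simp add: clinear_iff kac_map_def star_hom_simps plus_kac_quotient.abs_eq scaleC_kac_quotient.abs_eq)

lemma kac_map_one: "star_hom \<iota> \<Longrightarrow> kac_map \<iota> 1 = 1"
  by (simp add: kac_map_def star_hom_simps one_kac_quotient_def)

lemma star_hom_in_kac_ideal_iff:
  fixes \<iota> :: "'p::complex_star_algebra \<Rightarrow> 'c::cstar_algebra"
  assumes "star_hom \<iota>"
  shows "\<iota> a \<in> kac_ideal \<longleftrightarrow> (\<forall>\<tau> y. tracial_state \<tau> \<longrightarrow> \<tau> (\<iota> (a * y)) = 0)"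
proof
  assume "\<iota> a \<in> kac_ideal"
  then show "\<forall>\<tau> y. tracial_state \<tau> \<longrightarrow> \<tau> (\<iota> (a * y)) = 0"
    by (simp add: kac_ideal_iff star_hom_simps[OF assms])
next
  assume *: "\<forall>\<tau> y. tracial_state \<tau> \<longrightarrow> \<tau> (\<iota> (a * y)) = 0"
  then have "\<tau> (\<iota> (a * star a)) = 0" if "tracial_state \<tau>" for \<tau> using that by blast
  then show "\<iota> a \<in> kac_ideal" by (simp add: kac_ideal_def star_hom_simps[OF assms])
qed

section \<open>The reduced Kac ideal\<close>

locale reduced_cqg = cqg \<Delta> \<epsilon> S
  for \<Delta> :: "'p::complex_star_algebra \<Rightarrow> 'p \<otimes> 'p" and \<epsilon> :: "'p \<Rightarrow> complex" and S :: "'p \<Rightarrow> 'p" +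
  fixes h :: "'p \<Rightarrow> complex" and \<iota>\<^sub>r :: "'p \<Rightarrow> 'r::cstar_algebra"
  assumes haar: "haar_state \<Delta> h" and reduced: "reduced_completion h \<iota>\<^sub>r"
begin

lemma reduced_hom: "star_hom \<iota>\<^sub>r" and reduced_norm: "norm (\<iota>\<^sub>r a) = gns_norm h a"
  and reduced_dense: "closure (range \<iota>\<^sub>r) = UNIV"
  using reduced by (auto simp: reduced_completion_def cstar_completion_def)

lemma gns_norm_cstar_seminorm: "cstar_seminorm (gns_norm h)"
  using star_hom_cstar_seminorm[OF reduced_hom] by (simp add: reduced_norm)

text \<open>
  The convolution is the composition of the state with the slice map of \<open>\<sigma>\<close>, which is contractive
  for the reduced norm; so it extends to \<open>C\<^sub>r\<close>.
\<close>

lemma convolution_tracial_state: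
  assumes \<tau>: "tracial_state (\<tau> :: 'r \<Rightarrow> complex)" and \<sigma>: "tracial_functional \<sigma>"
  shows "\<exists>\<tau>'. tracial_state \<tau>' \<and> (\<forall>a. \<tau>' (\<iota>\<^sub>r a) = tensor_functional (\<lambda>a. \<tau> (\<iota>\<^sub>r a)) \<sigma> (\<Delta> a))"
proof -
  define \<tau>r where "\<tau>r a = \<tau> (\<iota>\<^sub>r a)" for a
  have \<tau>r: "tracial_functional \<tau>r"
    unfolding \<tau>r_def by (rule tracial_state_functional[OF \<tau> reduced_hom])
  have pos: "positive_functional \<tau>r" "positive_functional \<sigma>" and one: "\<tau>r 1 = 1" "\<sigma> 1 = 1"
    and tr: "\<And>x y. \<tau>r (x * y) = \<tau>r (y * x)" "\<And>x y. \<sigma> (x * y) = \<sigma> (y * x)"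
    using \<tau>r \<sigma> by (auto simp: tracial_functional_def)
  note lin = positive_linear[OF pos(1)] positive_linear[OF pos(2)]
  define \<phi> where "\<phi> a = tensor_functional \<tau>r \<sigma> (\<Delta> a)" for a
  have slice: "\<phi> a = \<tau>r (convolve \<sigma> a)" for a
    using tensor_functional_right_slice[OF lin, of 1 "\<Delta> a" 1]
    by (simp add: \<phi>_def convolve_def flip: one_tensor_eq)
  have "tracial_functional \<phi>"
    unfolding tracial_functional_def positive_functional_def
  proof (intro conjI allI)
    show "clinear \<phi>"
      by (simp add: clinear_iff \<phi>_def coproduct_simps tensor_functional_simps[OF lin] scaleC_complex_def)
    show "\<phi> (star x * x) \<in> \<real>\<^sub>\<ge>\<^sub>0" for x
      using tensor_functional_positive[OF pos] by (simp add: \<phi>_def coproduct_simps positive_functional_def)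
    show "\<phi> (x * y) = \<phi> (y * x)" for x y
      unfolding \<phi>_def coproduct_simps by (rule tensor_functional_tracial[OF lin tr])
    show "\<phi> 1 = 1"
      by (simp add: \<phi>_def coproduct_simps one_tensor_eq tensor_functional_tensor[OF lin] one)
  qed
  moreover obtain C where C: "C \<ge> 0" "\<And>x. cmod (\<tau> x) \<le> C * norm x"
    using tracial_state_bounded[OF \<tau>] by blast
  have "cmod (\<phi> a) \<le> C * norm (\<iota>\<^sub>r a)" for a
  proof -
    have "cmod (\<phi> a) \<le> C * gns_norm h (convolve \<sigma> a)"
      using C(2)[of "\<iota>\<^sub>r (convolve \<sigma> a)"] by (simp add: slice \<tau>r_def reduced_norm)
    also have "\<dots> \<le> C * gns_norm h a"
      by (intro mult_left_mono gns_norm_convolve haar pos one gns_norm_cstar_seminorm C)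
    finally show ?thesis by (simp add: reduced_norm)
  qed
  ultimately show ?thesis
    using tracial_state_extension[OF reduced_hom reduced_dense, of \<phi> C] by (simp add: \<phi>_def \<tau>r_def[abs_def])
qed

text \<open>
  For a tracial state \<open>\<tau>\<close> of \<open>C\<^sub>r\<close>, the convolution of \<open>\<tau>\<close> and \<open>\<sigma>\<close> vanishes at \<open>a a\<^sup>*\<close>. So \<open>\<Delta> a (\<Delta> a)\<^sup>*\<close> is a
  null element of \<open>\<tau> \<otimes> \<sigma>\<close>, and Cauchy-Schwarz gives \<open>(\<tau> \<otimes> \<sigma>) (\<Delta> a (x \<otimes> y)) = 0\<close> for all \<open>x\<close> and \<open>y\<close>.
\<close>

lemma reduced_kac_ideal_invariant:
  assumes a: "\<iota>\<^sub>r a \<in> kac_ideal" and \<sigma>: "tracial_functional \<sigma>"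
  shows "\<iota>\<^sub>r (right_slice (\<lambda>b. \<sigma> (b * y)) (\<Delta> a)) \<in> kac_ideal"
  unfolding star_hom_in_kac_ideal_iff[OF reduced_hom]
proof (intro allI impI)
  fix \<tau> :: "'r \<Rightarrow> complex" and x assume \<tau>: "tracial_state \<tau>"
  define \<tau>r where "\<tau>r a = \<tau> (\<iota>\<^sub>r a)" for a
  have \<tau>r: "tracial_functional \<tau>r"
    unfolding \<tau>r_def by (rule tracial_state_functional[OF \<tau> reduced_hom])
  have pos: "positive_functional \<tau>r" "positive_functional \<sigma>"
    using \<tau>r \<sigma> by (auto simp: tracial_functional_def)
  note lin = positive_linear[OF pos(1)] positive_linear[OF pos(2)]
  have lin_y: "clinear (\<lambda>b. \<sigma> (b * y))"
    by (simp add: clinear_iff distrib_right positive_simps[OF pos(2)] mult_scaleC_left scaleC_complex_def)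
  obtain \<tau>' where \<tau>': "tracial_state \<tau>'" "\<And>a. \<tau>' (\<iota>\<^sub>r a) = tensor_functional \<tau>r \<sigma> (\<Delta> a)"
    using convolution_tracial_state[OF \<tau> \<sigma>] by (auto simp: \<tau>r_def[abs_def])
  have "tensor_functional \<tau>r \<sigma> (\<Delta> a * star (\<Delta> a)) = \<tau>' (\<iota>\<^sub>r (a * star a))"
    by (simp add: \<tau>' coproduct_simps)
  also have "\<dots> = 0" using a \<tau>'(1) star_hom_in_kac_ideal_iff[OF reduced_hom] by blast
  finally have "tensor_functional \<tau>r \<sigma> (\<Delta> a * (x \<otimes> y)) = 0"
    by (rule positive_null[OF tensor_functional_positive[OF pos]])
  moreover have "tensor_functional \<tau>r \<sigma> (t * (x \<otimes> y)) = \<tau>r (right_slice (\<lambda>b. \<sigma> (b * y)) t * x)" for t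
    by (induction t rule: tensor_induct)
      (simp_all add: tensor_functional_simps[OF lin] tensor_functional_tensor[OF lin] right_slice_simps[OF lin_y lin_y]
        right_slice_tensor[OF lin_y lin_y] distrib_right times_tensor_tensor positive_simps[OF pos(1)] mult_scaleC_left)
  ultimately show "\<tau> (\<iota>\<^sub>r (right_slice (\<lambda>b. \<sigma> (b * y)) (\<Delta> a) * x)) = 0" by (simp add: \<tau>r_def)
qed

lemma counit_vanishes_on_reduced_kac_ideal:
  assumes \<tau>: "tracial_state (\<tau> :: 'r \<Rightarrow> complex)" and a: "\<iota>\<^sub>r a \<in> kac_ideal"
  shows "\<epsilon> a = 0"
proof (rule counit_vanishes_on_invariant_subspace)
  have \<sigma>: "tracial_functional (\<lambda>a. \<tau> (\<iota>\<^sub>r a))" by (rule tracial_state_functional[OF \<tau> reduced_hom])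
  then show "positive_functional (\<lambda>a. \<tau> (\<iota>\<^sub>r a))" "\<tau> (\<iota>\<^sub>r (x * y)) = \<tau> (\<iota>\<^sub>r (y * x))" "\<tau> (\<iota>\<^sub>r 1) = 1" for x y
    by (auto simp: tracial_functional_def)
  show "right_slice (\<lambda>b. \<tau> (\<iota>\<^sub>r (b * y))) (\<Delta> x) \<in> {a. \<iota>\<^sub>r a \<in> kac_ideal}" if "x \<in> {a. \<iota>\<^sub>r a \<in> kac_ideal}" for x y
    using reduced_kac_ideal_invariant[OF _ \<sigma>, of x y] that by simp
  show "\<tau> (\<iota>\<^sub>r (x * y)) = 0" if "x \<in> {a. \<iota>\<^sub>r a \<in> kac_ideal}" for x y
    using that \<tau> star_hom_in_kac_ideal_iff[OF reduced_hom] by blast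
qed (use a in \<open>simp_all add: star_hom_simps[OF reduced_hom] kac_ideal_0 kac_ideal_add kac_ideal_scaleC\<close>)

text \<open>
  The counit, applied to the slice of \<open>\<Delta> a\<close> by \<open>\<sigma>(- y)\<close>, which stays in the ideal, gives \<open>\<sigma> (a y)\<close>.
\<close>

lemma tracial_functional_vanishes_on_reduced_kac_ideal:
  assumes \<tau>: "tracial_state (\<tau> :: 'r \<Rightarrow> complex)" and a: "\<iota>\<^sub>r a \<in> kac_ideal" and \<sigma>: "tracial_functional \<sigma>"
  shows "\<sigma> (a * y) = 0"
proof -
  have pos: "positive_functional \<sigma>" using \<sigma> by (simp add: tracial_functional_def)
  have lin_y: "clinear (\<lambda>b. \<sigma> (b * y))"
    by (simp add: clinear_iff distrib_right positive_simps[OF pos] mult_scaleC_left scaleC_complex_def)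
  have "\<epsilon> (right_slice (\<lambda>b. \<sigma> (b * y)) t) = \<sigma> (left_slice \<epsilon> t * y)" for t
    by (induction t rule: tensor_induct)
      (simp_all add: right_slice_simps[OF lin_y lin_y] right_slice_tensor[OF lin_y lin_y]
        left_slice_simps[OF counit_linear counit_linear] left_slice_tensor[OF counit_linear counit_linear]
        clinear_functional_simps[OF counit_linear] positive_simps[OF pos] distrib_right mult_scaleC_left mult.commute)
  then have "\<sigma> (a * y) = \<epsilon> (right_slice (\<lambda>b. \<sigma> (b * y)) (\<Delta> a))" by (simp add: counit_left)
  also have "\<dots> = 0"
    by (rule counit_vanishes_on_reduced_kac_ideal[OF \<tau> reduced_kac_ideal_invariant[OF a \<sigma>]])
  finally show ?thesis .
qed

text \<open>
  Apply the counit to the first leg of \<open>(id \<otimes> \<pi>) (\<Delta> a) = a \<otimes> 1\<close>.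
\<close>

lemma kac_map_on_pol_quotient:
  assumes \<iota>: "star_hom (\<iota> :: 'p \<Rightarrow> 'c::cstar_algebra)" and a: "a \<in> pol_quotient \<Delta> (kac_map \<iota>)"
  shows "kac_map \<iota> a = \<epsilon> a *\<^sub>C 1"
proof -
  define B where "B = (\<lambda>x (y :: 'c kac_quotient). \<epsilon> x *\<^sub>C y)"
  have B: "cbilinear B"
    by (simp add: cbilinear_iff B_def clinear_functional_simps[OF counit_linear] scaleC_add_left scaleC_add_right
        scaleC_scaleC mult.commute)
  have B_tensor: "tensor_lift B (x \<otimes> y) = \<epsilon> x *\<^sub>C y" for x y
    by (simp add: tensor_lift_tensor[OF B]) (simp add: B_def)
  note kl = kac_map_linear[OF \<iota>]
  have id: "clinear (id :: 'p \<Rightarrow> 'p)" by (simp add: clinear_iff)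
  have tm_lin: "tensor_map id (kac_map \<iota>) (s + t) =
      tensor_map id (kac_map \<iota>) s + tensor_map id (kac_map \<iota>) t" for s t :: "'p \<otimes> 'p"
    by (induct s rule: tensor.abs_induct, induct t rule: tensor.abs_induct)
      (simp add: plus_tensor.abs_eq tensor_map_abs[OF id kl])
  have tm_0: "tensor_map id (kac_map \<iota>) (0 :: 'p \<otimes> 'p) = 0"
    using tm_lin[of 0 0] by simp
  have "tensor_lift B (tensor_map id (kac_map \<iota>) t) = kac_map \<iota> (left_slice \<epsilon> t)" for t
    using kl
    by (induction t rule: tensor_induct)
      (simp_all add: tm_lin tm_0 tensor_map_tensor[OF id kl] tensor_lift_add[OF B] tensor_lift_zero[OF B] B_tensor
        left_slice_simps[OF counit_linear counit_linear] left_slice_tensor[OF counit_linear counit_linear]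
        clinear_iff complex_vector.linear_0[OF kl])
  from this[of "\<Delta> a"] show ?thesis
    using a by (simp add: pol_quotient_def counit_left B_tensor)
qed

lemma tracial_state_on_pol_quotient:
  assumes \<tau>: "tracial_state (\<tau> :: 'r \<Rightarrow> complex)" and a: "a \<in> pol_quotient \<Delta> (kac_map \<iota>\<^sub>r)"
  shows "\<tau> (\<iota>\<^sub>r a) = \<epsilon> a"
proof -
  note hom = star_hom_simps[OF reduced_hom]
  have "kac_map \<iota>\<^sub>r (a - \<epsilon> a *\<^sub>C 1) = 0"
    using kac_map_on_pol_quotient[OF reduced_hom a] kac_map_linear[OF reduced_hom]
    by (simp add: complex_vector.linear_diff complex_vector.linear_scale kac_map_one[OF reduced_hom])
  then have "\<iota>\<^sub>r (a - \<epsilon> a *\<^sub>C 1) \<in> kac_ideal" by (simp add: kac_map_eq_0_iff)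
  then have "\<tau> (\<iota>\<^sub>r ((a - \<epsilon> a *\<^sub>C 1) * 1)) = 0"
    using \<tau> star_hom_in_kac_ideal_iff[OF reduced_hom] by blast
  moreover have "\<tau> 1 = 1" using \<tau> by (simp add: tracial_state_def state_on_def)
  ultimately show ?thesis
    by (simp add: hom tracial_state_diff[OF \<tau>] tracial_state_scaleC[OF \<tau>])
qed

end

theorem proposition3p5:
  fixes \<Delta> :: "'p::complex_star_algebra \<Rightarrow> 'p \<otimes> 'p"
    and \<epsilon> :: "'p \<Rightarrow> complex" and S :: "'p \<Rightarrow> 'p" and h :: "'p \<Rightarrow> complex"
    and \<iota>\<^sub>u :: "'p \<Rightarrow> 'u::cstar_algebra" and \<iota>\<^sub>r :: "'p \<Rightarrow> 'r::cstar_algebra"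
  assumes "compact_quantum_group \<Delta> \<epsilon> S"
    and "haar_state \<Delta> h"
    and "universal_completion \<iota>\<^sub>u"
    and "reduced_completion h \<iota>\<^sub>r"
    and "\<exists>\<tau> :: 'r \<Rightarrow> complex. tracial_state \<tau>"
  shows "equal_subgroups (kac_map \<iota>\<^sub>r) (kac_map \<iota>\<^sub>u) \<and>
    coamenable_quotient \<Delta> \<epsilon> \<iota>\<^sub>u \<iota>\<^sub>r (kac_map \<iota>\<^sub>r)"
proof -
  interpret reduced_cqg \<Delta> \<epsilon> S h \<iota>\<^sub>r by standard (rule assms)+
  have u_hom: "star_hom \<iota>\<^sub>u" and u_norm: "norm (\<iota>\<^sub>u a) = universal_norm a"
    and u_dense: "closure (range \<iota>\<^sub>u) = UNIV" for a
    using assms(3) by (auto simp: universal_completion_def cstar_completion_def)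
  obtain \<tau>\<^sub>0 :: "'r \<Rightarrow> complex" where \<tau>\<^sub>0: "tracial_state \<tau>\<^sub>0" using assms(5) by blast
  have r_le_u: "norm (\<iota>\<^sub>r a) \<le> norm (\<iota>\<^sub>u a)" for a
    unfolding u_norm by (rule cstar_seminorm_le_universal_norm[OF star_hom_cstar_seminorm[OF reduced_hom]])
  have "cstar_seminorm (\<lambda>a. cmod (\<epsilon> a))"
    by (simp add: cstar_seminorm_def clinear_functional_simps[OF counit_linear] counit_mult counit_star norm_triangle_ineq
        norm_mult power2_eq_square)
  then have counit_le_u: "cmod (\<epsilon> a) \<le> norm (\<iota>\<^sub>u a)" for a
    unfolding u_norm by (rule cstar_seminorm_le_universal_norm)
  have "\<iota>\<^sub>r a \<in> kac_ideal \<longleftrightarrow> \<iota>\<^sub>u a \<in> kac_ideal" for a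
  proof
    assume a: "\<iota>\<^sub>r a \<in> kac_ideal"
    show "\<iota>\<^sub>u a \<in> kac_ideal"
      unfolding star_hom_in_kac_ideal_iff[OF u_hom]
    proof (intro allI impI)
      fix \<tau> :: "'u \<Rightarrow> complex" and y assume "tracial_state \<tau>"
      then show "\<tau> (\<iota>\<^sub>u (a * y)) = 0"
        by (rule tracial_functional_vanishes_on_reduced_kac_ideal[OF \<tau>\<^sub>0 a tracial_state_functional[OF _ u_hom]])
    qed
  next
    assume a: "\<iota>\<^sub>u a \<in> kac_ideal"
    show "\<iota>\<^sub>r a \<in> kac_ideal"
      unfolding star_hom_in_kac_ideal_iff[OF reduced_hom]
    proof (intro allI impI)
      fix \<tau> :: "'r \<Rightarrow> complex" and y assume \<tau>: "tracial_state \<tau>"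
      obtain C where C: "C \<ge> 0" "\<And>x. cmod (\<tau> x) \<le> C * norm x"
        using tracial_state_bounded[OF \<tau>] by blast
      have "cmod (\<tau> (\<iota>\<^sub>r a)) \<le> C * norm (\<iota>\<^sub>u a)" for a
        using C(2)[of "\<iota>\<^sub>r a"] mult_left_mono[OF r_le_u[of a] C(1)] by linarith
      then obtain \<tau>' where "tracial_state \<tau>'" "\<And>a. \<tau>' (\<iota>\<^sub>u a) = \<tau> (\<iota>\<^sub>r a)"
        using tracial_state_extension[OF u_hom u_dense tracial_state_functional[OF \<tau> reduced_hom]] by blast
      then show "\<tau> (\<iota>\<^sub>r (a * y)) = 0"
        using a star_hom_in_kac_ideal_iff[OF u_hom] by metis
    qed
  qed
  then have "equal_subgroups (kac_map \<iota>\<^sub>r) (kac_map \<iota>\<^sub>u)"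
    by (simp add: equal_subgroups_def kac_map_eq_0_iff)
  moreover have "coamenable_quotient \<Delta> \<epsilon> \<iota>\<^sub>u \<iota>\<^sub>r (kac_map \<iota>\<^sub>r)"
    unfolding coamenable_quotient_def
  proof (intro exI[of _ \<tau>\<^sub>0] conjI ballI)
    show "state_on (closure (\<iota>\<^sub>r ` pol_quotient \<Delta> (kac_map \<iota>\<^sub>r))) \<tau>\<^sub>0"
      using \<tau>\<^sub>0 by (auto simp: tracial_state_def state_on_def intro: continuous_on_subset)
    have "dist (\<iota>\<^sub>r a) (\<iota>\<^sub>r b) \<le> 1 * dist (\<iota>\<^sub>u a) (\<iota>\<^sub>u b)" for a b
      using r_le_u[of "a - b"] by (simp add: dist_norm star_hom_simps[OF reduced_hom] star_hom_simps[OF u_hom])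
    then obtain \<Gamma> where \<Gamma>: "continuous_on UNIV \<Gamma>" "\<And>a. \<Gamma> (\<iota>\<^sub>u a) = \<iota>\<^sub>r a"
      using extension_from_dense[OF u_dense, of \<iota>\<^sub>r 1] by blast
    have "dist (\<epsilon> a) (\<epsilon> b) \<le> 1 * dist (\<iota>\<^sub>u a) (\<iota>\<^sub>u b)" for a b
      using counit_le_u[of "a - b"]
      by (simp add: dist_norm clinear_functional_simps[OF counit_linear] star_hom_simps[OF u_hom])
    then obtain \<epsilon>\<^sub>u where \<epsilon>\<^sub>u: "continuous_on UNIV \<epsilon>\<^sub>u" "\<And>a. \<epsilon>\<^sub>u (\<iota>\<^sub>u a) = \<epsilon> a"
      using extension_from_dense[OF u_dense, of \<epsilon> 1] by blast
    have "continuous_on UNIV \<tau>\<^sub>0" using \<tau>\<^sub>0 by (simp add: tracial_state_def state_on_def)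
    then have "continuous_on UNIV (\<lambda>x. \<tau>\<^sub>0 (\<Gamma> x))"
      using continuous_on_compose2[OF _ \<Gamma>(1)] by blast
    then have "closed {x. \<tau>\<^sub>0 (\<Gamma> x) = \<epsilon>\<^sub>u x}" using \<epsilon>\<^sub>u(1) by (intro closed_Collect_eq)
    moreover have "\<iota>\<^sub>u ` pol_quotient \<Delta> (kac_map \<iota>\<^sub>r) \<subseteq> {x. \<tau>\<^sub>0 (\<Gamma> x) = \<epsilon>\<^sub>u x}"
      using tracial_state_on_pol_quotient[OF \<tau>\<^sub>0] by (auto simp: \<Gamma> \<epsilon>\<^sub>u)
    ultimately have "closure (\<iota>\<^sub>u ` pol_quotient \<Delta> (kac_map \<iota>\<^sub>r)) \<subseteq> {x. \<tau>\<^sub>0 (\<Gamma> x) = \<epsilon>\<^sub>u x}"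
      by (intro closure_minimal)
    then show "\<tau>\<^sub>0 (continuous_extension \<iota>\<^sub>u \<iota>\<^sub>r x) = continuous_extension \<iota>\<^sub>u \<epsilon> x"
      if "x \<in> closure (\<iota>\<^sub>u ` pol_quotient \<Delta> (kac_map \<iota>\<^sub>r))" for x
      using that continuous_extension_eqI[OF u_dense \<Gamma>] continuous_extension_eqI[OF u_dense \<epsilon>\<^sub>u] by auto
  qed
  ultimately show ?thesis by blast
qed

end
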